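(* Let $\beta>0$, $r>0$, $s\ge0$ be constants, and suppose that, for each $n$, $\epsilon=n^{-\beta}$ and $\theta\in\mathbb{R}^p$, $\eta\in\mathbb{R}^q$ (with $\theta,\eta,p,q$ allowed to depend on $n$) satisfy $$\frac{2\|\theta\|\|\eta\|}{\sqrt{\|\theta\|^2+\|\eta\|^2}}=\sqrt{2r\log n},\qquad \frac{\big|\|\theta\|^2-\|\eta\|^2\big|}{\sqrt{\|\theta\|^2+\|\eta\|^2}}=\sqrt{2s\log n}.$$ Let $\widehat\theta,\widehat\eta$ be the estimators computed from the subsample $\mathcal D_0$, and $\widehat\psi_{\rm ada\text{-}HC}$ the adaptive test, described in the context. Assume that there is some constant $\gamma>0$ such that $$\lim_{n\to\infty}\sup_{z,\sigma\in\{-1,1\}^n}P^{(n)}_{(\theta,\eta,z,\sigma)}\Big(L(\widehat\theta,\theta)\vee L(\widehat\eta,\eta)>n^{-\gamma}\Big)=0.$$ If $\beta<\beta^*(r,s)$, then $\lim_{n\to\infty}R_n(\widehat\psi_{\rm ada\text{-}HC},\theta,\eta,\epsilon)=0$.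
   Context: Model: for $z,\sigma\in\{-1,1\}^n$, $P^{(n)}_{(\theta,\eta,z,\sigma)}$ is the joint law of independent $X_i\sim N(z_i\theta,I_p)$, $Y_i\sim N(\sigma_i\eta,I_q)$, $i\in[n]$ (together with the independent data-splitting variables below). Write $a\wedge b=\min(a,b)$, $a\vee b=\max(a,b)$, $a_+=\max(a,0)$, and $\ell(z,\sigma)=\big(\frac1n\sum_i\mathbf 1\{z_i\ne\sigma_i\}\big)\wedge\big(\frac1n\sum_i\mathbf 1\{z_i\ne-\sigma_i\}\big)$. For a test $\psi$ ($P\psi$ denotes expectation), $$R_n(\psi,\theta,\eta,\epsilon)=\sup_{z,\sigma\in\{-1,1\}^n:\,\ell(z,\sigma)=0}P^{(n)}_{(\theta,\eta,z,\sigma)}\psi+\sup_{z,\sigma\in\{-1,1\}^n:\,\ell(z,\sigma)>\epsilon}P^{(n)}_{(\theta,\eta,z,\sigma)}(1-\psi).$$ Losses: $L(\widehat\theta,\theta)=\|\widehat\theta-\theta\|\wedge\|\widehat\theta+\theta\|$ and $L(\widehat\eta,\eta)=\|\widehat\eta-\eta\|\wedge\|\widehat\eta+\eta\|$. Threshold function: with $A=r+s-\sqrt s\sqrt{r+s}$, $$\beta^*(r,s)=\begin{cases}\frac12+2A, & 3s>r \text{ and } A\le\frac18,\\ \frac12(1+3r-s), & 3s\le r\text{ and }5r+s\le1,\\ 2\sqrt r\sqrt{1-r-s}, & 5r+s>1,\ \frac18<A\le\frac12,\ 2(1-r-s)A>r,\\ 2\sqrt{2A}-2A, & 5r+s>1,\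 \frac18<A\le\frac12,\ 2(1-r-s)A\le r,\\ 1, & A>\frac12.\end{cases}$$ For $r,s\geq 0$ let $S_{(r,s)}(t)=\mathbb P\big(|\sqrt rU+\sqrt sV|-\sqrt{r+s}|V|>t\big)$, where $(U,V)\sim\frac12N(0,1)\otimes N(-\sqrt{2(r+s)\log n},1)+\frac12N(0,1)\otimes N(\sqrt{2(r+s)\log n},1)$. For scalars $x,y,a,b$ let $C^-(x,y,a,b)=|ax-by|-|ax+by|$ and $C^+(x,y,a,b)=|ax+by|-|ax-by|$. Adaptive test: draw $d_1,\dots,d_n$ i.i.d. uniform on $\{0,1,2\}$, independent of the data, and let $\mathcal D_m=\{i\in[n]:d_i=m\}$, $m\in\{0,1,2\}$. Given estimation algorithms $\widehat\theta(\cdot)$, $\widehat\eta(\cdot)$, set $\widehat\theta=\widehat\theta(\{(X_i,Y_i)\}_{i\in\mathcal D_0})$ and $\widehat\eta=\widehat\eta(\{(X_i,Y_i)\}_{i\in\mathcal D_0})$. For $i\in\mathcal D_1\cup\mathcal D_2$ let $\widehat X_i=\widehat\theta^TX_i/\|\widehat\theta\|$ and $\widehat Y_i=\widehat\eta^TY_i/\|\widehat\eta\|$. Let $$\widehat a=\sqrt{\Big(\frac1{|\mathcal D_1|}\sum_{i\in\mathcal D_1}\widehat X_i^2-1\Big)_+},\quad \widehat b=\sqrt{\Big(\frac1{|\mathcal D_1|}\sum_{i\in\mathcal D_1}\widehat Y_i^2-1\Big)_+},$$ $$\widehat r=\frac{(2|\widehat a||\widehat b|)^2}{(2\log n)(\widehat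 a^2+\widehat b^2)},\quad \widehat s=\frac{|\widehat a^2-\widehat b^2|^2}{(2\log n)(\widehat a^2+\widehat b^2)},$$ $$\widehat T_n^{\pm}=\sup_{|t|\le\log n}\frac{\left|\sum_{i\in\mathcal D_2}\mathbf 1\{C^{\pm}(\widehat X_i,\widehat Y_i,\widehat a,\widehat b)>t\sqrt{2\log n}\}-|\mathcal D_2|S_{(\widehat r,\widehat s)}(t)\right|}{\sqrt{|\mathcal D_2|S_{(\widehat r,\widehat s)}(t)}},$$ and $\widehat\psi_{\rm ada\text{-}HC}=\mathbf 1\{\widehat T_n^-\wedge\widehat T_n^+>(\log n)^3\}$ (with an arbitrary value wherever these formulas are undefined because of an empty subsample or a zero denominator). *)

theory Defs
  imports "HOL-Probability.Probability"
begin

text \<open>Since the dimensions \<open>p\<close>, \<open>q\<close> and the sample size \<open>n\<close> vary with \<open>n\<close>, a vector of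
  $\mathbb{R}^p$ is a function \<open>nat \<Rightarrow> real\<close> of which only the coordinates in \<open>{1..p}\<close> matter, and
  $[n]$ is \<open>{1..n}\<close>. A sample point is a pair \<open>(w, d)\<close> with \<open>w i = (X\<^sub>i, Y\<^sub>i)\<close> and \<open>d\<close> the
  data-splitting variables.\<close>

type_synonym vec = "nat \<Rightarrow> real"
type_synonym sample = "(nat \<Rightarrow> vec \<times> vec) \<times> (nat \<Rightarrow> nat)"

definition vnorm :: "nat \<Rightarrow> vec \<Rightarrow> real" where
  "vnorm p v = L2_set v {1..p}"

definition inner_vec :: "nat \<Rightarrow> vec \<Rightarrow> vec \<Rightarrow> real" where
  "inner_vec p u v = (\<Sum>j=1..p. u j * v j)"

definition vec_space :: "nat \<Rightarrow> vec measure" where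
  "vec_space p = Pi\<^sub>M {1..p} (\<lambda>_. borel)"

definition sample_space :: "nat \<Rightarrow> nat \<Rightarrow> nat \<Rightarrow> sample measure" where
  "sample_space n p q =
     Pi\<^sub>M {1..n} (\<lambda>_. vec_space p \<Otimes>\<^sub>M vec_space q) \<Otimes>\<^sub>M Pi\<^sub>M {1..n} (\<lambda>_. count_space UNIV)"

definition normal1 :: "real \<Rightarrow> real measure" where
  "normal1 \<mu> = density lborel (normal_density \<mu> 1)"

text \<open>$N(\mu, I_p)$.\<close>

definition normal_vec :: "nat \<Rightarrow> vec \<Rightarrow> vec measure" where
  "normal_vec p \<mu> = Pi\<^sub>M {1..p} (\<lambda>j. normal1 (\<mu> j))"

definition signs :: "nat \<Rightarrow> (nat \<Rightarrow> real) set" where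
  "signs n = {1..n} \<rightarrow>\<^sub>E {-1, 1}"

definition law :: "nat \<Rightarrow> nat \<Rightarrow> nat \<Rightarrow> vec \<Rightarrow> vec \<Rightarrow> (nat \<Rightarrow> real) \<Rightarrow> (nat \<Rightarrow> real) \<Rightarrow> sample measure" where
  "law n p q \<theta> \<eta> z \<sigma> =
     Pi\<^sub>M {1..n} (\<lambda>i. normal_vec p (\<lambda>j. z i * \<theta> j) \<Otimes>\<^sub>M normal_vec q (\<lambda>j. \<sigma> i * \<eta> j))
     \<Otimes>\<^sub>M Pi\<^sub>M {1..n} (\<lambda>_. measure_pmf (pmf_of_set {0, 1, 2}))"

definition ell :: "nat \<Rightarrow> (nat \<Rightarrow> real) \<Rightarrow> (nat \<Rightarrow> real) \<Rightarrow> real" where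
  "ell n z \<sigma> = min (real (card {i\<in>{1..n}. z i \<noteq> \<sigma> i}) / real n)
                   (real (card {i\<in>{1..n}. z i \<noteq> - \<sigma> i}) / real n)"

text \<open>The suprema in \<open>risk\<close> range over finite sets; the second one is over a nonempty set as soon
  as $\epsilon < \lfloor n/2 \rfloor / n$.\<close>

definition risk :: "nat \<Rightarrow> nat \<Rightarrow> nat \<Rightarrow> (sample \<Rightarrow> real) \<Rightarrow> vec \<Rightarrow> vec \<Rightarrow> real \<Rightarrow> real" where
  "risk n p q \<psi> \<theta> \<eta> \<epsilon> =
     (SUP (z, \<sigma>)\<in>{(z, \<sigma>). z \<in> signs n \<and> \<sigma> \<in> signs n \<and> ell n z \<sigma> = 0}.
        \<integral>\<omega>. \<psi> \<omega> \<partial>law n p q \<theta> \<eta> z \<sigma>)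
   + (SUP (z, \<sigma>)\<in>{(z, \<sigma>). z \<in> signs n \<and> \<sigma> \<in> signs n \<and> ell n z \<sigma> > \<epsilon>}.
        \<integral>\<omega>. 1 - \<psi> \<omega> \<partial>law n p q \<theta> \<eta> z \<sigma>)"

definition loss :: "nat \<Rightarrow> vec \<Rightarrow> vec \<Rightarrow> real" where
  "loss p v \<theta> = min (vnorm p (\<lambda>j. v j - \<theta> j)) (vnorm p (\<lambda>j. v j + \<theta> j))"

text \<open>The guards below are pairwise disjoint and, for $r, s \ge 0$, the last branch is reached
  exactly when $A > 1/2$.\<close>

definition beta_star :: "real \<Rightarrow> real \<Rightarrow> real" where
  "beta_star r s = (let A = r + s - sqrt s * sqrt (r + s) in
     if 3 * s > r \<and> A \<le> 1/8 then 1/2 + 2 * A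
     else if 3 * s \<le> r \<and> 5 * r + s \<le> 1 then 1/2 * (1 + 3 * r - s)
     else if 5 * r + s > 1 \<and> 1/8 < A \<and> A \<le> 1/2 \<and> 2 * (1 - r - s) * A > r
       then 2 * sqrt r * sqrt (1 - r - s)
     else if 5 * r + s > 1 \<and> 1/8 < A \<and> A \<le> 1/2 \<and> 2 * (1 - r - s) * A \<le> r
       then 2 * sqrt (2 * A) - 2 * A
     else 1)"

text \<open>$S_{(r,s)}(t)$; the law of $(U,V)$ is an equal mixture of two products, and the
  probability is written as the corresponding average.\<close>

definition S_tail :: "nat \<Rightarrow> real \<Rightarrow> real \<Rightarrow> real \<Rightarrow> real" where
  "S_tail n r s t =
     (let E = {(u, v). \<bar>sqrt r * u + sqrt s * v\<bar> - sqrt (r + s) * \<bar>v\<bar> > t};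
          \<mu> = sqrt (2 * (r + s) * ln (real n))
      in 1/2 * measure (normal1 0 \<Otimes>\<^sub>M normal1 (- \<mu>)) E
       + 1/2 * measure (normal1 0 \<Otimes>\<^sub>M normal1 \<mu>) E)"

definition C_minus :: "real \<Rightarrow> real \<Rightarrow> real \<Rightarrow> real \<Rightarrow> real" where
  "C_minus x y a b = \<bar>a * x - b * y\<bar> - \<bar>a * x + b * y\<bar>"

definition C_plus :: "real \<Rightarrow> real \<Rightarrow> real \<Rightarrow> real \<Rightarrow> real" where
  "C_plus x y a b = \<bar>a * x + b * y\<bar> - \<bar>a * x - b * y\<bar>"

definition subsample :: "nat \<Rightarrow> sample \<Rightarrow> nat \<Rightarrow> nat set" where
  "subsample n \<omega> m = {i\<in>{1..n}. snd \<omega> i = m}"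

text \<open>An estimation algorithm takes a finite index set \<open>I\<close> and a family of observations
  indexed by \<open>I\<close>.\<close>

type_synonym algorithm = "nat set \<Rightarrow> (nat \<Rightarrow> vec \<times> vec) \<Rightarrow> vec"

definition measurable_algorithm :: "nat \<Rightarrow> nat \<Rightarrow> nat \<Rightarrow> nat \<Rightarrow> algorithm \<Rightarrow> bool" where
  "measurable_algorithm n p q k alg \<longleftrightarrow>
     (\<forall>I \<subseteq> {1..n}. alg I \<in> Pi\<^sub>M I (\<lambda>_. vec_space p \<Otimes>\<^sub>M vec_space q) \<rightarrow>\<^sub>M vec_space k)"

definition estimate :: "nat \<Rightarrow> algorithm \<Rightarrow> sample \<Rightarrow> vec" where
  "estimate n alg \<omega> = alg (subsample n \<omega> 0) (restrict (fst \<omega>) (subsample n \<omega> 0))"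

definition x_hat :: "nat \<Rightarrow> nat \<Rightarrow> algorithm \<Rightarrow> sample \<Rightarrow> nat \<Rightarrow> real" where
  "x_hat n p thalg \<omega> i =
     inner_vec p (estimate n thalg \<omega>) (fst (fst \<omega> i)) / vnorm p (estimate n thalg \<omega>)"

definition y_hat :: "nat \<Rightarrow> nat \<Rightarrow> algorithm \<Rightarrow> sample \<Rightarrow> nat \<Rightarrow> real" where
  "y_hat n q etalg \<omega> i =
     inner_vec q (estimate n etalg \<omega>) (snd (fst \<omega> i)) / vnorm q (estimate n etalg \<omega>)"

definition signal_hat :: "nat set \<Rightarrow> (nat \<Rightarrow> real) \<Rightarrow> real" where
  "signal_hat I x = sqrt (max (1 / real (card I) * (\<Sum>i\<in>I. (x i)\<^sup>2) - 1) 0)"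

definition r_hat :: "nat \<Rightarrow> real \<Rightarrow> real \<Rightarrow> real" where
  "r_hat n a b = (2 * \<bar>a\<bar> * \<bar>b\<bar>)\<^sup>2 / ((2 * ln (real n)) * (a\<^sup>2 + b\<^sup>2))"

definition s_hat :: "nat \<Rightarrow> real \<Rightarrow> real \<Rightarrow> real" where
  "s_hat n a b = \<bar>a\<^sup>2 - b\<^sup>2\<bar>\<^sup>2 / ((2 * ln (real n)) * (a\<^sup>2 + b\<^sup>2))"

definition HC_stat :: "nat \<Rightarrow> (real \<Rightarrow> real \<Rightarrow> real \<Rightarrow> real \<Rightarrow> real) \<Rightarrow> nat set
    \<Rightarrow> (nat \<Rightarrow> real) \<Rightarrow> (nat \<Rightarrow> real) \<Rightarrow> real \<Rightarrow> real \<Rightarrow> ereal" where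
  "HC_stat n C I x y a b =
     (SUP t\<in>{t. \<bar>t\<bar> \<le> ln (real n)}.
        ereal (\<bar>(\<Sum>i\<in>I. of_bool (C (x i) (y i) a b > t * sqrt (2 * ln (real n))))
                 - real (card I) * S_tail n (r_hat n a b) (s_hat n a b) t\<bar>
               / sqrt (real (card I) * S_tail n (r_hat n a b) (s_hat n a b) t)))"

text \<open>\<open>dflt\<close> supplies the value of the test wherever its formula is undefined: an empty
  subsample, $\log n = 0$, a vanishing estimator, $\hat a = \hat b = 0$, or a zero denominator
  in the statistics.\<close>

definition ada_HC_test :: "nat \<Rightarrow> nat \<Rightarrow> nat \<Rightarrow> algorithm \<Rightarrow> algorithm \<Rightarrow> (sample \<Rightarrow> real)
    \<Rightarrow> sample \<Rightarrow> real" where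
  "ada_HC_test n p q thalg etalg dflt \<omega> =
     (let x = x_hat n p thalg \<omega>;
          y = y_hat n q etalg \<omega>;
          a = signal_hat (subsample n \<omega> 1) x;
          b = signal_hat (subsample n \<omega> 1) y;
          D2 = subsample n \<omega> 2
      in if n \<ge> 2 \<and> (\<forall>m\<in>{0, 1, 2}. subsample n \<omega> m \<noteq> {})
            \<and> vnorm p (estimate n thalg \<omega>) \<noteq> 0 \<and> vnorm q (estimate n etalg \<omega>) \<noteq> 0
            \<and> a\<^sup>2 + b\<^sup>2 \<noteq> 0
            \<and> (\<forall>t. \<bar>t\<bar> \<le> ln (real n) \<longrightarrow> S_tail n (r_hat n a b) (s_hat n a b) t \<noteq> 0)
         then of_bool (min (HC_stat n C_minus D2 x y a b) (HC_stat n C_plus D2 x y a b)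
                         > ereal ((ln (real n)) ^ 3))
         else dflt \<omega>)"

end

theory Submission
  imports Defs "HOL-Real_Asymp.Real_Asymp"
begin

text \<open>Conditionally on the first two subsamples, the projected observations of the third one are
  independent Gaussian pairs with means $\pm(a_1, b_1)$, and the plug-in values
  $(\hat a, \hat b)$ are close to $(a_1, b_1)$. If $\ell(z, \sigma) = 0$, then, since $C^\pm$ are
  invariant under a joint sign change and exchange roles when one sign is flipped, one of the two
  counting processes has an exceedance probability that differs from
  $S_{(\hat r, \hat s)}$ only by the bias of the plug-in values. A chi-square bound shows that this bias
  is negligible compared with the standard deviation of the count, and Chebyshev's inequality on a
  grid of quantiles controls the supremum over \<open>t\<close>. If $\ell(z, \sigma) > \epsilon$, then at least
  $n\epsilon/4$ sampled indices have mismatched signs for either statistic, and at a suitable threshold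
  $\tau\sqrt{2\log n}$ their exceedances alone outweigh the null standard deviation by a power of
  $n$. Such a $\tau$ exists below the detection boundary: the exponents of both exceedance
  probabilities follow from half-plane upper bounds and from the Gaussian density around one point.\<close>

subsection \<open>Sums of independent coordinates\<close>

text \<open>Three difficulties shape the argument. The denominators of the statistics become tiny
  for large \<open>t\<close>: where the expected count is below a negative power of the slack
  \<open>h\<close>, fluctuations cannot be compared with \<open>sqrt (m * S t)\<close>; there, with
  high probability, no observation exceeds the threshold at all. Elsewhere the supremum runs through
  an equispaced grid of polynomially many points, so the null counts need an exponential (Chernoff)
  tail for the union bound; Chebyshev serves for single sums. Secondly, the plug-in error is of
  order \<open>h / sqrt n\<close>, so the bias can reach \<open>2 * h\<close> standard deviations;
  the factor \<open>(ln n)^3\<close> in the rejection rule absorbs it, with \<open>h\<close> a small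
  power of \<open>ln n\<close>. Thirdly, directions are estimated only up to sign, so which of the
  two statistics is calibrated is random; a sign \<open>e\<close> in front of the second projection
  treats both at once. Exponents of Gaussian probabilities are squared distances in the plane, and
  the detection boundary is an optimisation over points of the exceedance region.\<close>

lemma PiM_integral_mult_distinct:
  fixes f g :: "'a \<Rightarrow> real"
  assumes M: "\<And>i. prob_space (M i)" and J: "finite J" "i \<in> J" "j \<in> J" "i \<noteq> j"
    and f: "integrable (M i) f" and g: "integrable (M j) g"
  shows "integrable (PiM J M) (\<lambda>w. f (w i) * g (w j))"
    and "(\<integral>w. f (w i) * g (w j) \<partial>PiM J M) = (\<integral>x. f x \<partial>M i) * (\<integral>x. g x \<partial>M j)"
proof -
  interpret Mk: prob_space "M k" for k by (rule M)
  interpret product_prob_space M J ..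
  define h where "h = (\<lambda>k. if k = i then f else if k = j then g else (\<lambda>_. 1))"
  have h_int: "\<And>k. k \<in> J \<Longrightarrow> integrable (M k) (h k)"
    using f g by (auto simp: h_def)
  have J_eq: "J = insert i (insert j (J - {i, j}))" using J by auto
  have h_prod: "(\<Prod>k\<in>J. h k (w k)) = f (w i) * g (w j)" for w
    using J by (subst J_eq) (simp add: h_def)
  have h_integral: "(\<Prod>k\<in>J. integral\<^sup>L (M k) (h k)) = (\<integral>x. f x \<partial>M i) * (\<integral>x. g x \<partial>M j)"
    using J by (subst J_eq) (simp add: h_def Mk.prob_space)
  show "integrable (PiM J M) (\<lambda>w. f (w i) * g (w j))"
    using product_integrable_prod[of J h, OF \<open>finite J\<close> h_int] by (simp add: h_prod)
  show "(\<integral>w. f (w i) * g (w j) \<partial>PiM J M) = (\<integral>x. f x \<partial>M i) * (\<integral>x. g x \<partial>M j)"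
    using product_integral_prod[of J h, OF \<open>finite J\<close> h_int] by (simp add: h_prod h_integral)
qed

lemma PiM_integral_component:
  fixes f :: "'a \<Rightarrow> real"
  assumes M: "\<And>i. prob_space (M i)" and J: "finite J" "i \<in> J"
    and f: "integrable (M i) f"
  shows "integrable (PiM J M) (\<lambda>w. f (w i))"
    and "(\<integral>w. f (w i) \<partial>PiM J M) = (\<integral>x. f x \<partial>M i)"
proof -
  interpret Mk: prob_space "M k" for k by (rule M)
  interpret product_prob_space M J ..
  define h where "h = (\<lambda>k. if k = i then f else (\<lambda>_. 1))"
  have h_int: "\<And>k. k \<in> J \<Longrightarrow> integrable (M k) (h k)"
    using f by (auto simp: h_def)
  have h_prod: "(\<Prod>k\<in>J. h k (w k)) = f (w i)" for w
    using J by (simp add: prod.remove[of J i] h_def)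
  have h_integral: "(\<Prod>k\<in>J. integral\<^sup>L (M k) (h k)) = (\<integral>x. f x \<partial>M i)"
    using J by (simp add: prod.remove[of J i] h_def Mk.prob_space)
  show "integrable (PiM J M) (\<lambda>w. f (w i))"
    using product_integrable_prod[of J h, OF \<open>finite J\<close> h_int] by (simp add: h_prod)
  show "(\<integral>w. f (w i) \<partial>PiM J M) = (\<integral>x. f x \<partial>M i)"
    using product_integral_prod[of J h, OF \<open>finite J\<close> h_int] by (simp add: h_prod h_integral)
qed

text \<open>Independent centred summands are uncorrelated, so the second moment of the sum is the
  sum of the second moments; Markov's inequality for the square finishes.\<close>

lemma PiM_Chebyshev:
  fixes f :: "'i \<Rightarrow> 'a \<Rightarrow> real"
  assumes M: "\<And>i. prob_space (M i)" and J: "finite J" "D \<subseteq> J"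
    and f: "\<And>i. i \<in> D \<Longrightarrow> f i \<in> borel_measurable (M i)"
    and f2: "\<And>i. i \<in> D \<Longrightarrow> integrable (M i) (\<lambda>x. (f i x)\<^sup>2)"
    and mean: "\<And>i. i \<in> D \<Longrightarrow> (\<integral>x. f i x \<partial>M i) = 0"
    and var: "\<And>i. i \<in> D \<Longrightarrow> (\<integral>x. (f i x)\<^sup>2 \<partial>M i) \<le> v i"
    and eta: "\<eta> > 0"
  shows "measure (PiM J M) {w \<in> space (PiM J M). \<bar>\<Sum>i\<in>D. f i (w i)\<bar> \<ge> \<eta>} \<le> (\<Sum>i\<in>D. v i) / \<eta>\<^sup>2"
proof -
  interpret Mk: prob_space "M k" for k by (rule M)
  interpret product_prob_space M J ..
  have fin: "finite D" using J finite_subset by auto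
  have f1: "integrable (M i) (f i)" if "i \<in> D" for i
    using finite_measure.square_integrable_imp_integrable[OF prob_space.finite_measure[OF M] f[OF that] f2[OF that]] .
  have sq: "(\<Sum>i\<in>D. f i (w i))\<^sup>2 = (\<Sum>i\<in>D. \<Sum>j\<in>D. f i (w i) * f j (w j))" for w
    by (simp add: power2_eq_square sum_product)
  have pair: "integrable (PiM J M) (\<lambda>w. f i (w i) * f j (w j)) \<and>
      (\<integral>w. f i (w i) * f j (w j) \<partial>PiM J M) = (if i = j then \<integral>x. (f i x)\<^sup>2 \<partial>M i else 0)"
    if "i \<in> D" "j \<in> D" for i j
  proof (cases "i = j")
    case True
    then show ?thesis
      using PiM_integral_component[of M J i, OF M \<open>finite J\<close> _ f2[OF \<open>i \<in> D\<close>]] that J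
      by (auto simp: power2_eq_square)
  next
    case False
    then show ?thesis
      using PiM_integral_mult_distinct[of M J i j, OF M \<open>finite J\<close> _ _ False f1[OF \<open>i \<in> D\<close>] f1[OF \<open>j \<in> D\<close>]] that J mean
      by auto
  qed
  have int: "integrable (PiM J M) (\<lambda>w. (\<Sum>i\<in>D. f i (w i))\<^sup>2)"
    unfolding sq using pair by (intro Bochner_Integration.integrable_sum) auto
  have "(\<integral>w. (\<Sum>i\<in>D. f i (w i))\<^sup>2 \<partial>PiM J M) = (\<Sum>i\<in>D. \<Sum>j\<in>D. \<integral>w. f i (w i) * f j (w j) \<partial>PiM J M)"
    unfolding sq using pair
    by (subst Bochner_Integration.integral_sum, (intro Bochner_Integration.integrable_sum, auto)[1])
       (intro sum.cong refl Bochner_Integration.integral_sum, auto)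
  also have "\<dots> = (\<Sum>i\<in>D. \<Sum>j\<in>D. if i = j then \<integral>x. (f i x)\<^sup>2 \<partial>M i else 0)"
    using pair by (intro sum.cong refl) auto
  also have "\<dots> = (\<Sum>i\<in>D. \<integral>x. (f i x)\<^sup>2 \<partial>M i)"
    using fin by (intro sum.cong refl) (simp add: sum.delta')
  also have "\<dots> \<le> (\<Sum>i\<in>D. v i)" by (intro sum_mono var)
  finally have second: "(\<integral>w. (\<Sum>i\<in>D. f i (w i))\<^sup>2 \<partial>PiM J M) \<le> (\<Sum>i\<in>D. v i)" .
  have "{w \<in> space (PiM J M). \<bar>\<Sum>i\<in>D. f i (w i)\<bar> \<ge> \<eta>} = {w \<in> space (PiM J M). (\<Sum>i\<in>D. f i (w i))\<^sup>2 \<ge> \<eta>\<^sup>2}"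
    using eta abs_le_square_iff[of \<eta>] by auto
  also have "measure (PiM J M) \<dots> \<le> (\<integral>w. (\<Sum>i\<in>D. f i (w i))\<^sup>2 \<partial>PiM J M) / \<eta>\<^sup>2"
    using eta by (intro integral_Markov_inequality_measure[OF int, of "{}"]) auto
  also have "\<dots> \<le> (\<Sum>i\<in>D. v i) / \<eta>\<^sup>2" using second by (intro divide_right_mono) auto
  finally show ?thesis .
qed

section \<open>Exponential moments and deviations of counts\<close>

lemma exp_le_quadratic:
  fixes x :: real
  assumes "\<bar>x\<bar> \<le> 1"
  shows "exp x \<le> 1 + x + x\<^sup>2"
proof (cases "x \<ge> 0")
  case True
  then show ?thesis using exp_bound[of x] assms by auto
next
  case False
  define y where "y = - x"
  have y: "0 \<le> y" "y \<le> 1" using False assms by (auto simp: y_def)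
  have "1 + y + y\<^sup>2 / 2 \<le> exp y" using exp_lower_Taylor_quadratic[of y] y by auto
  \<comment> \<open>Below zero the claim is \<open>1 \<le> (1 - y + y\<^sup>2) * exp y\<close>;
    replacing \<open>exp y\<close> by its quadratic Taylor polynomial leaves a product whose linear
    terms cancel.\<close>
  moreover have "1 \<le> (1 - y + y\<^sup>2) * (1 + y + y\<^sup>2 / 2)"
  proof -
    have "(1 - y + y\<^sup>2) * (1 + y + y\<^sup>2 / 2) = 1 + y\<^sup>2 / 2 + y^3 / 2 + y^4 / 2"
      by (simp add: field_simps power2_eq_square power3_eq_cube power4_eq_xxxx)
    then show ?thesis using y by simp
  qed
  moreover have "0 \<le> 1 - y + y\<^sup>2" using y by (smt (verit) zero_le_power2)
  ultimately have "1 \<le> (1 - y + y\<^sup>2) * exp y"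
    by (meson mult_left_mono order_trans)
  then have "exp (- y) \<le> 1 - y + y\<^sup>2"
    by (simp add: exp_minus field_simps)
  then show ?thesis by (simp add: y_def)
qed

text \<open>Each indicator contributes the factor \<open>1 + (exp l - 1) * p\<close>, at most
  \<open>exp ((l + l\<^sup>2) * p)\<close> for either sign of \<open>l\<close>, so both tails of the
  count come from one estimate.\<close>

lemma PiM_count_mgf:
  fixes b :: "'i \<Rightarrow> 'a \<Rightarrow> bool" and p l :: real
  assumes M: "\<And>i. prob_space (M i)" and J: "finite J" "D \<subseteq> J"
    and b: "\<And>i. i \<in> D \<Longrightarrow> {x \<in> space (M i). b i x} \<in> sets (M i)"
    and p: "\<And>i. i \<in> D \<Longrightarrow> measure (M i) {x \<in> space (M i). b i x} = p"
    and l: "\<bar>l\<bar> \<le> 1"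
  shows "integrable (PiM J M) (\<lambda>w. exp (l * (\<Sum>i\<in>D. of_bool (b i (w i)))))"
    and "(\<integral>w. exp (l * (\<Sum>i\<in>D. of_bool (b i (w i)))) \<partial>PiM J M) \<le> exp (card D * p * (l + l\<^sup>2))"
proof -
  interpret Mk: prob_space "M k" for k by (rule M)
  interpret product_prob_space M J ..
  have fin: "finite D" using J finite_subset by auto
  \<comment> \<open>\<open>h\<close> is 1 outside \<open>D\<close>, so that the product formula over
    all of \<open>J\<close> applies.\<close>
  define h where "h = (\<lambda>i x. if i \<in> D then 1 + (exp l - 1) * indicator {x \<in> space (M i). b i x} x else (1::real))"
  have h_int: "integrable (M i) (h i)" for i
  proof (cases "i \<in> D")
    case True
    then have "integrable (M i) (indicator {x \<in> space (M i). b i x} :: _ \<Rightarrow> real)"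
      using b[OF True] by (simp add: Mk.emeasure_eq_measure)
    then show ?thesis unfolding h_def using True by simp
  qed (simp add: h_def)
  have h_integral: "integral\<^sup>L (M i) (h i) = (if i \<in> D then 1 + (exp l - 1) * p else 1)" for i
  proof (cases "i \<in> D")
    case True
    have "integrable (M i) (indicator {x \<in> space (M i). b i x} :: _ \<Rightarrow> real)"
      using b[OF True] by (simp add: Mk.emeasure_eq_measure)
    then have "(\<integral>x. 1 + (exp l - 1) * indicator {x \<in> space (M i). b i x} x \<partial>M i)
        = 1 + (exp l - 1) * measure (M i) {x \<in> space (M i). b i x}"
      using b[OF True] by (subst Bochner_Integration.integral_add) (auto simp: Mk.prob_space Int_absorb2)
    then show ?thesis using p[OF True] True by (simp add: h_def)
  qed (simp add: h_def Mk.prob_space)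
  have h_prod: "(\<Prod>i\<in>J. h i (w i)) = exp (l * (\<Sum>i\<in>D. of_bool (b i (w i))))"
    if "w \<in> space (PiM J M)" for w
  proof -
    have w: "\<And>i. i \<in> D \<Longrightarrow> w i \<in> space (M i)" using that J by (auto simp: space_PiM)
    have "(\<Prod>i\<in>J. h i (w i)) = (\<Prod>i\<in>D. h i (w i))"
      using J fin by (intro prod.mono_neutral_right) (auto simp: h_def)
    also have "\<dots> = (\<Prod>i\<in>D. exp (l * of_bool (b i (w i))))"
      using w by (intro prod.cong) (auto simp: h_def)
    also have "\<dots> = exp (l * (\<Sum>i\<in>D. of_bool (b i (w i))))"
      using fin by (simp only: exp_sum sum_distrib_left)
    finally show ?thesis .
  qed
  show "integrable (PiM J M) (\<lambda>w. exp (l * (\<Sum>i\<in>D. of_bool (b i (w i)))))"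
    using product_integrable_prod[of J h, OF \<open>finite J\<close> h_int]
    by (rule Bochner_Integration.integrable_cong[THEN iffD1, rotated 2]) (auto simp: h_prod)
  have p01: "0 \<le> p" if "D \<noteq> {}" using p that by (metis ex_in_conv measure_nonneg)
  have p1: "p \<le> 1" if "D \<noteq> {}" using p that Mk.prob_le_1 by (metis ex_in_conv)
  have "(\<integral>w. exp (l * (\<Sum>i\<in>D. of_bool (b i (w i)))) \<partial>PiM J M) = (\<integral>w. (\<Prod>i\<in>J. h i (w i)) \<partial>PiM J M)"
    by (rule Bochner_Integration.integral_cong) (auto simp: h_prod)
  also have "\<dots> = (\<Prod>i\<in>J. if i \<in> D then 1 + (exp l - 1) * p else 1)"
    using product_integral_prod[of J h, OF \<open>finite J\<close> h_int] by (simp add: h_integral)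
  also have "\<dots> = (\<Prod>i\<in>D. 1 + (exp l - 1) * p)"
    using J by (intro prod.mono_neutral_cong_right) auto
  also have "\<dots> = (1 + (exp l - 1) * p) ^ card D" by simp
  also have "\<dots> \<le> exp ((l + l\<^sup>2) * p) ^ card D"
  proof (cases "D = {}")
    case False
    have "(exp l - 1) * p \<le> (l + l\<^sup>2) * p"
      using exp_le_quadratic[OF l] p01[OF False] by (intro mult_right_mono) auto
    then have "1 + (exp l - 1) * p \<le> exp ((l + l\<^sup>2) * p)"
      using exp_ge_add_one_self[of "(l + l\<^sup>2) * p"] by linarith
    moreover have "0 \<le> 1 + (exp l - 1) * p"
    proof -
      have "1 + (exp l - 1) * p = (1 - p) + exp l * p" by (simp add: algebra_simps)
      moreover have "0 \<le> exp l * p" using p01[OF False] by simp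
      ultimately show ?thesis using p1[OF False] by linarith
    qed
    ultimately show ?thesis by (intro power_mono) auto
  qed simp
  also have "\<dots> = exp (card D * p * (l + l\<^sup>2))"
    by (simp add: exp_of_nat_mult[symmetric] mult_ac)
  finally show "(\<integral>w. exp (l * (\<Sum>i\<in>D. of_bool (b i (w i)))) \<partial>PiM J M) \<le> exp (card D * p * (l + l\<^sup>2))" .
qed

text \<open>A Bernstein-type bound: the deviation is of order \<open>sqrt (L * Q)\<close> while the
  mean \<open>Q\<close> dominates \<open>L\<close>, and of order \<open>L\<close> in the Poisson
  range. The 5 is chosen so that the exponent is at most \<open>- 4 * L\<close>; with
  \<open>L = ln n\<close> the failure probability \<open>2 / n^4\<close> survives a union over about
  \<open>n^2\<close> points.\<close>

lemma PiM_count_Chernoff: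
  fixes b :: "'i \<Rightarrow> 'a \<Rightarrow> bool" and p L :: real
  assumes M: "\<And>i. prob_space (M i)" and J: "finite J" "D \<subseteq> J"
    and b: "\<And>i. i \<in> D \<Longrightarrow> {x \<in> space (M i). b i x} \<in> sets (M i)"
    and p: "\<And>i. i \<in> D \<Longrightarrow> measure (M i) {x \<in> space (M i). b i x} = p"
    and p0: "p \<ge> 0" and L: "L > 0"
  shows "measure (PiM J M) {w \<in> space (PiM J M).
      \<bar>(\<Sum>i\<in>D. of_bool (b i (w i))) - card D * p\<bar> \<ge> 5 * (sqrt (L * (card D * p)) + L)} \<le> 2 * exp (- 4 * L)"
proof -
  interpret Mk: prob_space "M k" for k by (rule M)
  interpret product_prob_space M J ..
  define Q where "Q = card D * p"
  define N where "N = (\<lambda>w. (\<Sum>i\<in>D. of_bool (b i (w i))) :: real)"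
  define x where "x = 5 * (sqrt (L * Q) + L)"
  \<comment> \<open>The optimal tilt is of order \<open>sqrt (L / Q)\<close>; it is capped at 1, the
    range of the quadratic bound for \<open>exp\<close>.\<close>
  define l where "l = (if Q \<le> L then 1 else sqrt (L / Q))"
  have Q0: "Q \<ge> 0" using p0 by (simp add: Q_def)
  have l: "0 < l" "l \<le> 1" using L Q0 by (auto simp: l_def)
  have lQ: "- (l * x) + l\<^sup>2 * Q \<le> - 4 * L"
  proof (cases "Q \<le> L")
    case True
    moreover have "0 \<le> sqrt (L * Q)" using L Q0 by simp
    moreover have "- (l * x) + l\<^sup>2 * Q = Q - 5 * sqrt (L * Q) - 5 * L"
      using True by (simp add: l_def x_def)
    ultimately show ?thesis using L by linarith
  next
    case False
    then have Qp: "Q > 0" using L by auto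
    have "l\<^sup>2 * Q = L" using False L Qp by (simp add: l_def)
    moreover have "l * sqrt (L * Q) = L"
      using False L Qp by (simp add: l_def real_sqrt_divide real_sqrt_mult)
    moreover have "l * x = 5 * (l * sqrt (L * Q)) + 5 * (l * L)" by (simp add: x_def algebra_simps)
    moreover have "l * L \<ge> 0" using l L by auto
    ultimately show ?thesis by linarith
  qed
  have one_side: "measure (PiM J M) {w \<in> space (PiM J M). exp (s * l * N w) \<ge> exp (s * l * Q + l * x)} \<le> exp (- 4 * L)"
    if s: "s = 1 \<or> s = -1" for s :: real
  proof -
    have sl: "\<bar>s * l\<bar> \<le> 1" "(s * l)\<^sup>2 = l\<^sup>2" using s l by (auto simp: abs_mult power_mult_distrib)
    note mgf = PiM_count_mgf[OF M J b p sl(1)]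
    have "measure (PiM J M) {w \<in> space (PiM J M). exp (s * l * N w) \<ge> exp (s * l * Q + l * x)}
        \<le> (\<integral>w. exp (s * l * N w) \<partial>PiM J M) / exp (s * l * Q + l * x)"
      using mgf(1) unfolding N_def by (intro integral_Markov_inequality_measure[where A="{}"]) auto
    also have "\<dots> \<le> exp (Q * (s * l + l\<^sup>2)) / exp (s * l * Q + l * x)"
      using mgf(2) unfolding N_def Q_def sl(2) by (intro divide_right_mono) auto
    also have "\<dots> = exp (- (l * x) + l\<^sup>2 * Q)" by (simp add: exp_diff[symmetric] algebra_simps)
    also have "\<dots> \<le> exp (- 4 * L)" using lQ by simp
    finally show ?thesis .
  qed
  have [measurable]: "N \<in> borel_measurable (PiM J M)"
  proof -
    have "(\<lambda>w. of_bool (b i (w i)) :: real) \<in> borel_measurable (PiM J M)" if "i \<in> D" for i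
    proof -
      have "Measurable.pred (M i) (b i)" using b[OF that] by (simp add: pred_def)
      then have "(\<lambda>x. of_bool (b i x) :: real) \<in> borel_measurable (M i)" by measurable
      then show ?thesis
        using J that by (intro measurable_compose[OF measurable_component_singleton]) auto
    qed
    then show ?thesis unfolding N_def by (intro borel_measurable_sum)
  qed
  have "{w \<in> space (PiM J M). \<bar>N w - Q\<bar> \<ge> x} \<subseteq>
      {w \<in> space (PiM J M). exp (1 * l * N w) \<ge> exp (1 * l * Q + l * x)} \<union>
      {w \<in> space (PiM J M). exp (- 1 * l * N w) \<ge> exp (- 1 * l * Q + l * x)}"
  proof
    fix w assume w: "w \<in> {w \<in> space (PiM J M). \<bar>N w - Q\<bar> \<ge> x}"
    then consider "N w \<le> Q - x" | "Q + x \<le> N w" by force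
    then show "w \<in> {w \<in> space (PiM J M). exp (1 * l * N w) \<ge> exp (1 * l * Q + l * x)} \<union>
      {w \<in> space (PiM J M). exp (- 1 * l * N w) \<ge> exp (- 1 * l * Q + l * x)}"
    proof cases
      case 1
      then have "l * N w \<le> l * (Q - x)" using l by simp
      then show ?thesis using w by (simp add: algebra_simps)
    next
      case 2
      then have "l * (Q + x) \<le> l * N w" using l by simp
      then show ?thesis using w by (simp add: algebra_simps)
    qed
  qed
  then have "measure (PiM J M) {w \<in> space (PiM J M). \<bar>N w - Q\<bar> \<ge> x} \<le>
     measure (PiM J M) ({w \<in> space (PiM J M). exp (1 * l * N w) \<ge> exp (1 * l * Q + l * x)} \<union>
      {w \<in> space (PiM J M). exp (- 1 * l * N w) \<ge> exp (- 1 * l * Q + l * x)})"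
    by (intro P.finite_measure_mono) measurable
  also have "\<dots> \<le> exp (- 4 * L) + exp (- 4 * L)"
    using one_side[of 1] one_side[of "-1"]
    by (intro order_trans[OF measure_Un_le] add_mono) auto
  finally show ?thesis by (simp add: N_def Q_def x_def)
qed

lemma emeasure_to_measure_bound: "prob_space M \<Longrightarrow> measure M B \<le> c \<Longrightarrow> emeasure M B \<le> ennreal c"
  by (simp add: finite_measure.emeasure_eq_measure prob_space.finite_measure ennreal_leI)

lemma (in prob_space) nn_integral_le_bad:
  assumes B: "B \<in> sets M" and bad: "\<And>x. x \<in> space M \<Longrightarrow> x \<in> B \<Longrightarrow> f x \<le> 1"
    and good: "\<And>x. x \<in> space M \<Longrightarrow> x \<notin> B \<Longrightarrow> f x \<le> c"
  shows "(\<integral>\<^sup>+x. f x \<partial>M) \<le> emeasure M B + c"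
proof -
  have "(\<integral>\<^sup>+x. f x \<partial>M) \<le> (\<integral>\<^sup>+x. indicator B x + c \<partial>M)"
  proof (intro nn_integral_mono)
    fix x assume "x \<in> space M"
    then show "f x \<le> indicator B x + c"
      using good[of x] bad[of x] by (cases "x \<in> B") (auto intro: add_increasing2)
  qed
  also have "\<dots> = emeasure M B + c"
    using B by (subst nn_integral_add) (auto simp: emeasure_space_1)
  finally show ?thesis .
qed

subsection \<open>Gaussian measures\<close>

lemma prob_space_normal1: "prob_space (normal1 m)"
  unfolding normal1_def by (rule prob_space_normal_density) simp

lemma sets_normal1 [measurable_cong, simp]: "sets (normal1 m) = sets borel"
  by (simp add: normal1_def)

lemma space_normal1 [simp]: "space (normal1 m) = UNIV"
  by (simp add: normal1_def)

lemma pair_prob_space_normal1: "pair_prob_space (normal1 a) (normal1 b)"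
  using prob_space_normal1
  by (intro pair_prob_space.intro pair_sigma_finite.intro prob_space_imp_sigma_finite)

lemma nn_integral_normal1:
  "f \<in> borel_measurable borel \<Longrightarrow>
    (\<integral>\<^sup>+x. f x \<partial>normal1 m) = (\<integral>\<^sup>+x. ennreal (normal_density m 1 x) * f x \<partial>lborel)"
  by (simp add: normal1_def nn_integral_density)

lemma integral_normal1:
  fixes f :: "real \<Rightarrow> real"
  shows "f \<in> borel_measurable borel \<Longrightarrow> (\<integral>x. f x \<partial>normal1 m) = (\<integral>x. normal_density m 1 x * f x \<partial>lborel)"
  by (simp add: normal1_def integral_density)

lemma integrable_normal1:
  fixes f :: "real \<Rightarrow> real"
  shows "f \<in> borel_measurable borel \<Longrightarrow> integrable (normal1 m) f \<longleftrightarrow> integrable lborel (\<lambda>x. normal_density m 1 x * f x)"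
  by (simp add: normal1_def integrable_density)

lemma distributed_lborel_iff:
  "distributed M lborel X f \<longleftrightarrow> f \<in> borel_measurable borel \<and> X \<in> borel_measurable M \<and> distr M borel X = density lborel f"
proof -
  have "distr M lborel X = distr M borel X" by (rule distr_cong) simp_all
  then show ?thesis by (auto simp: distributed_def)
qed

lemma distributed_normal1:
  "distributed M lborel X (normal_density m 1) \<longleftrightarrow> X \<in> borel_measurable M \<and> distr M borel X = normal1 m"
  by (auto simp: distributed_lborel_iff normal1_def)

lemma normal1_uminus: "distr (normal1 m) borel uminus = normal1 (- m)"
proof -
  interpret prob_space "normal1 m" by (rule prob_space_normal1)
  have "distributed (normal1 m) lborel (\<lambda>x. x) (normal_density m 1)"
    unfolding distributed_normal1 by (simp add: distr_id2)
  from normal_density_affine[OF this, of "-1" 0] show ?thesis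
    by (simp add: distributed_normal1)
qed

lemma normal_vec_projection:
  assumes "vnorm p v \<noteq> 0"
  shows "(\<lambda>X. inner_vec p v X / vnorm p v) \<in> borel_measurable (normal_vec p \<mu>)"
    and "distr (normal_vec p \<mu>) borel (\<lambda>X. inner_vec p v X / vnorm p v) = normal1 (inner_vec p v \<mu> / vnorm p v)"
proof -
  define M where "M = (\<lambda>j. normal1 (\<mu> j))"
  interpret Mk: prob_space "M k" for k unfolding M_def by (rule prob_space_normal1)
  interpret product_prob_space M "{1..p}" ..
  \<comment> \<open>Coordinates with \<open>v j = 0\<close> are removed: their terms would have
    standard deviation 0, while the addition theorem for independent normals asks for positive
    ones.\<close>
  define I where "I = {j\<in>{1..p}. v j \<noteq> 0}"
  have I: "finite I" "I \<subseteq> {1..p}" by (auto simp: I_def)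
  have "I \<noteq> {}" using assms unfolding vnorm_def I_def
    by (auto simp: L2_set_eq_0_iff)
  then have p: "{1..p} \<noteq> {}" using I by auto
  have coord: "(\<lambda>\<omega>. \<omega> j) \<in> borel_measurable (PiM {1..p} M)" if "j \<in> {1..p}" for j
    using measurable_component_singleton[OF that, of M] measurable_cong_sets[OF refl sets_normal1, of "PiM {1..p} M"]
    by (simp add: M_def)
  have "P.indep_vars (\<lambda>_. borel) (\<lambda>j \<omega>. \<omega> j) {1..p}"
  proof (subst P.indep_vars_iff_distr_eq_PiM'[OF p coord])
    have "distr (PiM {1..p} M) (PiM {1..p} (\<lambda>_. borel)) (\<lambda>x. \<lambda>i\<in>{1..p}. x i) = PiM {1..p} M"
    proof -
      have "distr (PiM {1..p} M) (PiM {1..p} (\<lambda>_. borel)) (\<lambda>x. \<lambda>i\<in>{1..p}. x i) = distr (PiM {1..p} M) (PiM {1..p} M) (\<lambda>x. x)"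
        by (intro distr_cong refl sets_PiM_cong) (auto simp: M_def space_PiM PiE_iff extensional_restrict)
      then show ?thesis by (simp add: distr_id2)
    qed
    moreover have "PiM {1..p} (\<lambda>i. distr (PiM {1..p} M) borel (\<lambda>\<omega>. \<omega> i)) = PiM {1..p} M"
    proof (intro PiM_cong refl)
      fix i assume "i \<in> {1..p}"
      have "distr (PiM {1..p} M) borel (\<lambda>\<omega>. \<omega> i) = distr (PiM {1..p} M) (M i) (\<lambda>\<omega>. \<omega> i)"
        by (rule distr_cong) (simp_all add: M_def)
      then show "distr (PiM {1..p} M) borel (\<lambda>\<omega>. \<omega> i) = M i"
        using PiM_component[OF \<open>i \<in> {1..p}\<close>] by simp
    qed
    ultimately show "distr (PiM {1..p} M) (PiM {1..p} (\<lambda>_. borel)) (\<lambda>x. \<lambda>i\<in>{1..p}. x i) =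
      PiM {1..p} (\<lambda>i. distr (PiM {1..p} M) borel (\<lambda>\<omega>. \<omega> i))" by simp
  qed
  then have "P.indep_vars (\<lambda>_. borel) (\<lambda>j \<omega>. \<omega> j) I" using I by (rule_tac P.indep_vars_subset)
  then have ind: "P.indep_vars (\<lambda>_. borel) (\<lambda>j \<omega>. v j / vnorm p v * \<omega> j) I"
    by (rule P.indep_vars_compose2) auto
  have marg: "distributed (PiM {1..p} M) lborel (\<lambda>\<omega>. v j / vnorm p v * \<omega> j)
      (normal_density (v j / vnorm p v * \<mu> j) \<bar>v j / vnorm p v\<bar>)" if "j \<in> I" for j
  proof -
    have j: "j \<in> {1..p}" "v j \<noteq> 0" using that by (auto simp: I_def)
    have "distr (PiM {1..p} M) borel (\<lambda>\<omega>. \<omega> j) = distr (PiM {1..p} M) (M j) (\<lambda>\<omega>. \<omega> j)"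
      by (rule distr_cong) (simp_all add: M_def)
    then have "distributed (PiM {1..p} M) lborel (\<lambda>\<omega>. \<omega> j) (normal_density (\<mu> j) 1)"
      using PiM_component[OF j(1)] coord[OF j(1)] by (simp add: distributed_normal1 M_def)
    from P.normal_density_affine[OF this, of "v j / vnorm p v" 0] show ?thesis
      using j assms by simp
  qed
  have "distributed (PiM {1..p} M) lborel (\<lambda>\<omega>. \<Sum>j\<in>I. v j / vnorm p v * \<omega> j)
     (normal_density (\<Sum>j\<in>I. v j / vnorm p v * \<mu> j) (sqrt (\<Sum>j\<in>I. \<bar>v j / vnorm p v\<bar>\<^sup>2)))"
    using assms by (intro P.sum_indep_normal I \<open>I \<noteq> {}\<close> ind marg) (auto simp: I_def)
  moreover have "(\<Sum>j\<in>I. v j / vnorm p v * w j) = inner_vec p v w / vnorm p v" for w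
  proof -
    have "(\<Sum>j\<in>I. v j / vnorm p v * w j) = (\<Sum>j\<in>{1..p}. v j / vnorm p v * w j)"
      by (intro sum.mono_neutral_left) (auto simp: I_def)
    then show ?thesis by (simp add: inner_vec_def sum_divide_distrib)
  qed
  moreover have "(\<Sum>j\<in>I. \<bar>v j / vnorm p v\<bar>\<^sup>2) = 1"
  proof -
    have "(\<Sum>j\<in>I. \<bar>v j / vnorm p v\<bar>\<^sup>2) = (\<Sum>j\<in>{1..p}. (v j)\<^sup>2 / (vnorm p v)\<^sup>2)"
      by (intro sum.mono_neutral_cong_left) (auto simp: I_def power_divide)
    also have "\<dots> = (\<Sum>j\<in>{1..p}. (v j)\<^sup>2) / (vnorm p v)\<^sup>2" by (simp add: sum_divide_distrib)
    also have "(\<Sum>j\<in>{1..p}. (v j)\<^sup>2) = (vnorm p v)\<^sup>2"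
      by (simp add: vnorm_def L2_set_def sum_nonneg)
    finally show ?thesis using assms by simp
  qed
  ultimately have "distributed (PiM {1..p} M) lborel (\<lambda>\<omega>. inner_vec p v \<omega> / vnorm p v)
     (normal_density (inner_vec p v \<mu> / vnorm p v) 1)" by simp
  then show "(\<lambda>X. inner_vec p v X / vnorm p v) \<in> borel_measurable (normal_vec p \<mu>)"
     and "distr (normal_vec p \<mu>) borel (\<lambda>X. inner_vec p v X / vnorm p v) = normal1 (inner_vec p v \<mu> / vnorm p v)"
    unfolding distributed_normal1 by (simp_all add: normal_vec_def M_def)
qed

lemma normal1_sq_centred:
  shows "integrable (normal1 a) (\<lambda>x. (x\<^sup>2 - 1 - a\<^sup>2)\<^sup>2)"
    and "(\<integral>x. x\<^sup>2 - 1 - a\<^sup>2 \<partial>normal1 a) = 0"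
    and "(\<integral>x. (x\<^sup>2 - 1 - a\<^sup>2)\<^sup>2 \<partial>normal1 a) = 2 + 4 * a\<^sup>2"
proof -
  let ?d = "\<lambda>x. normal_density a 1 x"
  have m0: "has_bochner_integral lborel (\<lambda>x. ?d x) 1"
    using normal_moment_even[of 1 a 0] by simp
  have m1: "has_bochner_integral lborel (\<lambda>x. ?d x * (x - a)) 0"
    using normal_moment_odd[of 1 a 0] by simp
  have m2: "has_bochner_integral lborel (\<lambda>x. ?d x * (x - a)\<^sup>2) 1"
    using normal_moment_even[of 1 a 1] by simp
  have m3: "has_bochner_integral lborel (\<lambda>x. ?d x * (x - a)^3) 0"
    using normal_moment_odd[of 1 a 1] by (simp add: numeral_3_eq_3)
  have m4: "has_bochner_integral lborel (\<lambda>x. ?d x * (x - a)^4) 3"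
    using normal_moment_even[of 1 a 2] by (simp add: fact_numeral)
  \<comment> \<open>Expansion in powers of \<open>x - a\<close>, whose moments of orders 0 to 4
    under the density are 1, 0, 1, 0, 3.\<close>
  have e1: "?d x * (x\<^sup>2 - 1 - a\<^sup>2) = (2 * a) * (?d x * (x - a)) + ?d x * (x - a)\<^sup>2 + (-1) * ?d x" for x
    by (simp add: algebra_simps power2_eq_square)
  have e2: "?d x * (x\<^sup>2 - 1 - a\<^sup>2)\<^sup>2 = ?d x * (x - a)^4 + (4 * a) * (?d x * (x - a)^3) + (4 * a\<^sup>2 - 2) * (?d x * (x - a)\<^sup>2)
     + (- 4 * a) * (?d x * (x - a)) + ?d x" for x
    by (simp add: algebra_simps power2_eq_square power3_eq_cube power4_eq_xxxx)
  have h1: "has_bochner_integral lborel (\<lambda>x. ?d x * (x\<^sup>2 - 1 - a\<^sup>2)) (2 * a * 0 + 1 + (-1) * 1)"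
    unfolding e1 by (intro has_bochner_integral_add has_bochner_integral_mult_right m0 m1 m2)
  have h2: "has_bochner_integral lborel (\<lambda>x. ?d x * (x\<^sup>2 - 1 - a\<^sup>2)\<^sup>2) (3 + (4 * a) * 0 + (4 * a\<^sup>2 - 2) * 1 + (- 4 * a) * 0 + 1)"
    unfolding e2 by (intro has_bochner_integral_add has_bochner_integral_mult_right m0 m1 m2 m3 m4)
  show "integrable (normal1 a) (\<lambda>x. (x\<^sup>2 - 1 - a\<^sup>2)\<^sup>2)"
    using h2 by (simp add: integrable_normal1 has_bochner_integral_iff)
  show "(\<integral>x. x\<^sup>2 - 1 - a\<^sup>2 \<partial>normal1 a) = 0"
    using h1 by (simp add: integral_normal1 has_bochner_integral_iff)
  show "(\<integral>x. (x\<^sup>2 - 1 - a\<^sup>2)\<^sup>2 \<partial>normal1 a) = 2 + 4 * a\<^sup>2"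
    using h2 by (simp add: integral_normal1 has_bochner_integral_iff)
qed

lemma normal1_mgf: "(\<integral>\<^sup>+x. ennreal (exp (l * x)) \<partial>normal1 m) = ennreal (exp (l * m + l\<^sup>2 / 2))"
proof -
  have "normal_density m 1 x * exp (l * x) = exp (l * m + l\<^sup>2 / 2) * normal_density (m + l) 1 x" for x
    by (simp add: normal_density_def exp_add[symmetric] field_simps power2_eq_square)
  then have "(\<integral>\<^sup>+x. ennreal (exp (l * x)) \<partial>normal1 m) =
      (\<integral>\<^sup>+x. ennreal (exp (l * m + l\<^sup>2 / 2)) * ennreal (normal_density (m + l) 1 x) \<partial>lborel)"
    by (simp add: nn_integral_normal1 ennreal_mult'[symmetric])
  also have "\<dots> = ennreal (exp (l * m + l\<^sup>2 / 2)) * (\<integral>\<^sup>+x. ennreal (normal_density (m + l) 1 x) \<partial>lborel)"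
    by (rule nn_integral_cmult) simp
  also have "(\<integral>\<^sup>+x. ennreal (normal_density (m + l) 1 x) \<partial>lborel) = emeasure (normal1 (m + l)) (space (normal1 (m + l)))"
    by (simp add: normal1_def emeasure_density)
  also have "\<dots> = 1" using prob_space.emeasure_space_1[OF prob_space_normal1] .
  finally show ?thesis by simp
qed

text \<open>Exponential Markov inequality with the optimal tilt \<open>l\<close>: the distance from
  the mean of the linear form to \<open>t\<close>, divided by its variance. Geometrically, the
  exponent is half the squared distance from the mean to the half-plane.\<close>

lemma normal1_pair_linear_tail:
  assumes g: "g1\<^sup>2 + g2\<^sup>2 > 0" and t: "g1 * a + g2 * b \<le> t"
  shows "measure (normal1 a \<Otimes>\<^sub>M normal1 b) {(u, v). g1 * u + g2 * v > t}
    \<le> exp (- ((t - g1 * a - g2 * b)\<^sup>2 / (2 * (g1\<^sup>2 + g2\<^sup>2))))"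
proof -
  interpret pair_prob_space "normal1 a" "normal1 b" by (rule pair_prob_space_normal1)
  define G where "G = g1\<^sup>2 + g2\<^sup>2"
  define l where "l = (t - g1 * a - g2 * b) / G"
  have G: "G > 0" using g by (simp add: G_def)
  have l: "l \<ge> 0" using t G by (simp add: l_def)
  let ?A = "{(u, v). g1 * u + g2 * v > t}"
  have A: "?A \<in> sets (borel \<Otimes>\<^sub>M borel)"
  proof -
    have "?A = {z \<in> space (borel \<Otimes>\<^sub>M borel). g1 * fst z + g2 * snd z > t}"
      by (auto simp: space_pair_measure)
    also have "\<dots> \<in> sets (borel \<Otimes>\<^sub>M borel)" by measurable
    finally show ?thesis .
  qed
  have sets_eq: "sets (normal1 a \<Otimes>\<^sub>M normal1 b) = sets (borel \<Otimes>\<^sub>M borel)"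
    by (intro sets_pair_measure_cong) simp_all
  have "emeasure (normal1 a \<Otimes>\<^sub>M normal1 b) ?A = (\<integral>\<^sup>+z. indicator ?A z \<partial>(normal1 a \<Otimes>\<^sub>M normal1 b))"
    using A by (subst nn_integral_indicator) (simp_all only: sets_eq)
  also have "\<dots> \<le> (\<integral>\<^sup>+z. ennreal (exp (- l * t)) * (ennreal (exp (l * g1 * fst z)) * ennreal (exp (l * g2 * snd z))) \<partial>(normal1 a \<Otimes>\<^sub>M normal1 b))"
  proof (intro nn_integral_mono)
    fix z :: "real \<times> real"
    have "0 \<le> - l * t + (l * g1 * fst z + l * g2 * snd z)" if "z \<in> ?A"
    proof -
      have "l * t \<le> l * (g1 * fst z + g2 * snd z)" using that l by (intro mult_left_mono) auto
      then show ?thesis by (simp add: algebra_simps)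
    qed
    then show "indicator ?A z \<le> ennreal (exp (- l * t)) * (ennreal (exp (l * g1 * fst z)) * ennreal (exp (l * g2 * snd z)))"
      by (simp add: indicator_def ennreal_mult'[symmetric] exp_add[symmetric] ennreal_1[symmetric] del: ennreal_1)
  qed
  also have "\<dots> = ennreal (exp (- l * t)) * (\<integral>\<^sup>+u. \<integral>\<^sup>+v. ennreal (exp (l * g1 * u)) * ennreal (exp (l * g2 * v)) \<partial>normal1 b \<partial>normal1 a)"
    by (subst nn_integral_cmult, measurable, subst M2.nn_integral_fst[symmetric]) simp_all
  also have "(\<integral>\<^sup>+u. \<integral>\<^sup>+v. ennreal (exp (l * g1 * u)) * ennreal (exp (l * g2 * v)) \<partial>normal1 b \<partial>normal1 a)
    = ennreal (exp (l * g1 * a + (l * g1)\<^sup>2 / 2)) * ennreal (exp (l * g2 * b + (l * g2)\<^sup>2 / 2))"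
    by (simp add: nn_integral_cmult nn_integral_multc normal1_mgf)
  also have "ennreal (exp (- l * t)) * \<dots> = ennreal (exp (- l * (t - g1 * a - g2 * b) + l\<^sup>2 * G / 2))"
    by (simp add: ennreal_mult'[symmetric] exp_add[symmetric] G_def algebra_simps power_mult_distrib add_divide_distrib)
  also have "- l * (t - g1 * a - g2 * b) + l\<^sup>2 * G / 2 = - ((t - g1 * a - g2 * b)\<^sup>2 / (2 * G))"
    using G by (simp add: l_def power2_eq_square field_simps)
  finally show ?thesis
    by (simp add: emeasure_eq_measure G_def)
qed

text \<open>A plane rotation is carried out as two affine substitutions in one variable with Fubini
  in between: \<open>v\<close> is replaced at fixed \<open>u\<close>, then \<open>u\<close> at fixed
  \<open>y\<close>. The scale factors \<open>c / b\<close> and \<open>b / c\<close> cancel.\<close>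

lemma rotation_nn_integral:
  fixes f :: "real \<Rightarrow> real \<Rightarrow> ennreal"
  assumes [measurable]: "case_prod f \<in> borel_measurable (borel \<Otimes>\<^sub>M borel)"
    and c: "c\<^sup>2 = a\<^sup>2 + b\<^sup>2" "b \<noteq> 0"
  shows "(\<integral>\<^sup>+u. \<integral>\<^sup>+v. f u v \<partial>lborel \<partial>lborel) =
    (\<integral>\<^sup>+x. \<integral>\<^sup>+y. f ((b * x - a * y) / c) ((a * x + b * y) / c) \<partial>lborel \<partial>lborel)"
proof -
  have c0: "c \<noteq> 0" using c by (auto simp: sum_power2_eq_zero_iff)
  have m1: "(\<lambda>(u, y). f u (a / b * u + c / b * y)) \<in> borel_measurable (borel \<Otimes>\<^sub>M borel)"
    using measurable_compose[OF _ assms(1), of "\<lambda>(u, y). (u, a / b * u + c / b * y)"]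
    by (simp add: case_prod_beta')
  have m2: "(\<lambda>(x, y). f (- a / c * y + b / c * x) (a / b * (- a / c * y + b / c * x) + c / b * y)) \<in> borel_measurable (borel \<Otimes>\<^sub>M borel)"
    using measurable_compose[OF _ assms(1), of "\<lambda>(x, y). (- a / c * y + b / c * x, a / b * (- a / c * y + b / c * x) + c / b * y)"]
    by (simp add: case_prod_beta')
  have fm: "\<And>u. (\<lambda>v. f u v) \<in> borel_measurable borel"
    using assms(1) by simp
  have "(\<integral>\<^sup>+u. \<integral>\<^sup>+v. f u v \<partial>lborel \<partial>lborel) = (\<integral>\<^sup>+u. ennreal \<bar>c / b\<bar> * (\<integral>\<^sup>+y. f u (a / b * u + c / b * y) \<partial>lborel) \<partial>lborel)"
    using c0 c by (intro nn_integral_cong nn_integral_real_affine fm) auto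
  also have "\<dots> = ennreal \<bar>c / b\<bar> * (\<integral>\<^sup>+u. (\<integral>\<^sup>+y. f u (a / b * u + c / b * y) \<partial>lborel) \<partial>lborel)"
    by (rule nn_integral_cmult) measurable
  also have "(\<integral>\<^sup>+u. (\<integral>\<^sup>+y. f u (a / b * u + c / b * y) \<partial>lborel) \<partial>lborel) = (\<integral>\<^sup>+y. (\<integral>\<^sup>+u. f u (a / b * u + c / b * y) \<partial>lborel) \<partial>lborel)"
    by (rule lborel_pair.Fubini'[symmetric]) (use m1 in measurable)
  also have "\<dots> = (\<integral>\<^sup>+y. ennreal \<bar>b / c\<bar> * (\<integral>\<^sup>+x. f (- a / c * y + b / c * x) (a / b * (- a / c * y + b / c * x) + c / b * y) \<partial>lborel) \<partial>lborel)"
    using c0 c by (intro nn_integral_cong nn_integral_real_affine) auto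
  also have "\<dots> = ennreal \<bar>b / c\<bar> * (\<integral>\<^sup>+y. (\<integral>\<^sup>+x. f (- a / c * y + b / c * x) (a / b * (- a / c * y + b / c * x) + c / b * y) \<partial>lborel) \<partial>lborel)"
    by (rule nn_integral_cmult) measurable
  also have "(\<integral>\<^sup>+y. (\<integral>\<^sup>+x. f (- a / c * y + b / c * x) (a / b * (- a / c * y + b / c * x) + c / b * y) \<partial>lborel) \<partial>lborel)
    = (\<integral>\<^sup>+x. (\<integral>\<^sup>+y. f (- a / c * y + b / c * x) (a / b * (- a / c * y + b / c * x) + c / b * y) \<partial>lborel) \<partial>lborel)"
    by (rule lborel_pair.Fubini') (use m2 in measurable)
  also have "\<dots> = (\<integral>\<^sup>+x. \<integral>\<^sup>+y. f ((b * x - a * y) / c) ((a * x + b * y) / c) \<partial>lborel \<partial>lborel)"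
  proof (intro nn_integral_cong)
    fix x y
    have e1: "a / b * (- a / c * y + b / c * x) + c / b * y = (a * x + b * y) / c"
    proof -
      have "a / b * (- a / c * y + b / c * x) + c / b * y = (a * x + b * y) / c + (c\<^sup>2 - a\<^sup>2 - b\<^sup>2) * y / (b * c)"
        using c0 c(2) by (simp add: field_simps power2_eq_square)
      then show ?thesis using c(1) by simp
    qed
    have e2: "- a / c * y + b / c * x = (b * x - a * y) / c"
      using c0 by (simp add: field_simps)
    show "f (- a / c * y + b / c * x) (a / b * (- a / c * y + b / c * x) + c / b * y) = f ((b * x - a * y) / c) ((a * x + b * y) / c)"
      unfolding e1 unfolding e2 ..
  qed
  finally have "(\<integral>\<^sup>+u. \<integral>\<^sup>+v. f u v \<partial>lborel \<partial>lborel) = (ennreal \<bar>c / b\<bar> * ennreal \<bar>b / c\<bar>) *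
     (\<integral>\<^sup>+x. \<integral>\<^sup>+y. f ((b * x - a * y) / c) ((a * x + b * y) / c) \<partial>lborel \<partial>lborel)"
    by (simp only: mult.assoc)
  moreover have "ennreal \<bar>c / b\<bar> * ennreal \<bar>b / c\<bar> = 1"
    using c0 c(2) by (simp add: ennreal_mult'[symmetric] abs_mult[symmetric] mult.commute[of c b])
  ultimately show ?thesis by simp
qed

lemma normal1_pair_emeasure:
  assumes [measurable]: "E \<in> sets (borel \<Otimes>\<^sub>M borel)"
  shows "emeasure (normal1 a \<Otimes>\<^sub>M normal1 b) E =
    (\<integral>\<^sup>+x. \<integral>\<^sup>+y. ennreal (normal_density a 1 x * normal_density b 1 y) * indicator E (x, y) \<partial>lborel \<partial>lborel)"
proof -
  interpret pair_prob_space "normal1 a" "normal1 b" by (rule pair_prob_space_normal1)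
  have "emeasure (normal1 a \<Otimes>\<^sub>M normal1 b) E = (\<integral>\<^sup>+x. \<integral>\<^sup>+y. indicator E (x, y) \<partial>normal1 b \<partial>normal1 a)"
    by (subst M2.nn_integral_fst) (simp_all, measurable)
  also have "\<dots> = (\<integral>\<^sup>+x. normal_density a 1 x * (\<integral>\<^sup>+y. ennreal (normal_density b 1 y) * indicator E (x, y) \<partial>lborel) \<partial>lborel)"
  proof -
    have inner: "(\<integral>\<^sup>+y. indicator E (x, y) \<partial>normal1 b) = (\<integral>\<^sup>+y. ennreal (normal_density b 1 y) * indicator E (x, y) \<partial>lborel)" for x
      by (rule nn_integral_normal1) measurable
    show ?thesis unfolding inner by (rule nn_integral_normal1) measurable
  qed
  also have "\<dots> = (\<integral>\<^sup>+x. \<integral>\<^sup>+y. ennreal (normal_density a 1 x * normal_density b 1 y) * indicator E (x, y) \<partial>lborel \<partial>lborel)"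
    by (intro nn_integral_cong, subst nn_integral_cmult[symmetric], measurable)
       (simp only: ennreal_mult[OF normal_density_nonneg normal_density_nonneg] mult.assoc)
  finally show ?thesis .
qed

text \<open>The rotation taking \<open>(a, b)\<close> to \<open>(0, c)\<close> preserves the
  Gaussian density. It links the coordinates \<open>(U, V)\<close> of \<open>S_tail\<close> with
  those of the projected observations. As only \<open>c\<^sup>2\<close> is prescribed,
  \<open>c\<close> may be negative, which serves the mixture component with mean
  \<open>- \<mu>\<close>.\<close>

lemma normal1_pair_rotation:
  assumes E[measurable]: "E \<in> sets (borel \<Otimes>\<^sub>M borel)"
    and c: "c\<^sup>2 = a\<^sup>2 + b\<^sup>2" "b \<noteq> 0"
  shows "measure (normal1 0 \<Otimes>\<^sub>M normal1 c) E =
    measure (normal1 a \<Otimes>\<^sub>M normal1 b) {(x, y). ((b * x - a * y) / c, (a * x + b * y) / c) \<in> E}"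
proof -
  have c0: "c \<noteq> 0" using c by (auto simp: sum_power2_eq_zero_iff)
  let ?E = "{(x, y). ((b * x - a * y) / c, (a * x + b * y) / c) \<in> E}"
  have E': "?E \<in> sets (borel \<Otimes>\<^sub>M borel)"
  proof -
    have "(\<lambda>(x, y). ((b * x - a * y) / c, (a * x + b * y) / c)) \<in> (borel \<Otimes>\<^sub>M borel :: (real \<times> real) measure) \<rightarrow>\<^sub>M (borel \<Otimes>\<^sub>M borel)"
      by measurable
    from measurable_sets[OF this E] show ?thesis
      by (simp add: space_pair_measure vimage_def case_prod_beta')
  qed
  have dens: "normal_density 0 1 ((b * x - a * y) / c) * normal_density c 1 ((a * x + b * y) / c)
      = normal_density a 1 x * normal_density b 1 y" for x y
  proof -
    have sq: "(b * x - a * y)\<^sup>2 + (a * x + b * y)\<^sup>2 = c\<^sup>2 * (x\<^sup>2 + y\<^sup>2)"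
      unfolding c(1) by (simp add: algebra_simps power2_eq_square)
    have "((b * x - a * y) / c)\<^sup>2 + ((a * x + b * y) / c - c)\<^sup>2 =
        ((b * x - a * y)\<^sup>2 + (a * x + b * y)\<^sup>2) / c\<^sup>2 - 2 * (a * x + b * y) + c\<^sup>2"
    proof -
      have "((a * x + b * y) / c - c)\<^sup>2 = ((a * x + b * y) / c)\<^sup>2 - 2 * (a * x + b * y) + c\<^sup>2"
        using c0 unfolding power2_diff by simp
      then show ?thesis by (simp only: power_divide add_divide_distrib[of "(b * x - a * y)\<^sup>2"])
    qed
    also have "\<dots> = (x\<^sup>2 + y\<^sup>2) - 2 * (a * x + b * y) + (a\<^sup>2 + b\<^sup>2)"
      unfolding sq by (simp add: c0 c(1)[symmetric])
    also have "\<dots> = (x - a)\<^sup>2 + (y - b)\<^sup>2"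
      by (simp add: power2_eq_square algebra_simps)
    finally have *: "((b * x - a * y) / c)\<^sup>2 + ((a * x + b * y) / c - c)\<^sup>2 = (x - a)\<^sup>2 + (y - b)\<^sup>2" .
    have nd: "normal_density m 1 u * normal_density k 1 v = 1 / (2 * pi) * exp (- ((u - m)\<^sup>2 + (v - k)\<^sup>2) / 2)" for m k u v
      by (simp add: normal_density_def exp_add[symmetric] add_divide_distrib)
    show ?thesis unfolding nd using * by simp
  qed
  have "emeasure (normal1 0 \<Otimes>\<^sub>M normal1 c) E = emeasure (normal1 a \<Otimes>\<^sub>M normal1 b) ?E"
    unfolding normal1_pair_emeasure[OF E] normal1_pair_emeasure[OF E']
    by (subst rotation_nn_integral[OF _ c]) (simp_all add: dens indicator_def)
  then show ?thesis by (simp add: measure_def)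
qed

lemma sets_normal1_pair [measurable_cong]:
  "sets (normal1 a \<Otimes>\<^sub>M normal1 b) = sets (borel \<Otimes>\<^sub>M borel)"
  by (intro sets_pair_measure_cong) simp_all

lemma space_normal1_pair [simp]: "space (normal1 a \<Otimes>\<^sub>M normal1 b) = UNIV"
  by (simp add: space_pair_measure)

lemma Collect_pair_sets:
  assumes "(\<lambda>z. P (fst z) (snd z)) \<in> borel \<Otimes>\<^sub>M borel \<rightarrow>\<^sub>M count_space UNIV"
  shows "{(x :: real, y :: real). P x y} \<in> sets (borel \<Otimes>\<^sub>M borel)"
proof -
  have "{(x, y). P x y} = {z \<in> space (borel \<Otimes>\<^sub>M borel :: (real \<times> real) measure). P (fst z) (snd z)}"
    by (auto simp: space_pair_measure)
  then show ?thesis using assms by (simp add: pred_def)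
qed

section \<open>Change of mean and chi-square comparison\<close>

lemma normal1_likelihood_ratio:
  "normal1 a1 = density (normal1 a0) (\<lambda>x. ennreal (exp ((a1 - a0) * x - (a1\<^sup>2 - a0\<^sup>2) / 2)))"
proof -
  have "normal_density a1 1 x = normal_density a0 1 x * exp ((a1 - a0) * x - (a1\<^sup>2 - a0\<^sup>2) / 2)" for x
    by (simp add: normal_density_def exp_add[symmetric] field_simps power2_eq_square)
  then show ?thesis
    unfolding normal1_def by (subst density_density_eq) (simp_all add: ennreal_mult'[symmetric])
qed

text \<open>The chi-square divergence of the two Gaussians is $e^{|\Delta|^2}-1$; integrating
  $|g - 1| \le c/2 + (g-1)^2/(2c)$ over \<open>E\<close>, for the likelihood ratio \<open>g\<close>, bounds the
  difference of the probabilities of \<open>E\<close> relative to the probability itself.\<close>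

lemma normal1_pair_chi_square:
  assumes E: "E \<in> sets (borel \<Otimes>\<^sub>M borel)" and c: "c > 0"
  defines "P \<equiv> \<lambda>a b. measure (normal1 a \<Otimes>\<^sub>M normal1 b) E"
  shows "\<bar>P a1 b1 - P a0 b0\<bar> \<le> c / 2 * P a0 b0 + (exp ((a1 - a0)\<^sup>2 + (b1 - b0)\<^sup>2) - 1) / (2 * c)"
proof -
  interpret pair_prob_space "normal1 a0" "normal1 b0" by (rule pair_prob_space_normal1)
  interpret P1: pair_prob_space "normal1 a1" "normal1 b1" by (rule pair_prob_space_normal1)
  let ?N = "normal1 a0 \<Otimes>\<^sub>M normal1 b0"
  define h where "h = (\<lambda>m m0 x. exp ((m - m0) * x - (m\<^sup>2 - m0\<^sup>2) / 2) :: real)"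
  define g where "g = (\<lambda>z. h a1 a0 (fst z) * h b1 b0 (snd z))"
  have [measurable]: "g \<in> borel_measurable ?N" unfolding g_def h_def by measurable
  have EN [measurable]: "E \<in> sets ?N" using E by (simp add: sets_normal1_pair)
  have g_pos: "g z > 0" for z by (simp add: g_def h_def)
  \<comment> \<open>Moments of the likelihood ratio under the base law: \<open>k = 1\<close> gives
    its normalisation, \<open>k = 2\<close> the chi-square divergence plus one.\<close>
  have moment: "(\<integral>\<^sup>+x. ennreal (h m m0 x ^ k) \<partial>normal1 m0) = ennreal (exp (((real k)\<^sup>2 - real k) / 2 * (m - m0)\<^sup>2))" for m m0 k
  proof -
    have "(\<integral>\<^sup>+x. ennreal (h m m0 x ^ k) \<partial>normal1 m0) =
      (\<integral>\<^sup>+x. ennreal (exp (- (k * ((m\<^sup>2 - m0\<^sup>2) / 2)))) * ennreal (exp ((k * (m - m0)) * x)) \<partial>normal1 m0)"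
      by (intro nn_integral_cong)
         (simp add: h_def exp_of_nat_mult[symmetric] ennreal_mult'[symmetric] exp_add[symmetric] algebra_simps)
    also have "\<dots> = ennreal (exp (- (k * ((m\<^sup>2 - m0\<^sup>2) / 2)))) * ennreal (exp ((k * (m - m0)) * m0 + (k * (m - m0))\<^sup>2 / 2))"
      by (subst nn_integral_cmult) (simp_all add: normal1_mgf)
    also have "\<dots> = ennreal (exp (((real k)\<^sup>2 - real k) / 2 * (m - m0)\<^sup>2))"
      by (simp add: ennreal_mult'[symmetric] exp_add[symmetric] field_simps power2_eq_square)
    finally show ?thesis .
  qed
  have g_moment: "integrable ?N (\<lambda>z. g z ^ k)
      \<and> (\<integral>z. g z ^ k \<partial>?N) = exp (((real k)\<^sup>2 - real k) / 2 * ((a1 - a0)\<^sup>2 + (b1 - b0)\<^sup>2))" for k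
  proof -
    have [measurable]: "h m m0 \<in> borel_measurable borel" for m m0 unfolding h_def by measurable
    have "(\<integral>\<^sup>+z. ennreal (g z ^ k) \<partial>?N) = (\<integral>\<^sup>+x. \<integral>\<^sup>+y. ennreal (h a1 a0 x ^ k) * ennreal (h b1 b0 y ^ k) \<partial>normal1 b0 \<partial>normal1 a0)"
      by (subst M2.nn_integral_fst[symmetric])
         (simp_all add: g_def power_mult_distrib ennreal_mult' h_def)
    also have "\<dots> = (\<integral>\<^sup>+x. ennreal (h a1 a0 x ^ k) * ennreal (exp (((real k)\<^sup>2 - real k) / 2 * (b1 - b0)\<^sup>2)) \<partial>normal1 a0)"
      by (intro nn_integral_cong) (subst nn_integral_cmult, simp_all add: moment)
    also have "\<dots> = ennreal (exp (((real k)\<^sup>2 - real k) / 2 * (a1 - a0)\<^sup>2)) * ennreal (exp (((real k)\<^sup>2 - real k) / 2 * (b1 - b0)\<^sup>2))"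
      by (subst nn_integral_multc) (simp_all add: moment)
    also have "\<dots> = ennreal (exp (((real k)\<^sup>2 - real k) / 2 * ((a1 - a0)\<^sup>2 + (b1 - b0)\<^sup>2)))"
      by (simp add: ennreal_mult'[symmetric] exp_add[symmetric] distrib_left)
    finally have *: "(\<integral>\<^sup>+z. ennreal (g z ^ k) \<partial>?N) = ennreal (exp (((real k)\<^sup>2 - real k) / 2 * ((a1 - a0)\<^sup>2 + (b1 - b0)\<^sup>2)))" .
    have "has_bochner_integral ?N (\<lambda>z. g z ^ k) (exp (((real k)\<^sup>2 - real k) / 2 * ((a1 - a0)\<^sup>2 + (b1 - b0)\<^sup>2)))"
      using g_pos * by (intro has_bochner_integral_nn_integral) (auto simp: less_imp_le)
    then show ?thesis by (simp add: has_bochner_integral_iff)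
  qed
  have g1: "integrable ?N g" "(\<integral>z. g z \<partial>?N) = 1" using g_moment[of 1] by simp_all
  have g2: "integrable ?N (\<lambda>z. (g z)\<^sup>2)" "(\<integral>z. (g z)\<^sup>2 \<partial>?N) = exp ((a1 - a0)\<^sup>2 + (b1 - b0)\<^sup>2)"
    using g_moment[of 2] by simp_all
  have "normal1 a1 \<Otimes>\<^sub>M normal1 b1 = density ?N (\<lambda>(x, y). ennreal (h a1 a0 x) * ennreal (h b1 b0 y))"
  proof -
    have ratio: "normal1 m = density (normal1 m0) (\<lambda>x. ennreal (h m m0 x))" for m m0
      unfolding h_def by (rule normal1_likelihood_ratio)
    have [measurable]: "h m m0 \<in> borel_measurable borel" for m m0 unfolding h_def by measurable
    have "normal1 a1 \<Otimes>\<^sub>M normal1 b1 = density (normal1 a0) (\<lambda>x. ennreal (h a1 a0 x)) \<Otimes>\<^sub>M density (normal1 b0) (\<lambda>x. ennreal (h b1 b0 x))"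
      by (simp only: ratio[symmetric])
    also have "\<dots> = density ?N (\<lambda>(x, y). ennreal (h a1 a0 x) * ennreal (h b1 b0 y))"
      by (intro pair_measure_density)
         (measurable, simp_all add: ratio[symmetric] prob_space_imp_sigma_finite prob_space_normal1)
    finally show ?thesis .
  qed
  also have "\<dots> = density ?N (\<lambda>z. ennreal (g z))"
    by (intro density_cong) (auto simp: g_def h_def ennreal_mult' split: prod.splits)
  finally have dens: "normal1 a1 \<Otimes>\<^sub>M normal1 b1 = density ?N (\<lambda>z. ennreal (g z))" .
  have P1: "P a1 b1 = (\<integral>z. g z * indicator E z \<partial>?N)"
  proof -
    have "P a1 b1 = (\<integral>z. indicator E z \<partial>density ?N (\<lambda>z. ennreal (g z)))"
      unfolding P_def dens[symmetric] using E by (simp add: sets_normal1_pair)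
    also have "\<dots> = (\<integral>z. g z *\<^sub>R indicator E z \<partial>?N)"
      using g_pos by (intro integral_density) (auto simp: less_imp_le)
    finally show ?thesis by simp
  qed
  have P0: "P a0 b0 = (\<integral>z. indicator E z \<partial>?N)" unfolding P_def by simp
  have intE: "integrable ?N (\<lambda>z. indicator E z :: real)"
    using EN by (intro integrable_real_indicator) (simp_all add: emeasure_eq_measure)
  have intg: "integrable ?N (\<lambda>z. g z * indicator E z)"
    using integrable_mult_indicator[OF EN g1(1)] by (simp add: mult.commute)
  have sq: "(\<lambda>z. (g z - 1)\<^sup>2) = (\<lambda>z. (g z)\<^sup>2 - 2 * g z + 1)"
    by (simp add: power2_eq_square algebra_simps)
  have intsq: "integrable ?N (\<lambda>z. (g z - 1)\<^sup>2)" unfolding sq using g1 g2 by auto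
  have sq_val: "(\<integral>z. (g z - 1)\<^sup>2 \<partial>?N) = exp ((a1 - a0)\<^sup>2 + (b1 - b0)\<^sup>2) - 1"
    unfolding sq using g1 g2 prob_space by simp
  have "P a1 b1 - P a0 b0 = (\<integral>z. (g z - 1) * indicator E z \<partial>?N)"
    unfolding P1 P0 left_diff_distrib using intE intg by simp
  then have "\<bar>P a1 b1 - P a0 b0\<bar> \<le> (\<integral>z. \<bar>(g z - 1) * indicator E z\<bar> \<partial>?N)"
    by simp
  also have "\<dots> \<le> (\<integral>z. c / 2 * indicator E z + (g z - 1)\<^sup>2 / (2 * c) \<partial>?N)"
  proof (rule integral_mono)
    show "integrable ?N (\<lambda>z. \<bar>(g z - 1) * indicator E z\<bar>)"
      unfolding left_diff_distrib using intE intg by auto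
    show "integrable ?N (\<lambda>z. c / 2 * indicator E z + (g z - 1)\<^sup>2 / (2 * c))"
      using intE intsq by auto
    fix z
    have "0 \<le> (\<bar>g z - 1\<bar> - c)\<^sup>2" by simp
    then have "2 * c * \<bar>g z - 1\<bar> \<le> c\<^sup>2 + (g z - 1)\<^sup>2"
      by (simp add: power2_diff algebra_simps)
    then have "\<bar>g z - 1\<bar> \<le> c / 2 + (g z - 1)\<^sup>2 / (2 * c)"
      using c by (simp add: field_simps power2_eq_square)
    then show "\<bar>(g z - 1) * indicator E z\<bar> \<le> c / 2 * indicator E z + (g z - 1)\<^sup>2 / (2 * c)"
      using c by (auto simp: indicator_def)
  qed
  also have "\<dots> = c / 2 * P a0 b0 + (exp ((a1 - a0)\<^sup>2 + (b1 - b0)\<^sup>2) - 1) / (2 * c)"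
    unfolding P0 sq_val[symmetric] using intE intsq by simp
  finally show ?thesis .
qed

text \<open>The free constant of the previous bound is taken as \<open>K / sqrt (P a0 b0)\<close>,
  which makes both terms at most \<open>K / 2 * sqrt (P a0 b0)\<close>. An error proportional to the
  root of the probability is comparable with the standard deviation of a count even for very rare
  events, where a total variation bound would say nothing.\<close>

lemma normal1_pair_chi_square_sqrt:
  assumes E: "E \<in> sets (borel \<Otimes>\<^sub>M borel)"
  defines "P \<equiv> \<lambda>a b. measure (normal1 a \<Otimes>\<^sub>M normal1 b) E"
  assumes pos: "P a0 b0 > 0" and K: "K > 0" "exp ((a1 - a0)\<^sup>2 + (b1 - b0)\<^sup>2) - 1 \<le> K\<^sup>2"
  shows "\<bar>P a1 b1 - P a0 b0\<bar> \<le> K * sqrt (P a0 b0)"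
proof -
  define l where "l = K / sqrt (P a0 b0)"
  have l: "l > 0" using pos K by (simp add: l_def)
  have "\<bar>P a1 b1 - P a0 b0\<bar> \<le> l / 2 * P a0 b0 + (exp ((a1 - a0)\<^sup>2 + (b1 - b0)\<^sup>2) - 1) / (2 * l)"
    using normal1_pair_chi_square[OF E l] unfolding P_def .
  also have "\<dots> \<le> l / 2 * P a0 b0 + K\<^sup>2 / (2 * l)"
    using K l by (intro add_left_mono divide_right_mono) auto
  also have "l / 2 * P a0 b0 = K / 2 * (P a0 b0 / sqrt (P a0 b0))"
    by (simp add: l_def)
  also have "P a0 b0 / sqrt (P a0 b0) = sqrt (P a0 b0)"
    using pos by (simp add: real_div_sqrt)
  also have "K\<^sup>2 / (2 * l) = K / 2 * sqrt (P a0 b0)"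
    using K pos by (simp add: l_def power2_eq_square)
  finally show ?thesis by simp
qed

section \<open>Gaussian mass of intervals and boxes\<close>

lemma normal1_interval_le:
  assumes "x \<le> y"
  shows "emeasure (normal1 m) {x..y} \<le> ennreal ((y - x) / 2)"
proof -
  have "normal_density m 1 t \<le> 1 / 2" for t
  proof -
    have "2 \<le> sqrt (2 * pi)" using pi_gt3 by (intro real_le_rsqrt) simp
    then have "1 / sqrt (2 * pi) \<le> 1 / 2" by (intro divide_left_mono) auto
    moreover have "exp (- (t - m)\<^sup>2 / 2) \<le> 1" by simp
    ultimately have "1 / sqrt (2 * pi) * exp (- (t - m)\<^sup>2 / 2) \<le> 1 / 2 * 1"
      by (intro mult_mono) auto
    then show ?thesis by (simp add: normal_density_def)
  qed
  then have "ennreal (normal_density m 1 t) \<le> ennreal (1 / 2)" for t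
    by (rule ennreal_leI)
  then have "emeasure (normal1 m) {x..y} \<le> (\<integral>\<^sup>+t. ennreal (1 / 2) * indicator {x..y} t \<partial>lborel)"
    unfolding normal1_def
    by (subst emeasure_density) (simp, simp, intro nn_integral_mono mult_right_mono, simp_all only: zero_le)
  also have "\<dots> = ennreal (1 / 2) * ennreal (y - x)"
    using assms by (subst nn_integral_cmult_indicator) auto
  also have "\<dots> = ennreal ((y - x) / 2)"
    by (simp only: ennreal_mult'[symmetric]) simp
  finally show ?thesis .
qed

lemma normal1_interval_ge:
  assumes "w \<ge> 0"
  shows "measure (normal1 m) {x - w..x + w} \<ge> 2 * w / sqrt (2 * pi) * exp (- ((\<bar>x - m\<bar> + w)\<^sup>2 / 2))"
proof -
  interpret prob_space "normal1 m" by (rule prob_space_normal1)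
  define D where "D = 1 / sqrt (2 * pi) * exp (- ((\<bar>x - m\<bar> + w)\<^sup>2 / 2))"
  have D: "D \<ge> 0" by (simp add: D_def)
  have "D \<le> normal_density m 1 t" if "t \<in> {x - w..x + w}" for t
  proof -
    have "\<bar>t - m\<bar> \<le> \<bar>x - m\<bar> + w" using that by auto
    then have "(t - m)\<^sup>2 \<le> (\<bar>x - m\<bar> + w)\<^sup>2" by (metis abs_ge_zero power2_abs power_mono)
    then show ?thesis unfolding D_def normal_density_def
      by (simp add: divide_right_mono)
  qed
  then have "(\<integral>\<^sup>+t. ennreal D * indicator {x - w..x + w} t \<partial>lborel) \<le> emeasure (normal1 m) {x - w..x + w}"
    unfolding normal1_def
    by (subst emeasure_density) (auto intro!: nn_integral_mono ennreal_leI simp: indicator_def)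
  moreover have "(\<integral>\<^sup>+t. ennreal D * indicator {x - w..x + w} t \<partial>lborel) = ennreal (D * (2 * w))"
    using assms D by (subst nn_integral_cmult_indicator) (auto simp: ennreal_mult'[symmetric])
  ultimately have "ennreal (D * (2 * w)) \<le> ennreal (measure (normal1 m) {x - w..x + w})"
    by (simp add: emeasure_eq_measure)
  then show ?thesis by (simp add: D_def mult_ac)
qed

lemma normal1_pair_box_le:
  assumes E: "E \<in> sets (borel \<Otimes>\<^sub>M borel)" and AB: "A \<in> sets borel" "B \<in> sets borel" "A \<times> B \<subseteq> E"
  shows "measure (normal1 a) A * measure (normal1 b) B \<le> measure (normal1 a \<Otimes>\<^sub>M normal1 b) E"
proof -
  interpret pair_prob_space "normal1 a" "normal1 b" by (rule pair_prob_space_normal1)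
  have "measure (normal1 a \<Otimes>\<^sub>M normal1 b) (A \<times> B) \<le> measure (normal1 a \<Otimes>\<^sub>M normal1 b) E"
    using E AB by (intro finite_measure_mono) (auto simp: sets_normal1_pair)
  then show ?thesis
    using AB by (simp add: measure_def M2.emeasure_pair_measure_Times enn2real_mult)
qed

subsection \<open>The tail function of the reduced problem\<close>

text \<open>\<open>m1\<close>, \<open>m2\<close> are the true means and \<open>a\<close>,
  \<open>b\<close> the plug-in weights. The tail used for centring is the diagonal case
  \<open>C_tail a b a b\<close>; a mismatched index has the sign of one mean reversed.\<close>

definition C_tail :: "real \<Rightarrow> real \<Rightarrow> real \<Rightarrow> real \<Rightarrow> real \<Rightarrow> real" where
  "C_tail m1 m2 a b T = measure (normal1 m1 \<Otimes>\<^sub>M normal1 m2) {(x, y). C_minus x y a b > T}"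

lemma C_minus_sets [measurable]: "{(x, y). C_minus x y a b > T} \<in> sets (borel \<Otimes>\<^sub>M borel)"
  unfolding C_minus_def by (rule Collect_pair_sets) measurable

lemma C_tail_uminus: "C_tail (- m1) (- m2) a b T = C_tail m1 m2 a b T"
proof -
  interpret pair_prob_space "normal1 m1" "normal1 m2" by (rule pair_prob_space_normal1)
  have "normal1 (- m1) \<Otimes>\<^sub>M normal1 (- m2) = distr (normal1 m1) borel uminus \<Otimes>\<^sub>M distr (normal1 m2) borel uminus"
    by (simp add: normal1_uminus)
  also have "\<dots> = distr (normal1 m1 \<Otimes>\<^sub>M normal1 m2) (borel \<Otimes>\<^sub>M borel) (\<lambda>(x, y). (- x, - y))"
    by (rule pair_measure_distr)
       (simp_all add: normal1_uminus prob_space_imp_sigma_finite prob_space_normal1)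
  finally have distr_eq: "normal1 (- m1) \<Otimes>\<^sub>M normal1 (- m2) = distr (normal1 m1 \<Otimes>\<^sub>M normal1 m2) (borel \<Otimes>\<^sub>M borel) (\<lambda>(x, y). (- x, - y))" .
  have "C_tail (- m1) (- m2) a b T =
    measure (normal1 m1 \<Otimes>\<^sub>M normal1 m2) ((\<lambda>(x, y). (- x, - y)) -` {(x, y). C_minus x y a b > T} \<inter> space (normal1 m1 \<Otimes>\<^sub>M normal1 m2))"
    unfolding C_tail_def distr_eq by (rule measure_distr[OF _ C_minus_sets]) measurable
  also have "(\<lambda>(x, y). (- x, - y)) -` {(x, y). C_minus x y a b > T} \<inter> space (normal1 m1 \<Otimes>\<^sub>M normal1 m2) = {(x, y). C_minus x y a b > T}"
  proof -
    have "C_minus (- x) (- y) a b = C_minus x y a b" for x y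
      unfolding C_minus_def by (simp add: abs_minus_commute)
    then show ?thesis by auto
  qed
  finally show ?thesis unfolding C_tail_def .
qed

lemma C_tail_swap: "C_tail m2 m1 b a T = C_tail m1 m2 a b T"
proof -
  interpret pair_prob_space "normal1 m2" "normal1 m1" by (rule pair_prob_space_normal1)
  have "C_tail m2 m1 b a T = measure (distr (normal1 m1 \<Otimes>\<^sub>M normal1 m2) (normal1 m2 \<Otimes>\<^sub>M normal1 m1) (\<lambda>(x, y). (y, x))) {(x, y). C_minus x y b a > T}"
    unfolding C_tail_def by (subst distr_pair_swap) (rule refl)
  also have "\<dots> = measure (normal1 m1 \<Otimes>\<^sub>M normal1 m2) ((\<lambda>(x, y). (y, x)) -` {(x, y). C_minus x y b a > T} \<inter> space (normal1 m1 \<Otimes>\<^sub>M normal1 m2))"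
    by (rule measure_distr)
       (simp_all only: measurable_cong_sets[OF sets_normal1_pair sets_normal1_pair] measurable_pair_swap' sets_normal1_pair C_minus_sets)
  also have "(\<lambda>(x, y). (y, x)) -` {(x, y). C_minus x y b a > T} \<inter> space (normal1 m1 \<Otimes>\<^sub>M normal1 m2) = {(x, y). C_minus x y a b > T}"
    by (auto simp: C_minus_def abs_minus_commute add.commute)
  finally show ?thesis unfolding C_tail_def .
qed

text \<open>In the quadrant \<open>x > 0 > y\<close> the statistic is twice the minimum of
  \<open>a * x\<close> and \<open>- b * y\<close>, so a box far out lies in the event. Positivity
  keeps the denominators of the statistics nonzero and the test off its default branch.\<close>

lemma C_tail_pos:
  assumes "a > 0" "b > 0"
  shows "C_tail m1 m2 a b T > 0"
proof -
  define x where "x = (\<bar>T\<bar> + 1) / a + 1"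
  define y where "y = - ((\<bar>T\<bar> + 1) / b + 1)"
  have "{x - 1..x + 1} \<times> {y - 1..y + 1} \<subseteq> {(x, y). C_minus x y a b > T}"
  proof safe
    fix u v assume uv: "u \<in> {x - 1..x + 1}" "v \<in> {y - 1..y + 1}"
    have "(\<bar>T\<bar> + 1) / a \<le> u" "(\<bar>T\<bar> + 1) / b \<le> - v"
      using uv by (auto simp: x_def y_def)
    then have "\<bar>T\<bar> + 1 \<le> a * u" "b * v \<le> - (\<bar>T\<bar> + 1)"
      using assms by (auto simp: field_simps)
    then show "C_minus u v a b > T" unfolding C_minus_def by linarith
  qed
  then have "measure (normal1 m1) {x - 1..x + 1} * measure (normal1 m2) {y - 1..y + 1} \<le> C_tail m1 m2 a b T"
    unfolding C_tail_def by (intro normal1_pair_box_le C_minus_sets) auto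
  moreover have "measure (normal1 m) {u - 1..u + 1} > 0" for m u
    by (rule less_le_trans[OF _ normal1_interval_ge[of 1 u m]]) auto
  ultimately show ?thesis by (smt (verit) mult_pos_pos)
qed

lemma S_tail_event_sets: "{(u, v). \<bar>sqrt r * u + sqrt s * v\<bar> - sqrt (r + s) * \<bar>v\<bar> > t} \<in> sets (borel \<Otimes>\<^sub>M borel)"
  by (rule Collect_pair_sets) measurable

text \<open>After rotating by the angle of \<open>(a, b)\<close>,
  \<open>sqrt r_hat * u + sqrt s_hat * v\<close> becomes \<open>(a * x - b * y) / K\<close> and the
  modulus subtracted from it becomes that of \<open>(a * x + b * y) / K\<close>, so the event of
  \<open>S_tail\<close> turns into that of \<open>C_minus\<close>. The order
  \<open>b \<le> a\<close> fixes the root \<open>sqrt s_hat\<close> as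
  \<open>(a\<^sup>2 - b\<^sup>2) / (K * c)\<close>.\<close>

lemma S_tail_eq_C_tail_aux:
  assumes ab: "0 < b" "b \<le> a" and n: "n \<ge> 2"
  shows "S_tail n (r_hat n a b) (s_hat n a b) t = C_tail a b a b (t * sqrt (2 * ln (real n)))"
proof -
  define K where "K = sqrt (2 * ln (real n))"
  define c where "c = sqrt (a\<^sup>2 + b\<^sup>2)"
  have K: "K > 0" using n by (simp add: K_def)
  have K2: "2 * ln (real n) = K\<^sup>2" using n by (simp add: K_def)
  have c2: "c\<^sup>2 = a\<^sup>2 + b\<^sup>2" by (simp add: c_def)
  have c: "c > 0" using ab by (simp add: c_def add_pos_pos)
  have a: "a > 0" using ab by simp
  have r: "r_hat n a b = (2 * a * b / (K * c))\<^sup>2"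
    using a ab by (simp add: r_hat_def K2 c2[symmetric] power_divide power_mult_distrib)
  have s: "s_hat n a b = ((a\<^sup>2 - b\<^sup>2) / (K * c))\<^sup>2"
    by (simp add: s_hat_def K2 c2[symmetric] power_divide power_mult_distrib)
  have rs: "r_hat n a b + s_hat n a b = (c / K)\<^sup>2"
  proof -
    have "(2 * a * b)\<^sup>2 + (a\<^sup>2 - b\<^sup>2)\<^sup>2 = (c\<^sup>2)\<^sup>2"
      unfolding c2 by (simp add: power2_eq_square algebra_simps)
    then have "r_hat n a b + s_hat n a b = (c\<^sup>2)\<^sup>2 / (K * c)\<^sup>2"
      unfolding r s power_divide add_divide_distrib[symmetric] by simp
    then show ?thesis using c K by (simp add: power2_eq_square)
  qed
  have sqrts: "sqrt (r_hat n a b) = 2 * a * b / (K * c)" "sqrt (s_hat n a b) = (a\<^sup>2 - b\<^sup>2) / (K * c)"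
    "sqrt (r_hat n a b + s_hat n a b) = c / K"
  proof -
    have "b\<^sup>2 \<le> a\<^sup>2" using ab by (intro power_mono) auto
    then show "sqrt (s_hat n a b) = (a\<^sup>2 - b\<^sup>2) / (K * c)" unfolding s using K c by (intro real_sqrt_unique) auto
    show "sqrt (r_hat n a b) = 2 * a * b / (K * c)" unfolding r using a ab K c by simp
    show "sqrt (r_hat n a b + s_hat n a b) = c / K" unfolding rs using K c by simp
  qed
  have mu: "sqrt (2 * (r_hat n a b + s_hat n a b) * ln (real n)) = c"
  proof -
    have "2 * (r_hat n a b + s_hat n a b) * ln (real n) = (r_hat n a b + s_hat n a b) * K\<^sup>2"
      by (simp only: K2[symmetric] mult_ac)
    then show ?thesis using K c by (simp add: rs power_mult_distrib[symmetric])
  qed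
  let ?E = "{(u, v). \<bar>sqrt (r_hat n a b) * u + sqrt (s_hat n a b) * v\<bar> - sqrt (r_hat n a b + s_hat n a b) * \<bar>v\<bar> > t}"
  have event: "{(x, y). ((b * x - a * y) / c, (a * x + b * y) / c) \<in> ?E} = {(x, y). C_minus x y a b > t * K}"
  proof -
    have "(\<bar>2 * a * b / (K * c) * ((b * x - a * y) / c) + (a\<^sup>2 - b\<^sup>2) / (K * c) * ((a * x + b * y) / c)\<bar> - c / K * \<bar>(a * x + b * y) / c\<bar> > t)
       \<longleftrightarrow> C_minus x y a b > t * K" for x y
    proof -
      have num: "2 * a * b * (b * x - a * y) + (a\<^sup>2 - b\<^sup>2) * (a * x + b * y) = c\<^sup>2 * (a * x - b * y)"
        unfolding c2 by (simp add: power2_eq_square algebra_simps)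
      have "2 * a * b / (K * c) * ((b * x - a * y) / c) + (a\<^sup>2 - b\<^sup>2) / (K * c) * ((a * x + b * y) / c)
         = (2 * a * b * (b * x - a * y) + (a\<^sup>2 - b\<^sup>2) * (a * x + b * y)) / (K * c * c)"
        by (simp only: times_divide_times_eq add_divide_distrib[symmetric])
      also have "\<dots> = (a * x - b * y) / K"
        unfolding num using c by (simp add: power2_eq_square)
      finally have e: "2 * a * b / (K * c) * ((b * x - a * y) / c) + (a\<^sup>2 - b\<^sup>2) / (K * c) * ((a * x + b * y) / c) = (a * x - b * y) / K" .
      have "c / K * \<bar>(a * x + b * y) / c\<bar> = \<bar>a * x + b * y\<bar> / K"
        unfolding abs_divide using c by simp
      moreover have "\<bar>(a * x - b * y) / K\<bar> = \<bar>a * x - b * y\<bar> / K"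
        unfolding abs_divide using K by simp
      ultimately have "\<bar>2 * a * b / (K * c) * ((b * x - a * y) / c) + (a\<^sup>2 - b\<^sup>2) / (K * c) * ((a * x + b * y) / c)\<bar> - c / K * \<bar>(a * x + b * y) / c\<bar>
        = C_minus x y a b / K"
        unfolding e C_minus_def by (simp only: diff_divide_distrib)
      then show ?thesis using K by (simp add: less_divide_eq)
    qed
    then show ?thesis unfolding sqrts by (simp only: mem_Collect_eq case_prod_conv)
  qed
  have "measure (normal1 0 \<Otimes>\<^sub>M normal1 c) ?E = C_tail a b a b (t * K)"
    unfolding C_tail_def
    by (subst normal1_pair_rotation[OF S_tail_event_sets c2]) (use ab event in auto)
  \<comment> \<open>Reversing \<open>a\<close>, \<open>b\<close> and \<open>c\<close> together
    leaves the rotation unchanged, so the second mixture component has the same event under the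
    means \<open>(- a, - b)\<close>; \<open>C_tail_uminus\<close> then makes both components
    equal.\<close>
  moreover have "measure (normal1 0 \<Otimes>\<^sub>M normal1 (- c)) ?E = C_tail (- a) (- b) a b (t * K)"
  proof -
    have "(- b * x - (- a) * y) / (- c) = (b * x - a * y) / c" "(- a * x + (- b) * y) / (- c) = (a * x + b * y) / c" for x y
      using c by (simp_all add: field_simps)
    then show ?thesis
      unfolding C_tail_def event[symmetric]
      by (subst normal1_pair_rotation[OF S_tail_event_sets, of "- c" "- a" "- b"]) (use ab c2 in auto)
  qed
  ultimately show ?thesis
    unfolding S_tail_def Let_def mu K_def[symmetric] C_tail_uminus by simp
qed

lemma S_tail_eq_C_tail:
  assumes ab: "0 < a" "0 < b" and n: "n \<ge> 2"
  shows "S_tail n (r_hat n a b) (s_hat n a b) t = C_tail a b a b (t * sqrt (2 * ln (real n)))"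
proof (cases "b \<le> a")
  case True
  then show ?thesis using S_tail_eq_C_tail_aux ab n by auto
next
  case False
  have "r_hat n a b = r_hat n b a" "s_hat n a b = s_hat n b a"
    by (simp_all add: r_hat_def s_hat_def abs_minus_commute ac_simps)
  then show ?thesis
    using S_tail_eq_C_tail_aux[of a b n t] False ab n C_tail_swap[of b a b a] by simp
qed

text \<open>Since $|\sqrt r u + \sqrt s v| - \sqrt{r+s}\,|v| \le \sqrt r |u| - \kappa |v|$ for
  $\kappa \le \sqrt{r+s} - \sqrt s$, the event is covered by two half-planes.\<close>

lemma S_tail_le:
  assumes r: "r > 0" and s: "s \<ge> 0" and n: "n \<ge> 2"
    and kappa: "0 \<le> \<kappa>" "\<kappa> \<le> sqrt (r + s) - sqrt s" and pos: "0 \<le> \<tau> + \<kappa> * sqrt (r + s)"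
  shows "S_tail n r s (\<tau> * sqrt (2 * ln (real n))) \<le> 2 * real n powr (- ((\<tau> + \<kappa> * sqrt (r + s))\<^sup>2 / (r + \<kappa>\<^sup>2)))"
proof -
  define K where "K = sqrt (2 * ln (real n))"
  have K: "K > 0" and K2: "K\<^sup>2 = 2 * ln (real n)" using n by (auto simp: K_def)
  define m where "m = sqrt (r + s) * K"
  have mu: "sqrt (2 * (r + s) * ln (real n)) = m"
    unfolding m_def K_def real_sqrt_mult[symmetric] by (simp add: mult_ac)
  let ?E = "{(u, v). \<bar>sqrt r * u + sqrt s * v\<bar> - sqrt (r + s) * \<bar>v\<bar> > \<tau> * K}"
  have main: "measure (normal1 0 \<Otimes>\<^sub>M normal1 (e * m)) ?E \<le> 2 * real n powr (- ((\<tau> + \<kappa> * sqrt (r + s))\<^sup>2 / (r + \<kappa>\<^sup>2)))"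
    if e: "e = 1 \<or> e = -1" for e :: real
  proof -
    interpret pair_prob_space "normal1 0" "normal1 (e * m)" by (rule pair_prob_space_normal1)
    \<comment> \<open>For the component with mean \<open>e * m\<close>,
      \<open>- \<kappa> * \<bar>v\<bar>\<close> is relaxed to \<open>- \<kappa> * e * v\<close>. The
      resulting half-plane recedes from the mean, which adds \<open>\<kappa> * sqrt (r + s)\<close>
      to the threshold; the two signs of \<open>g\<close> account for the modulus of
      \<open>u\<close>.\<close>
    let ?H = "\<lambda>g. {(u, v). g * u + (- e * \<kappa>) * v > \<tau> * K}"
    have H: "?H g \<in> sets (normal1 0 \<Otimes>\<^sub>M normal1 (e * m))" for g
      unfolding sets_normal1_pair by (rule Collect_pair_sets) measurable
    have e2: "e\<^sup>2 = 1" "e * e = 1" using e by auto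
    have half: "measure (normal1 0 \<Otimes>\<^sub>M normal1 (e * m)) (?H g) \<le> real n powr (- ((\<tau> + \<kappa> * sqrt (r + s))\<^sup>2 / (r + \<kappa>\<^sup>2)))"
      if g: "g\<^sup>2 = r" for g
    proof -
      have val: "\<tau> * K - g * 0 - (- e * \<kappa>) * (e * m) = (\<tau> + \<kappa> * sqrt (r + s)) * K"
        using e by (auto simp: m_def algebra_simps)
      have "measure (normal1 0 \<Otimes>\<^sub>M normal1 (e * m)) (?H g)
         \<le> exp (- ((\<tau> * K - g * 0 - (- e * \<kappa>) * (e * m))\<^sup>2 / (2 * (g\<^sup>2 + (- e * \<kappa>)\<^sup>2))))"
      proof (rule normal1_pair_linear_tail)
        show "0 < g\<^sup>2 + (- e * \<kappa>)\<^sup>2" using g r by (simp add: add_pos_nonneg)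
        have "0 \<le> (\<tau> + \<kappa> * sqrt (r + s)) * K" using pos K by simp
        then show "g * 0 + (- e * \<kappa>) * (e * m) \<le> \<tau> * K" using val by linarith
      qed
      also have "(\<tau> * K - g * 0 - (- e * \<kappa>) * (e * m))\<^sup>2 / (2 * (g\<^sup>2 + (- e * \<kappa>)\<^sup>2))
          = (\<tau> + \<kappa> * sqrt (r + s))\<^sup>2 / (r + \<kappa>\<^sup>2) * ln (real n)"
      proof -
        define D where "D = r + \<kappa>\<^sup>2"
        have "g\<^sup>2 + (- e * \<kappa>)\<^sup>2 = D" using g e by (auto simp: D_def)
        then show ?thesis unfolding val power_mult_distrib K2 D_def[symmetric] by simp
      qed
      finally show ?thesis using n by (simp add: powr_def)
    qed
    have "?E \<subseteq> ?H (sqrt r) \<union> ?H (- sqrt r)"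
    proof safe
      fix u v
      assume E: "\<tau> * K < \<bar>sqrt r * u + sqrt s * v\<bar> - sqrt (r + s) * \<bar>v\<bar>"
        and not: "\<not> \<tau> * K < - sqrt r * u + - e * \<kappa> * v"
      have "\<bar>sqrt r * u + sqrt s * v\<bar> \<le> \<bar>sqrt r * u\<bar> + sqrt s * \<bar>v\<bar>"
        using s by (metis abs_mult abs_of_nonneg abs_triangle_ineq real_sqrt_ge_zero)
      moreover have "\<kappa> * \<bar>v\<bar> \<le> (sqrt (r + s) - sqrt s) * \<bar>v\<bar>"
        using kappa by (intro mult_right_mono) auto
      moreover have "\<kappa> * (e * v) \<le> \<kappa> * \<bar>v\<bar>" using e kappa by (intro mult_left_mono) auto
      ultimately have "\<tau> * K < \<bar>sqrt r * u\<bar> - \<kappa> * (e * v)"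
        using E by (simp add: left_diff_distrib)
      then show "\<tau> * K < sqrt r * u + - e * \<kappa> * v"
        using not by (auto simp: abs_if mult_ac split: if_splits)
    qed
    then have "measure (normal1 0 \<Otimes>\<^sub>M normal1 (e * m)) ?E \<le> measure (normal1 0 \<Otimes>\<^sub>M normal1 (e * m)) (?H (sqrt r) \<union> ?H (- sqrt r))"
      by (rule finite_measure_mono[OF _ sets.Un[OF H H]])
    also have "\<dots> \<le> measure (normal1 0 \<Otimes>\<^sub>M normal1 (e * m)) (?H (sqrt r)) + measure (normal1 0 \<Otimes>\<^sub>M normal1 (e * m)) (?H (- sqrt r))"
      by (rule measure_Un_le[OF H H])
    also have "\<dots> \<le> 2 * real n powr (- ((\<tau> + \<kappa> * sqrt (r + s))\<^sup>2 / (r + \<kappa>\<^sup>2)))"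
      using half[of "sqrt r"] half[of "- sqrt r"] r by simp
    finally show ?thesis .
  qed
  show ?thesis
    unfolding S_tail_def Let_def mu K_def[symmetric] using main[of 1] main[of "-1"] by simp
qed

lemma S_tail_antimono:
  assumes "t \<le> t'"
  shows "S_tail n r s t' \<le> S_tail n r s t"
proof -
  have "measure (normal1 a \<Otimes>\<^sub>M normal1 b) {(u, v). \<bar>sqrt r * u + sqrt s * v\<bar> - sqrt (r + s) * \<bar>v\<bar> > t'}
    \<le> measure (normal1 a \<Otimes>\<^sub>M normal1 b) {(u, v). \<bar>sqrt r * u + sqrt s * v\<bar> - sqrt (r + s) * \<bar>v\<bar> > t}" for a b
  proof -
    interpret pair_prob_space "normal1 a" "normal1 b" by (rule pair_prob_space_normal1)
    show ?thesis using assms S_tail_event_sets by (intro finite_measure_mono) (auto simp: sets_normal1_pair)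
  qed
  then show ?thesis unfolding S_tail_def Let_def by (intro add_mono mult_left_mono) auto
qed

text \<open>For fixed \<open>v\<close> the values of \<open>u\<close> between the two thresholds lie
  in two intervals of length \<open>(t' - t) / sqrt r\<close>, and a normal density with unit
  variance is below 1/2. This bounds the change of the null tail within one grid cell.\<close>

lemma S_tail_Lipschitz:
  assumes r: "r > 0" and t: "t \<le> t'"
  shows "S_tail n r s t - S_tail n r s t' \<le> (t' - t) / sqrt r"
proof -
  let ?f = "\<lambda>u v. \<bar>sqrt r * u + sqrt s * v\<bar> - sqrt (r + s) * \<bar>v\<bar>"
  let ?E = "\<lambda>t. {(u, v). ?f u v > t}"
  have main: "measure (normal1 a \<Otimes>\<^sub>M normal1 b) (?E t) - measure (normal1 a \<Otimes>\<^sub>M normal1 b) (?E t') \<le> (t' - t) / sqrt r" for a b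
  proof -
    interpret pair_prob_space "normal1 a" "normal1 b" by (rule pair_prob_space_normal1)
    have sets: "?E x \<in> sets (normal1 a \<Otimes>\<^sub>M normal1 b)" for x
      using S_tail_event_sets by (simp add: sets_normal1_pair)
    have diff: "measure (normal1 a \<Otimes>\<^sub>M normal1 b) (?E t) - measure (normal1 a \<Otimes>\<^sub>M normal1 b) (?E t') = measure (normal1 a \<Otimes>\<^sub>M normal1 b) (?E t - ?E t')"
      using t by (intro finite_measure_Diff[symmetric] sets) auto
    have "emeasure (normal1 a \<Otimes>\<^sub>M normal1 b) (?E t - ?E t') = (\<integral>\<^sup>+v. emeasure (normal1 a) ((\<lambda>u. (u, v)) -` (?E t - ?E t')) \<partial>normal1 b)"
      using sets by (intro emeasure_pair_measure_alt2) auto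
    also have "\<dots> \<le> (\<integral>\<^sup>+v. ennreal ((t' - t) / sqrt r) \<partial>normal1 b)"
    proof (intro nn_integral_mono)
      fix v :: real
      define k where "k = sqrt (r + s) * \<bar>v\<bar>"
      define w where "w = sqrt s * v"
      have sr: "sqrt r > 0" using r by simp
      let ?I = "{(t + k - w) / sqrt r..(t' + k - w) / sqrt r}"
      let ?J = "{(- t' - k - w) / sqrt r..(- t - k - w) / sqrt r}"
      have "(\<lambda>u. (u, v)) -` (?E t - ?E t') \<subseteq> ?I \<union> ?J"
      proof
        fix u assume "u \<in> (\<lambda>u. (u, v)) -` (?E t - ?E t')"
        then have "t + k < \<bar>sqrt r * u + w\<bar>" "\<bar>sqrt r * u + w\<bar> \<le> t' + k"
          by (auto simp: k_def w_def)
        then have "(t + k - w \<le> sqrt r * u \<and> sqrt r * u \<le> t' + k - w) \<or> (- t' - k - w \<le> sqrt r * u \<and> sqrt r * u \<le> - t - k - w)"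
          by linarith
        then show "u \<in> ?I \<union> ?J" using sr by (auto simp: divide_le_eq le_divide_eq mult.commute)
      qed
      then have "emeasure (normal1 a) ((\<lambda>u. (u, v)) -` (?E t - ?E t')) \<le> emeasure (normal1 a) (?I \<union> ?J)"
        by (intro emeasure_mono) auto
      also have "\<dots> \<le> emeasure (normal1 a) ?I + emeasure (normal1 a) ?J"
        by (intro emeasure_subadditive) auto
      also have "\<dots> \<le> ennreal ((t' - t) / sqrt r / 2) + ennreal ((t' - t) / sqrt r / 2)"
      proof (intro add_mono)
        have 1: "(t + k - w) / sqrt r \<le> (t' + k - w) / sqrt r" "(- t' - k - w) / sqrt r \<le> (- t - k - w) / sqrt r"
          using t sr by (auto simp: divide_right_mono)
        have 2: "(t' + k - w) / sqrt r - (t + k - w) / sqrt r = (t' - t) / sqrt r" "(- t - k - w) / sqrt r - (- t' - k - w) / sqrt r = (t' - t) / sqrt r"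
          by (simp_all add: diff_divide_distrib[symmetric])
        show "emeasure (normal1 a) ?I \<le> ennreal ((t' - t) / sqrt r / 2)"
          using normal1_interval_le[OF 1(1)] unfolding 2 .
        show "emeasure (normal1 a) ?J \<le> ennreal ((t' - t) / sqrt r / 2)"
          using normal1_interval_le[OF 1(2)] unfolding 2 .
      qed
      also have "\<dots> = ennreal ((t' - t) / sqrt r)"
        using t sr by (subst ennreal_plus[symmetric]) auto
      finally show "emeasure (normal1 a) ((\<lambda>u. (u, v)) -` (?E t - ?E t')) \<le> ennreal ((t' - t) / sqrt r)" .
    qed
    also have "\<dots> = ennreal ((t' - t) / sqrt r)"
      using M2.emeasure_space_1 by simp
    finally have "measure (normal1 a \<Otimes>\<^sub>M normal1 b) (?E t - ?E t') \<le> (t' - t) / sqrt r"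
      using t r by (simp add: emeasure_eq_measure)
    with diff show ?thesis by simp
  qed
  show ?thesis
    unfolding S_tail_def Let_def
    using main[of 0 "- sqrt (2 * (r + s) * ln (real n))"] main[of 0 "sqrt (2 * (r + s) * ln (real n))"] by linarith
qed

subsection \<open>Exponents at the detection boundary\<close>

text \<open>In units of $\sqrt{2\log n}$: \<open>\<tau>\<close> is the threshold, \<open>\<kappa>\<close> the slope of a half-plane whose null
  probability has exponent $(\tau+\kappa c)^2/(r+\kappa^2)$, and \<open>(u, v)\<close> a point of the exceedance
  region, so that the alternative probability has exponent at most its squared distance from
  $(\sqrt r, \sqrt s)$.\<close>

lemma beta_star_witness:
  fixes r s \<beta> :: real
  assumes r: "r > 0" and s: "s \<ge> 0" and beta: "\<beta> < beta_star r s"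
  defines "c \<equiv> sqrt (r + s)"
  obtains \<tau> \<kappa> u v where "0 \<le> \<kappa>" "\<kappa> \<le> c - sqrt s" "0 < \<tau> + \<kappa> * c"
    "\<tau> \<le> \<bar>sqrt r * u + sqrt s * v\<bar> - c * \<bar>v\<bar>"
    "\<beta> < 1/2 + min 1 ((\<tau> + \<kappa> * c)\<^sup>2 / (r + \<kappa>\<^sup>2)) / 2 - ((u - sqrt r)\<^sup>2 + (v - sqrt s)\<^sup>2)"
    "(u - sqrt r)\<^sup>2 + (v - sqrt s)\<^sup>2 < min 1 ((\<tau> + \<kappa> * c)\<^sup>2 / (r + \<kappa>\<^sup>2))"
proof -
  define w where "w = sqrt s"
  define q where "q = sqrt r"
  define A where "A = c * (c - w)"
  have w: "w \<ge> 0" "w\<^sup>2 = s" using s by (auto simp: w_def)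
  have q: "q > 0" "q\<^sup>2 = r" "q * q = r" using r by (auto simp: q_def)
  have c: "c > 0" "c\<^sup>2 = r + s" using r s by (auto simp: c_def)
  have wc: "w < c" unfolding w_def c_def using r by simp
  have r_fac: "r = (c - w) * (c + w)" using c w by (simp add: power2_eq_square algebra_simps)
  have A_pos: "A > 0" using wc c by (simp add: A_def)
  have A_eq: "r + s - sqrt s * sqrt (r + s) = A"
    unfolding A_def w_def[symmetric] c_def[symmetric] using c(2) by (simp add: power2_eq_square algebra_simps)
  have two_A: "r + (c - w)\<^sup>2 = 2 * A" unfolding r_fac A_def by (simp add: power2_eq_square algebra_simps)
  have kc: "(c - w) * c = A" by (simp add: A_def)
  have s3: "3 * s \<le> r \<longleftrightarrow> 2 * w \<le> c"
  proof -
    have "3 * s \<le> r \<longleftrightarrow> (2 * w)\<^sup>2 \<le> c\<^sup>2" using c w by (simp add: power_mult_distrib)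
    also have "\<dots> \<longleftrightarrow> 2 * w \<le> c" using abs_le_square_iff[of "2 * w" c] c(1) w(1) by linarith
    finally show ?thesis .
  qed
  \<comment> \<open>Since \<open>3 * c > 2 * w\<close>, \<open>5 * r + s \<le> 8 * A\<close> holds
    exactly if \<open>2 * w \<le> c\<close>, that is, \<open>3 * s \<le> r\<close>. This reconciles
    the two kinds of borders between the branches, \<open>8 * A = 1\<close> and
    \<open>5 * r + s = 1\<close>.\<close>
  have quad: "5 * r + s - 8 * A = - ((c - 2 * w) * (3 * c - 2 * w))"
  proof -
    have "5 * r + s = 5 * c\<^sup>2 - 4 * w\<^sup>2" using c w by simp
    then show ?thesis unfolding A_def by (simp add: power2_eq_square algebra_simps)
  qed
  consider (1) "3 * s > r" "A \<le> 1/8" "beta_star r s = 1/2 + 2 * A"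
    | (2) "3 * s \<le> r" "5 * r + s \<le> 1" "beta_star r s = 1/2 * (1 + 3 * r - s)"
    | (3) "2 * (1 - r - s) * A > r" "beta_star r s = 2 * q * sqrt (1 - r - s)"
    | (4) "A \<le> 1/2" "2 * (1 - r - s) * A \<le> r" "beta_star r s = 2 * sqrt (2 * A) - 2 * A"
    | (5) "A > 1/2" "beta_star r s = 1"
  proof -
    have else_A: "A > 1/2" if "\<not> (3 * s > r \<and> A \<le> 1/8)" "\<not> (3 * s \<le> r \<and> 5 * r + s \<le> 1)"
      "\<not> (5 * r + s > 1 \<and> 1/8 < A \<and> A \<le> 1/2)"
    proof (rule ccontr)
      assume "\<not> A > 1/2"
      then have "5 * r + s \<le> 1 \<or> A \<le> 1/8" using that by linarith
      then show False
      proof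
        assume small: "5 * r + s \<le> 1"
        then have "2 * w > c" "A > 1/8" using that s3 by linarith+
        then have "(c - 2 * w) * (3 * c - 2 * w) < 0" using wc c by (intro mult_neg_pos) linarith+
        then show False using quad small \<open>A > 1/8\<close> by linarith
      next
        assume small: "A \<le> 1/8"
        then have "2 * w \<le> c" "5 * r + s > 1" using that s3 by linarith+
        then have "(c - 2 * w) * (3 * c - 2 * w) \<ge> 0" using wc c by (intro mult_nonneg_nonneg) linarith+
        then show False using quad small \<open>5 * r + s > 1\<close> by linarith
      qed
    qed
    note B = beta_star_def[of r s, unfolded Let_def A_eq]
    consider (1) "3 * s > r \<and> A \<le> 1/8" | (2) "\<not> (3 * s > r \<and> A \<le> 1/8)" "3 * s \<le> r \<and> 5 * r + s \<le> 1"
      | (3) "\<not> (3 * s > r \<and> A \<le> 1/8)" "\<not> (3 * s \<le> r \<and> 5 * r + s \<le> 1)" "5 * r + s > 1 \<and> 1/8 < A \<and> A \<le> 1/2"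
      | (4) "\<not> (3 * s > r \<and> A \<le> 1/8)" "\<not> (3 * s \<le> r \<and> 5 * r + s \<le> 1)" "\<not> (5 * r + s > 1 \<and> 1/8 < A \<and> A \<le> 1/2)"
      by argo
    then show thesis
    proof cases
      case 1
      then show thesis using that(1) unfolding B by simp
    next
      case 2
      then have "beta_star r s = 1/2 * (1 + 3 * r - s)" unfolding B by (simp only: if_True if_False simp_thms)
      then show thesis using that(2) 2 by blast
    next
      case 3
      show thesis
      proof (cases "2 * (1 - r - s) * A > r")
        case True
        then have "beta_star r s = 2 * q * sqrt (1 - r - s)"
          using 3 unfolding B q_def by (simp only: if_True if_False conj_assoc simp_thms)
        then show thesis using that(3) True by blast
      next
        case False
        then have le: "2 * (1 - r - s) * A \<le> r" by linarith
        then have "beta_star r s = 2 * sqrt (2 * A) - 2 * A"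
          using 3 False unfolding B by (simp only: if_True if_False conj_assoc simp_thms)
        then show thesis using that(4) le 3 by blast
      qed
    next
      case 4
      have "\<not> (5 * r + s > 1 \<and> 1/8 < A \<and> A \<le> 1/2 \<and> P)" for P using 4(3) by blast
      then have "beta_star r s = 1" using 4(1,2) unfolding B by (simp only: if_True if_False)
      then show thesis using that(5) else_A[OF 4] by blast
    qed
  qed
  \<comment> \<open>In every case \<open>(u, v)\<close> is the foot of the perpendicular from the
    null mean \<open>(0, c)\<close> to the line \<open>q * u - \<kappa> * v = \<tau>\<close>, that
    is, \<open>(0, c) + \<lambda> * (q, - \<kappa>)\<close> for some \<open>\<lambda>\<close>. For
    \<open>\<kappa> = c - w\<close> the alternative mean \<open>(q, w)\<close> has
    \<open>\<lambda> = 1\<close>, the null exponent is \<open>2 * A * \<lambda>\<^sup>2\<close> and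
    the cost \<open>2 * A * (\<lambda> - 1)\<^sup>2\<close>. The free optimum is
    \<open>\<lambda> = 2\<close>; if its null exponent exceeds 1, \<open>\<lambda>\<close> is
    lowered to \<open>1 / sqrt (2 * A)\<close>, though not below 1. If the foot would have
    \<open>v < 0\<close>, the kink of the region at \<open>v = 0\<close> takes over, and
    \<open>\<kappa>\<close> is chosen so that the foot lies on it.\<close>
  then show thesis
  proof cases
    case 1
    \<comment> \<open>\<open>\<lambda> = 2\<close>: null exponent \<open>8 * A\<close>, cost
      \<open>2 * A\<close>.\<close>
    have v: "2 * w - c \<ge> 0" using 1 s3 by linarith
    have "(3 * A + (c - w) * c)\<^sup>2 / (r + (c - w)\<^sup>2) = 8 * A"
      unfolding two_A kc using A_pos by (simp add: power2_eq_square)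
    moreover have "(2 * q - q)\<^sup>2 + (2 * w - c - w)\<^sup>2 = 2 * A"
      unfolding two_A[symmetric] q(2)[symmetric] by (simp add: power2_eq_square algebra_simps)
    moreover have "3 * A = \<bar>q * (2 * q) + w * (2 * w - c)\<bar> - c * \<bar>2 * w - c\<bar>"
    proof -
      have "q * (2 * q) + w * (2 * w - c) \<ge> 0" using q w v by (intro add_nonneg_nonneg mult_nonneg_nonneg) auto
      moreover have "q * (2 * q) = 2 * r" using q by (simp add: power2_eq_square)
      moreover have "2 * r + w * (2 * w - c) - c * (2 * w - c) = 3 * A"
        unfolding r_fac A_def by (simp add: algebra_simps)
      ultimately show ?thesis using v by simp
    qed
    ultimately show thesis
      using that[of "c - w" "3 * A" "2 * q" "2 * w - c"] wc A_pos kc 1 beta w_def q_def by auto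
  next
    case 2
    \<comment> \<open>Still \<open>\<lambda> = 2\<close>, with the slope lowered to
      \<open>c / 2\<close>, for which the foot is \<open>(2 * q, 0)\<close>.\<close>
    have w2: "c / 2 \<le> c - w" using 2 s3 by linarith
    have D: "4 * r + c\<^sup>2 > 0" using r zero_le_power2[of c] by linarith
    have "(2 * r + c / 2 * c)\<^sup>2 / (r + (c / 2)\<^sup>2) = ((4 * r + c\<^sup>2) / 2)\<^sup>2 / ((4 * r + c\<^sup>2) / 4)"
      by (intro arg_cong2[where f="(/)"]) (simp_all add: power2_eq_square field_simps)
    also have "\<dots> = 4 * r + c\<^sup>2" using D by (simp add: power2_eq_square)
    also have "\<dots> = 5 * r + s" using c by simp
    finally have exp0: "(2 * r + c / 2 * c)\<^sup>2 / (r + (c / 2)\<^sup>2) = 5 * r + s" .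
    have exp1: "(2 * q - q)\<^sup>2 + (0 - w)\<^sup>2 = r + s" using q w by simp
    have min_eq: "min 1 (5 * r + s) = 5 * r + s" using 2 by simp
    show thesis
    proof (rule that[of "c / 2" "2 * r" "2 * q" 0, folded w_def q_def, unfolded exp0 exp1 min_eq])
      show "2 * r \<le> \<bar>q * (2 * q) + w * 0\<bar> - c * \<bar>0\<bar>" using q r by simp
      show "0 < 2 * r + c / 2 * c" using r c(1) by (intro add_pos_pos mult_pos_pos) auto
      show "\<beta> < 1 / 2 + (5 * r + s) / 2 - (r + s)" using 2 beta by argo
    qed (use c w2 r in auto)
  next
    case 3
    \<comment> \<open>\<open>(k, 0)\<close> is the point of the kink at distance 1 from the null
      mean; the slope \<open>r * c / \<tau>\<close> is the one that makes it the foot, and the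
      branch condition bounds this slope.\<close>
    define k where "k = sqrt (1 - c\<^sup>2)"
    define \<tau> where "\<tau> = q * k"
    have "0 < 2 * (1 - r - s) * A" using 3 r by linarith
    then have c1: "1 - c\<^sup>2 > 0" using A_pos c by (simp add: zero_less_mult_iff)
    have k: "k > 0" "k\<^sup>2 = 1 - c\<^sup>2" using c1 by (auto simp: k_def)
    have t: "\<tau> > 0" "\<tau>\<^sup>2 = r * (1 - c\<^sup>2)" using k q by (auto simp: \<tau>_def power_mult_distrib)
    have kap: "r * c / \<tau> \<le> c - w"
    proof -
      have "(c - w) * (c + w) < (c - w) * (2 * (1 - c\<^sup>2) * c)"
      proof -
        have "(c - w) * (2 * (1 - c\<^sup>2) * c) = 2 * (1 - r - s) * A"
          unfolding A_def c(2) by (simp add: mult_ac diff_diff_add)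
        then show ?thesis using 3(1) r_fac by linarith
      qed
      then have "c + w < 2 * (1 - c\<^sup>2) * c" using wc by simp
      then have "c\<^sup>2 * (c + w) \<le> (c - w) * (1 - c\<^sup>2)" by (simp add: power2_eq_square algebra_simps)
      then have "(c + w) * (c\<^sup>2 * (c + w)) \<le> (c + w) * ((c - w) * (1 - c\<^sup>2))"
        using c w by (intro mult_left_mono) auto
      also have "\<dots> = \<tau>\<^sup>2" unfolding t(2) r_fac by simp
      finally have "((c + w) * c)\<^sup>2 \<le> \<tau>\<^sup>2" by (simp add: power2_eq_square mult_ac)
      then have "(c + w) * c \<le> \<tau>" by (rule power2_le_imp_le) (use t in simp)
      then have "(c - w) * ((c + w) * c) \<le> (c - w) * \<tau>" using wc by (intro mult_left_mono) auto
      moreover have "(c - w) * ((c + w) * c) = r * c" by (simp only: r_fac mult.assoc)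
      ultimately show ?thesis using t(1) by (simp only: pos_divide_le_eq)
    qed
    have "(\<tau> + r * c / \<tau> * c)\<^sup>2 / (r + (r * c / \<tau>)\<^sup>2) = 1"
    proof -
      have sum: "\<tau>\<^sup>2 + r * c\<^sup>2 = r" unfolding t(2) by (simp add: algebra_simps)
      have "\<tau> + r * c / \<tau> * c = (\<tau>\<^sup>2 + r * c\<^sup>2) / \<tau>" using t by (simp add: power2_eq_square field_simps)
      then have 1: "\<tau> + r * c / \<tau> * c = r / \<tau>" unfolding sum .
      have "r + (r * c / \<tau>)\<^sup>2 = r * (\<tau>\<^sup>2 + r * c\<^sup>2) / \<tau>\<^sup>2" using t(1) by (simp add: power2_eq_square field_simps)
      then have 2: "r + (r * c / \<tau>)\<^sup>2 = (r / \<tau>)\<^sup>2" unfolding sum by (simp add: power2_eq_square)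
      show ?thesis unfolding 1 2 using r t by simp
    qed
    moreover have "(k - q)\<^sup>2 + (0 - w)\<^sup>2 = 1 - 2 * q * k"
    proof -
      have "(k - q)\<^sup>2 + (0 - w)\<^sup>2 = k\<^sup>2 + q\<^sup>2 + w\<^sup>2 - 2 * q * k"
        by (simp add: power2_eq_square algebra_simps)
      then show ?thesis unfolding k(2) q(2) w(2) c(2) by simp
    qed
    moreover have "\<tau> = \<bar>q * k + w * 0\<bar> - c * \<bar>0\<bar>" using q k by (simp add: \<tau>_def)
    moreover have "0 < \<tau> + r * c / \<tau> * c" using r c t by (simp add: add_pos_pos)
    moreover have "beta_star r s = 2 * q * k" using 3 c by (simp add: k_def algebra_simps)
    ultimately show thesis
      using that[of "r * c / \<tau>" \<tau> k 0] kap r c t beta q k w_def q_def by auto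
  next
    case 4
    \<comment> \<open>\<open>1 / W = 1 + m\<close> is the value of \<open>\<lambda>\<close> with
      null exponent 1; the branch condition is what keeps \<open>v\<close> nonnegative.\<close>
    define W where "W = sqrt (2 * A)"
    have W: "W > 0" "W\<^sup>2 = 2 * A" "W \<le> 1" using A_pos 4 by (auto simp: W_def)
    define m where "m = (1 - W) / W"
    have mW: "m * W = 1 - W" using W by (simp add: m_def)
    have mA: "m * (2 * A) = W - W\<^sup>2"
    proof -
      have "m * (2 * A) = (m * W) * W" using W(2) by (simp add: power2_eq_square)
      then show ?thesis unfolding mW by (simp add: power2_eq_square algebra_simps)
    qed
    have v: "w - m * (c - w) \<ge> 0"
    proof -
      have "(c - w) * (2 * (1 - c\<^sup>2) * c) \<le> (c - w) * (c + w)"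
      proof -
        have "(c - w) * (2 * (1 - c\<^sup>2) * c) = 2 * (1 - r - s) * A"
          unfolding A_def c(2) by (simp add: mult_ac diff_diff_add)
        then show ?thesis using 4(2) r_fac by linarith
      qed
      then have "2 * (1 - c\<^sup>2) * c \<le> c + w" using wc by simp
      then have "c - w \<le> 2 * c^3" by (simp add: power2_eq_square power3_eq_cube algebra_simps)
      then have "2 * (c * (c - w)) \<le> 2 * (c * (2 * c^3))" using c by (intro mult_left_mono) auto
      then have "W\<^sup>2 \<le> (2 * c\<^sup>2)\<^sup>2" unfolding W(2) A_def by (simp add: power2_eq_square power3_eq_cube mult_ac)
      then have "W \<le> 2 * c\<^sup>2" by (rule power2_le_imp_le) simp
      then have "W * W \<le> W * (2 * c\<^sup>2)" using W by (intro mult_left_mono) auto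
      moreover have "W * W = 2 * (c * (c - w))" using W(2) unfolding A_def by (simp only: power2_eq_square)
      moreover have "W * (2 * c\<^sup>2) = 2 * (c * (c * W))" by (simp add: power2_eq_square)
      ultimately have "c * (c - w) \<le> c * (c * W)" by linarith
      then have "c - w \<le> c * W" using c by simp
      then have "W * (m * (c - w)) \<le> W * w"
        using mW by (simp add: mult.assoc[symmetric] mult.commute[of W m]) (simp add: algebra_simps)
      then show ?thesis using W by simp
    qed
    have "(W - A + (c - w) * c)\<^sup>2 / (r + (c - w)\<^sup>2) = 1"
      unfolding two_A kc using W A_pos by simp
    moreover have "(q * (1 + m) - q)\<^sup>2 + (w - m * (c - w) - w)\<^sup>2 = (1 - W)\<^sup>2"
    proof -
      have "(q * (1 + m) - q)\<^sup>2 + (w - m * (c - w) - w)\<^sup>2 = m\<^sup>2 * (q\<^sup>2 + (c - w)\<^sup>2)"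
        by (simp add: power2_eq_square algebra_simps)
      also have "\<dots> = (m * W)\<^sup>2" unfolding q(2) two_A W(2)[symmetric] by (simp add: power_mult_distrib)
      finally show ?thesis unfolding mW .
    qed
    moreover have "W - A \<le> \<bar>q * (q * (1 + m)) + w * (w - m * (c - w))\<bar> - c * \<bar>w - m * (c - w)\<bar>"
    proof -
      have 1: "q * (q * (1 + m)) = r * (1 + m)" by (simp only: q(3) mult.assoc[symmetric])
      have 2: "r * (1 + m) + w * (w - m * (c - w)) - c * (w - m * (c - w)) = r - (c - w) * w + m * (r + (c - w)\<^sup>2)"
        by (simp add: power2_eq_square algebra_simps)
      have 3: "r - (c - w) * w = A" unfolding r_fac A_def by (simp add: algebra_simps)
      have "q * (q * (1 + m)) + w * (w - m * (c - w)) - c * (w - m * (c - w)) = W - A"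
        unfolding 1 2 two_A mA unfolding 3 W(2) by simp
      then show ?thesis using v by simp
    qed
    moreover have "(1 - W)\<^sup>2 < 1" using W(1,3) by (simp add: abs_square_less_1 abs_if)
    moreover have "beta_star r s = 1 - (1 - W)\<^sup>2"
      unfolding 4(3) W_def[symmetric] by (simp add: power2_diff W(2))
    ultimately show thesis
      using that[of "c - w" "W - A" "q * (1 + m)" "w - m * (c - w)"] wc kc W beta w_def q_def by auto
  next
    case 5
    \<comment> \<open>\<open>\<lambda> = 1\<close>: the point is the alternative mean itself, at no
      cost, and the null exponent \<open>2 * A\<close> already exceeds 1.\<close>
    have "(A + (c - w) * c)\<^sup>2 / (r + (c - w)\<^sup>2) = 2 * A"
      unfolding two_A kc using A_pos by (simp add: power2_eq_square)
    moreover have "A \<le> \<bar>q * q + w * w\<bar> - c * \<bar>w\<bar>"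
    proof -
      have "q * q + w * w = c * c" using q w c by (simp add: power2_eq_square)
      then show ?thesis using c w by (simp add: A_def algebra_simps)
    qed
    ultimately show thesis
      using that[of "c - w" A q w] wc kc A_pos 5 beta w_def q_def by auto
  qed
qed

text \<open>The witness in the coordinates \<open>(x, y)\<close> of the observations, related to \<open>(u, v)\<close> by a rotation
  (and a reflection if \<open>a < b\<close>).\<close>

lemma beta_star_witness_C_minus:
  fixes r s \<beta> a b :: real
  assumes r: "r > 0" and s: "s \<ge> 0" and beta: "\<beta> < beta_star r s"
  defines "c \<equiv> sqrt (r + s)"
  assumes ab: "a > 0" "b > 0" and ab_r: "2 * a * b = c * sqrt r" and ab_s: "\<bar>a\<^sup>2 - b\<^sup>2\<bar> = c * sqrt s"
  obtains \<tau> \<kappa> x y where "0 \<le> \<kappa>" "\<kappa> \<le> c - sqrt s" "0 < \<tau> + \<kappa> * c" "\<tau> \<le> C_minus x y a b"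
    "\<beta> < 1/2 + min 1 ((\<tau> + \<kappa> * c)\<^sup>2 / (r + \<kappa>\<^sup>2)) / 2 - ((x - a)\<^sup>2 + (y + b)\<^sup>2)"
    "(x - a)\<^sup>2 + (y + b)\<^sup>2 < min 1 ((\<tau> + \<kappa> * c)\<^sup>2 / (r + \<kappa>\<^sup>2))"
proof -
  have c: "c > 0" "c\<^sup>2 = r + s" using r s by (auto simp: c_def)
  have c_sq: "a\<^sup>2 + b\<^sup>2 = c\<^sup>2"
  proof -
    have "(a\<^sup>2 + b\<^sup>2)\<^sup>2 = (2 * a * b)\<^sup>2 + \<bar>a\<^sup>2 - b\<^sup>2\<bar>\<^sup>2" by (simp add: power2_eq_square algebra_simps)
    also have "\<dots> = (c\<^sup>2)\<^sup>2" unfolding ab_r ab_s power_mult_distrib using r s c by (simp add: power2_eq_square distrib_left[symmetric])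
    finally show ?thesis by (rule power2_eq_imp_eq) auto
  qed
  obtain \<tau> \<kappa> u v where wit: "0 \<le> \<kappa>" "\<kappa> \<le> c - sqrt s" "0 < \<tau> + \<kappa> * c"
    "\<tau> \<le> \<bar>sqrt r * u + sqrt s * v\<bar> - c * \<bar>v\<bar>"
    "\<beta> < 1/2 + min 1 ((\<tau> + \<kappa> * c)\<^sup>2 / (r + \<kappa>\<^sup>2)) / 2 - ((u - sqrt r)\<^sup>2 + (v - sqrt s)\<^sup>2)"
    "(u - sqrt r)\<^sup>2 + (v - sqrt s)\<^sup>2 < min 1 ((\<tau> + \<kappa> * c)\<^sup>2 / (r + \<kappa>\<^sup>2))"
    by (rule beta_star_witness[OF r s beta, folded c_def])
  \<comment> \<open>The sign of \<open>a\<^sup>2 - b\<^sup>2\<close>, which \<open>sqrt s\<close>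
    forgets; for \<open>e = -1\<close> a reflection is composed with the rotation.\<close>
  define e :: real where "e = (if b \<le> a then 1 else -1)"
  have e: "e * e = 1" "e = 1 \<or> e = -1" by (auto simp: e_def)
  have q: "sqrt r = 2 * a * b / c" using ab_r c by (simp add: field_simps)
  have w: "sqrt s = e * (a\<^sup>2 - b\<^sup>2) / c"
  proof -
    have "\<bar>a\<^sup>2 - b\<^sup>2\<bar> = e * (a\<^sup>2 - b\<^sup>2)"
      using ab power_mono[of b a 2] power_mono[of a b 2] by (auto simp: e_def)
    then show ?thesis using ab_s c by (simp add: field_simps)
  qed
  \<comment> \<open>This isometry sends \<open>(sqrt r, sqrt s)\<close> to \<open>(a, - b)\<close>,
    the scaled mean of a mismatched pair, so the cost is preserved.\<close>
  define x where "x = (b * u + e * a * v) / c"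
  define y where "y = (e * b * v - a * u) / c"
  have 1: "a * x + b * y = e * c * v"
  proof -
    have "a * x + b * y = e * (a\<^sup>2 + b\<^sup>2) * v / c"
      unfolding x_def y_def by (simp add: power2_eq_square add_divide_distrib[symmetric]) (simp add: algebra_simps)
    then show ?thesis unfolding c_sq using c(1) by (simp add: power2_eq_square)
  qed
  have 2: "a * x - b * y = sqrt r * u + sqrt s * v"
    unfolding x_def y_def q w by (simp add: power2_eq_square add_divide_distrib[symmetric] diff_divide_distrib[symmetric]) (simp add: algebra_simps)
  have "C_minus x y a b = \<bar>sqrt r * u + sqrt s * v\<bar> - c * \<bar>v\<bar>"
    unfolding C_minus_def 1 2 using e c by (auto simp: abs_mult)
  moreover have "(x - a)\<^sup>2 + (y + b)\<^sup>2 = (u - sqrt r)\<^sup>2 + (v - sqrt s)\<^sup>2"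
  proof -
    have "x - a = (b * (u - sqrt r) + e * a * (v - sqrt s)) / c"
    proof -
      have "b * sqrt r + e * a * sqrt s = (2 * a * b * b + (e * e) * a * (a\<^sup>2 - b\<^sup>2)) / c"
        unfolding q w by (simp add: add_divide_distrib mult_ac)
      also have "\<dots> = a * (a\<^sup>2 + b\<^sup>2) / c" unfolding e by (simp add: power2_eq_square algebra_simps)
      also have "\<dots> = a * c" unfolding c_sq using c(1) by (simp add: power2_eq_square)
      finally show ?thesis using c unfolding x_def by (simp add: field_simps)
    qed
    moreover have "y + b = (e * b * (v - sqrt s) - a * (u - sqrt r)) / c"
    proof -
      have "e * b * sqrt s - a * sqrt r = ((e * e) * b * (a\<^sup>2 - b\<^sup>2) - 2 * a * a * b) / c"
        unfolding q w by (simp add: diff_divide_distrib mult_ac)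
      also have "\<dots> = - b * (a\<^sup>2 + b\<^sup>2) / c" unfolding e by (simp add: power2_eq_square algebra_simps)
      also have "\<dots> = - b * c" unfolding c_sq using c(1) by (simp add: power2_eq_square)
      finally show ?thesis using c unfolding y_def by (simp add: field_simps)
    qed
    moreover have "(b * U + e * a * V)\<^sup>2 + (e * b * V - a * U)\<^sup>2 = (a\<^sup>2 + b\<^sup>2) * (U\<^sup>2 + V\<^sup>2)" for U V
      using e(2) by (auto simp: power2_eq_square algebra_simps)
    ultimately show ?thesis unfolding c_sq
      using c(1) by (simp add: power_divide add_divide_distrib[symmetric])
  qed
  ultimately show thesis using that[of \<kappa> \<tau> x y] wit by simp
qed

lemma eventually_nhds_pair_real:
  assumes "eventually P (nhds (a :: real, b :: real))"
  shows "\<exists>\<rho>>0. \<forall>a' b'. \<bar>a' - a\<bar> \<le> \<rho> \<longrightarrow> \<bar>b' - b\<bar> \<le> \<rho> \<longrightarrow> P (a', b')"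
proof -
  obtain d where d: "d > 0" "\<And>z. dist z (a, b) < d \<Longrightarrow> P z"
    using assms unfolding eventually_nhds_metric by blast
  have "dist (a', b') (a, b) < d" if "\<bar>a' - a\<bar> \<le> d / 3" "\<bar>b' - b\<bar> \<le> d / 3" for a' b'
  proof -
    have "dist (a', b') (a, b) \<le> \<bar>a' - a\<bar> + \<bar>b' - b\<bar>"
      unfolding dist_Pair_Pair dist_real_def by (metis sqrt_sum_squares_le_sum_abs abs_idempotent)
    then show ?thesis using that d by linarith
  qed
  then show ?thesis using d by (intro exI[of _ "d / 3"]) auto
qed

text \<open>All conditions on the witness become strict after a small perturbation, hence hold uniformly
  when \<open>(a, b)\<close> is replaced by a nearby estimate.\<close>

lemma beta_star_witness_robust:
  fixes r s \<beta> a b :: real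
  assumes r: "r > 0" and s: "s \<ge> 0" and beta: "\<beta> < beta_star r s"
    and ab: "a > 0" "b > 0" and ab_r: "2 * a * b = sqrt (r + s) * sqrt r" and ab_s: "\<bar>a\<^sup>2 - b\<^sup>2\<bar> = sqrt (r + s) * sqrt s"
  defines "R \<equiv> \<lambda>a b. (2 * a * b)\<^sup>2 / (a\<^sup>2 + b\<^sup>2)" and "S \<equiv> \<lambda>a b. (a\<^sup>2 - b\<^sup>2)\<^sup>2 / (a\<^sup>2 + b\<^sup>2 :: real)"
  obtains \<tau> \<kappa> x y A0 E1 \<rho> where "0 \<le> \<kappa>" "A0 \<le> 1" "E1 < A0" "\<beta> < 1/2 + A0 / 2 - E1" "\<rho> > 0"
    "\<And>a' b'. \<bar>a' - a\<bar> \<le> \<rho> \<Longrightarrow> \<bar>b' - b\<bar> \<le> \<rho> \<Longrightarrow> a' > 0 \<and> b' > 0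
      \<and> \<kappa> \<le> sqrt (R a' b' + S a' b') - sqrt (S a' b') \<and> 0 \<le> \<tau> + \<kappa> * sqrt (R a' b' + S a' b')
      \<and> A0 \<le> (\<tau> + \<kappa> * sqrt (R a' b' + S a' b'))\<^sup>2 / (R a' b' + \<kappa>\<^sup>2)
      \<and> (\<bar>x - a'\<bar> + \<rho>)\<^sup>2 + (\<bar>y + b'\<bar> + \<rho>)\<^sup>2 \<le> E1"
    "\<And>a' b' x' y'. \<bar>a' - a\<bar> \<le> \<rho> \<Longrightarrow> \<bar>b' - b\<bar> \<le> \<rho> \<Longrightarrow> \<bar>x' - x\<bar> \<le> \<rho> \<Longrightarrow> \<bar>y' - y\<bar> \<le> \<rho> \<Longrightarrow> \<tau> < C_minus x' y' a' b'"
proof -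
  define c where "c = sqrt (r + s)"
  have c: "c > 0" "c\<^sup>2 = r + s" using r s by (auto simp: c_def)
  have c_sq: "a\<^sup>2 + b\<^sup>2 = c\<^sup>2"
  proof -
    have "(a\<^sup>2 + b\<^sup>2)\<^sup>2 = (2 * a * b)\<^sup>2 + \<bar>a\<^sup>2 - b\<^sup>2\<bar>\<^sup>2" by (simp add: power2_eq_square algebra_simps)
    also have "\<dots> = (c\<^sup>2)\<^sup>2" unfolding ab_r ab_s power_mult_distrib using r s c by (simp add: power2_eq_square distrib_left[symmetric])
    finally show ?thesis by (rule power2_eq_imp_eq) auto
  qed
  have R_ab: "R a b = r" unfolding R_def c_sq ab_r c_def[symmetric] using c(1) r by (simp add: power_mult_distrib)
  have S_ab: "S a b = s"
  proof -
    have "(a\<^sup>2 - b\<^sup>2)\<^sup>2 = c\<^sup>2 * s" using ab_s s unfolding c_def[symmetric] by (metis power2_abs power_mult_distrib real_sqrt_pow2)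
    then show ?thesis unfolding S_def c_sq using c(1) by simp
  qed
  obtain \<tau>0 \<kappa>0 x y where wit: "0 \<le> \<kappa>0" "\<kappa>0 \<le> c - sqrt s" "0 < \<tau>0 + \<kappa>0 * c" "\<tau>0 \<le> C_minus x y a b"
    "\<beta> < 1/2 + min 1 ((\<tau>0 + \<kappa>0 * c)\<^sup>2 / (r + \<kappa>0\<^sup>2)) / 2 - ((x - a)\<^sup>2 + (y + b)\<^sup>2)"
    "(x - a)\<^sup>2 + (y + b)\<^sup>2 < min 1 ((\<tau>0 + \<kappa>0 * c)\<^sup>2 / (r + \<kappa>0\<^sup>2))"
    by (rule beta_star_witness_C_minus[OF r s beta ab ab_r ab_s, folded c_def])
  define E0 where "E0 = (x - a)\<^sup>2 + (y + b)\<^sup>2"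
  \<comment> \<open>Lowering \<open>\<tau>0\<close> by \<open>z\<close> makes the threshold
    condition strict, and shrinking \<open>\<kappa>0\<close> by the factor \<open>1 - z\<close> does
    so for the slope; for small \<open>z\<close> the strict inequalities on the exponents
    persist.\<close>
  define f where "f = (\<lambda>z. ((\<tau>0 - z) + (1 - z) * \<kappa>0 * c)\<^sup>2 / (r + ((1 - z) * \<kappa>0)\<^sup>2))"
  have r0: "r + k\<^sup>2 \<noteq> 0" for k using r zero_le_power2[of k] by linarith
  have lim_f: "(f \<longlongrightarrow> f 0) (at_right 0)" unfolding f_def using r0 by (intro tendsto_intros) auto
  have f0: "f 0 = (\<tau>0 + \<kappa>0 * c)\<^sup>2 / (r + \<kappa>0\<^sup>2)" by (simp add: f_def)
  have "\<forall>\<^sub>F z in at_right 0. \<beta> < 1/2 + min 1 (f z) / 2 - E0"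
  proof -
    have "((\<lambda>z. 1/2 + min 1 (f z) / 2 - E0) \<longlongrightarrow> 1/2 + min 1 (f 0) / 2 - E0) (at_right 0)"
      by (intro tendsto_intros lim_f) auto
    then show ?thesis using wit(5) by (intro order_tendstoD(1)) (auto simp: f0 E0_def)
  qed
  moreover have "\<forall>\<^sub>F z in at_right 0. E0 < min 1 (f z)"
    using wit(6) by (intro order_tendstoD(1)[OF tendsto_min[OF tendsto_const lim_f]]) (auto simp: f0 E0_def)
  moreover have "\<forall>\<^sub>F z in at_right 0. 0 < (\<tau>0 - z) + (1 - z) * \<kappa>0 * c"
  proof -
    have "((\<lambda>z. (\<tau>0 - z) + (1 - z) * \<kappa>0 * c) \<longlongrightarrow> (\<tau>0 - 0) + (1 - 0) * \<kappa>0 * c) (at_right 0)" by (intro tendsto_intros)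
    then show ?thesis using wit(3) by (intro order_tendstoD(1)) auto
  qed
  moreover have "\<forall>\<^sub>F z in at_right (0::real). z < 1 \<and> 0 < z"
    unfolding eventually_at_right_field by (intro exI[of _ 1]) auto
  ultimately have "\<forall>\<^sub>F z in at_right 0. \<beta> < 1/2 + min 1 (f z) / 2 - E0 \<and> E0 < min 1 (f z)
      \<and> 0 < (\<tau>0 - z) + (1 - z) * \<kappa>0 * c \<and> z < 1 \<and> 0 < z"
    by eventually_elim auto
  then obtain z where z: "\<beta> < 1/2 + min 1 (f z) / 2 - E0" "E0 < min 1 (f z)" "0 < (\<tau>0 - z) + (1 - z) * \<kappa>0 * c" "z < 1" "0 < z"
    using eventually_happens[of _ "at_right (0::real)"] by (auto simp: trivial_limit_at_right_real)
  define \<kappa> where "\<kappa> = (1 - z) * \<kappa>0"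
  define \<tau> where "\<tau> = \<tau>0 - z"
  have f_z: "f z = (\<tau> + \<kappa> * c)\<^sup>2 / (r + \<kappa>\<^sup>2)" by (simp add: f_def \<kappa>_def \<tau>_def)
  have \<kappa>0: "0 \<le> \<kappa>" using wit z by (simp add: \<kappa>_def)
  have \<kappa>1: "\<kappa> < c - sqrt s"
  proof (cases "\<kappa>0 = 0")
    case True
    then show ?thesis using r by (simp add: \<kappa>_def c_def)
  next
    case False
    then have "z * \<kappa>0 > 0" using z wit by simp
    then have "\<kappa> < \<kappa>0" by (simp add: \<kappa>_def left_diff_distrib)
    then show ?thesis using wit by linarith
  qed
  define mf where "mf = min 1 (f z)"
  have mf: "mf \<le> 1" "mf \<le> f z" "\<beta> < 1/2 + mf / 2 - E0" "E0 < mf" using z by (auto simp: mf_def)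
  \<comment> \<open>\<open>\<xi>\<close> is at most a third of both slacks, so lowering the null
    exponent to \<open>A0\<close> and raising the cost to \<open>E1\<close>, each by
    \<open>\<xi>\<close>, preserves both inequalities.\<close>
  define \<xi> where "\<xi> = min ((1/2 + mf / 2 - E0 - \<beta>) / 3) ((mf - E0) / 3)"
  have \<xi>: "\<xi> > 0" "3 * \<xi> \<le> 1/2 + mf / 2 - E0 - \<beta>" "3 * \<xi> \<le> mf - E0"
  proof -
    show "\<xi> > 0" unfolding \<xi>_def using mf by (intro min_less_iff_conj[THEN iffD2] conjI divide_pos_pos) linarith+
    have "\<xi> \<le> (1/2 + mf / 2 - E0 - \<beta>) / 3" unfolding \<xi>_def by (rule min.cobounded1)
    then show "3 * \<xi> \<le> 1/2 + mf / 2 - E0 - \<beta>" by (subst (asm) le_divide_eq) (simp add: mult.commute)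
    have "\<xi> \<le> (mf - E0) / 3" unfolding \<xi>_def by (rule min.cobounded2)
    then show "3 * \<xi> \<le> mf - E0" by (subst (asm) le_divide_eq) (simp add: mult.commute)
  qed
  define A0 where "A0 = mf - \<xi>"
  define E1 where "E1 = E0 + \<xi>"
  have A0: "A0 \<le> 1" "A0 < f z" "E1 < A0" "\<beta> < 1/2 + A0 / 2 - E1"
  proof -
    show "A0 \<le> 1" using \<xi> mf unfolding A0_def by linarith
    show "A0 < f z" using \<xi> mf unfolding A0_def by linarith
    show "E1 < A0" using \<xi> mf unfolding A0_def E1_def by linarith
    show "\<beta> < 1/2 + A0 / 2 - E1" using \<xi> mf unfolding A0_def E1_def by argo
  qed
  let ?R = "\<lambda>z. R (fst z) (snd z)" and ?S = "\<lambda>z. S (fst z) (snd z)"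
  have ne: "a\<^sup>2 + b\<^sup>2 \<noteq> 0" unfolding c_sq using c(1) by simp
  have lim_fst: "(fst \<longlongrightarrow> a) (nhds (a, b))" and lim_snd: "(snd \<longlongrightarrow> b) (nhds (a, b))"
  proof -
    have id: "((\<lambda>z. z) \<longlongrightarrow> (a, b)) (nhds (a, b))" by (rule filterlim_ident)
    show "(fst \<longlongrightarrow> a) (nhds (a, b))" using tendsto_fst[OF id] by simp
    show "(snd \<longlongrightarrow> b) (nhds (a, b))" using tendsto_snd[OF id] by simp
  qed
  have lim_R: "(?R \<longlongrightarrow> r) (nhds (a, b))"
    unfolding R_ab[symmetric] unfolding R_def using ne by (intro tendsto_intros lim_fst lim_snd)
  have lim_S: "(?S \<longlongrightarrow> s) (nhds (a, b))"
    unfolding S_ab[symmetric] unfolding S_def using ne by (intro tendsto_intros lim_fst lim_snd)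
  have lim_c: "((\<lambda>z. sqrt (?R z + ?S z)) \<longlongrightarrow> c) (nhds (a, b))"
    unfolding c_def by (intro tendsto_intros lim_R lim_S)
  have "\<forall>\<^sub>F z in nhds (a, b). 0 < fst z" by (rule order_tendstoD(1)[OF lim_fst ab(1)])
  moreover have "\<forall>\<^sub>F z in nhds (a, b). 0 < snd z" by (rule order_tendstoD(1)[OF lim_snd ab(2)])
  moreover have "\<forall>\<^sub>F z in nhds (a, b). \<kappa> < sqrt (?R z + ?S z) - sqrt (?S z)"
    by (rule order_tendstoD(1)[OF tendsto_diff[OF lim_c tendsto_real_sqrt[OF lim_S]] \<kappa>1])
  moreover have "\<forall>\<^sub>F z in nhds (a, b). 0 < \<tau> + \<kappa> * sqrt (?R z + ?S z)"
    using z(3) by (intro order_tendstoD(1)[OF tendsto_add[OF tendsto_const tendsto_mult[OF tendsto_const lim_c]]]) (simp add: \<tau>_def \<kappa>_def)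
  moreover have "\<forall>\<^sub>F z in nhds (a, b). A0 < (\<tau> + \<kappa> * sqrt (?R z + ?S z))\<^sup>2 / (?R z + \<kappa>\<^sup>2)"
  proof -
    have "((\<lambda>z. (\<tau> + \<kappa> * sqrt (?R z + ?S z))\<^sup>2 / (?R z + \<kappa>\<^sup>2)) \<longlongrightarrow> (\<tau> + \<kappa> * c)\<^sup>2 / (r + \<kappa>\<^sup>2)) (nhds (a, b))"
      using r0 by (intro tendsto_intros lim_c lim_R)
    then show ?thesis using A0(2) unfolding f_z by (rule order_tendstoD(1))
  qed
  ultimately have "\<forall>\<^sub>F z in nhds (a, b). 0 < fst z \<and> 0 < snd z \<and> \<kappa> < sqrt (?R z + ?S z) - sqrt (?S z)
      \<and> 0 < \<tau> + \<kappa> * sqrt (?R z + ?S z) \<and> A0 < (\<tau> + \<kappa> * sqrt (?R z + ?S z))\<^sup>2 / (?R z + \<kappa>\<^sup>2)"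
    by eventually_elim auto
  from eventually_nhds_pair_real[OF this]
  obtain \<rho>1 where \<rho>1: "\<rho>1 > 0" "\<And>a' b'. \<bar>a' - a\<bar> \<le> \<rho>1 \<Longrightarrow> \<bar>b' - b\<bar> \<le> \<rho>1 \<Longrightarrow> 0 < a' \<and> 0 < b' \<and> \<kappa> < sqrt (R a' b' + S a' b') - sqrt (S a' b')
      \<and> 0 < \<tau> + \<kappa> * sqrt (R a' b' + S a' b') \<and> A0 < (\<tau> + \<kappa> * sqrt (R a' b' + S a' b'))\<^sup>2 / (R a' b' + \<kappa>\<^sup>2)"
    by auto
  have "((\<lambda>\<rho>. (\<bar>x - a\<bar> + 2 * \<rho>)\<^sup>2 + (\<bar>y + b\<bar> + 2 * \<rho>)\<^sup>2) \<longlongrightarrow> (\<bar>x - a\<bar> + 2 * 0)\<^sup>2 + (\<bar>y + b\<bar> + 2 * 0)\<^sup>2) (at_right 0)"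
    by (intro tendsto_intros)
  moreover have "(\<bar>x - a\<bar> + 2 * 0)\<^sup>2 + (\<bar>y + b\<bar> + 2 * 0)\<^sup>2 < E1" using \<xi> by (simp add: E1_def E0_def)
  ultimately have "\<forall>\<^sub>F \<rho> in at_right 0. (\<bar>x - a\<bar> + 2 * \<rho>)\<^sup>2 + (\<bar>y + b\<bar> + 2 * \<rho>)\<^sup>2 < E1"
    by (rule order_tendstoD(2))
  then obtain \<rho>2 where \<rho>2: "\<rho>2 > 0" "\<And>\<rho>. 0 < \<rho> \<Longrightarrow> \<rho> < \<rho>2 \<Longrightarrow> (\<bar>x - a\<bar> + 2 * \<rho>)\<^sup>2 + (\<bar>y + b\<bar> + 2 * \<rho>)\<^sup>2 < E1"
    unfolding eventually_at_right_field by auto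
  \<comment> \<open>\<open>M * \<rho>\<close> bounds the change of \<open>C_minus\<close> when all
    four arguments move by at most \<open>\<rho> \<le> 1\<close>; with
    \<open>\<rho> \<le> z / (2 * M)\<close> only half of the margin \<open>z\<close> is
    spent.\<close>
  define M where "M = 2 * (\<bar>x\<bar> + \<bar>y\<bar> + a + b + 2)"
  have M: "M > 0" using ab by (simp add: M_def add_nonneg_pos)
  define \<rho> where "\<rho> = min (min \<rho>1 (\<rho>2 / 2)) (min 1 (z / (2 * M)))"
  have \<rho>: "\<rho> > 0" "\<rho> \<le> \<rho>1" "\<rho> < \<rho>2" "\<rho> \<le> 1" "\<rho> \<le> z / (2 * M)"
    using \<rho>1 \<rho>2 z M by (auto simp: \<rho>_def)
  have "\<tau> < C_minus x' y' a' b'"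
    if "\<bar>a' - a\<bar> \<le> \<rho>" "\<bar>b' - b\<bar> \<le> \<rho>" "\<bar>x' - x\<bar> \<le> \<rho>" "\<bar>y' - y\<bar> \<le> \<rho>" for a' b' x' y'
  proof -
    have prod: "\<bar>u' * v' - u * v\<bar> \<le> (\<bar>u\<bar> + \<bar>v\<bar> + 1) * \<rho>" if "\<bar>u' - u\<bar> \<le> \<rho>" "\<bar>v' - v\<bar> \<le> \<rho>" for u v u' v'
    proof -
      have "u' * v' - u * v = (u' - u) * v + u * (v' - v) + (u' - u) * (v' - v)" by (simp add: algebra_simps)
      then have "\<bar>u' * v' - u * v\<bar> \<le> \<bar>(u' - u) * v\<bar> + \<bar>u * (v' - v)\<bar> + \<bar>(u' - u) * (v' - v)\<bar>" by linarith
      then have "\<bar>u' * v' - u * v\<bar> \<le> \<bar>u' - u\<bar> * \<bar>v\<bar> + \<bar>u\<bar> * \<bar>v' - v\<bar> + \<bar>u' - u\<bar> * \<bar>v' - v\<bar>"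
        by (simp only: abs_mult)
      also have "\<dots> \<le> \<rho> * \<bar>v\<bar> + \<bar>u\<bar> * \<rho> + \<rho> * 1"
        using that \<rho> by (intro add_mono mult_mono) auto
      finally show ?thesis by (simp add: algebra_simps)
    qed
    have gen: "\<bar>\<bar>P - Q\<bar> - \<bar>P + Q\<bar> - (\<bar>p - q\<bar> - \<bar>p + q\<bar>)\<bar> \<le> 2 * (d + e)"
      if "\<bar>P - p\<bar> \<le> d" "\<bar>Q - q\<bar> \<le> e" for P Q p q d e :: real
    proof -
      have "\<bar>\<bar>P - Q\<bar> - \<bar>p - q\<bar>\<bar> \<le> d + e" using that by linarith
      moreover have "\<bar>\<bar>P + Q\<bar> - \<bar>p + q\<bar>\<bar> \<le> d + e" using that by linarith
      moreover have "\<bar>A - B - (C - D)\<bar> \<le> 2 * m" if "\<bar>A - C\<bar> \<le> m" "\<bar>B - D\<bar> \<le> m" for A B C D m :: real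
        using that by linarith
      ultimately show ?thesis by blast
    qed
    have "\<bar>a' * x' - a * x\<bar> \<le> (\<bar>a\<bar> + \<bar>x\<bar> + 1) * \<rho>" "\<bar>b' * y' - b * y\<bar> \<le> (\<bar>b\<bar> + \<bar>y\<bar> + 1) * \<rho>"
      using prod that by auto
    then have "\<bar>C_minus x' y' a' b' - C_minus x y a b\<bar> \<le> 2 * ((\<bar>a\<bar> + \<bar>x\<bar> + 1) * \<rho> + (\<bar>b\<bar> + \<bar>y\<bar> + 1) * \<rho>)"
      unfolding C_minus_def by (rule gen)
    also have "\<dots> = M * \<rho>" using ab by (simp add: M_def algebra_simps)
    also have "\<dots> \<le> z / 2" using \<rho>(5) M by (simp add: field_simps)
    finally show ?thesis using wit(4) z unfolding \<tau>_def by linarith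
  qed
  moreover have cost: "(\<bar>x - a'\<bar> + \<rho>)\<^sup>2 + (\<bar>y + b'\<bar> + \<rho>)\<^sup>2 \<le> E1" if "\<bar>a' - a\<bar> \<le> \<rho>" "\<bar>b' - b\<bar> \<le> \<rho>" for a' b'
  proof -
    have h1: "\<bar>x - a'\<bar> + \<rho> \<le> \<bar>x - a\<bar> + 2 * \<rho>" using that by linarith
    have h2: "\<bar>y + b'\<bar> + \<rho> \<le> \<bar>y + b\<bar> + 2 * \<rho>" using that by linarith
    have "(\<bar>x - a'\<bar> + \<rho>)\<^sup>2 + (\<bar>y + b'\<bar> + \<rho>)\<^sup>2 \<le> (\<bar>x - a\<bar> + 2 * \<rho>)\<^sup>2 + (\<bar>y + b\<bar> + 2 * \<rho>)\<^sup>2"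
      by (intro add_mono power_mono h1 h2) (use \<rho>(1) in auto)
    then show ?thesis using \<rho>2(2)[OF \<rho>(1,3)] by linarith
  qed
  moreover have "a' > 0 \<and> b' > 0
      \<and> \<kappa> \<le> sqrt (R a' b' + S a' b') - sqrt (S a' b') \<and> 0 \<le> \<tau> + \<kappa> * sqrt (R a' b' + S a' b')
      \<and> A0 \<le> (\<tau> + \<kappa> * sqrt (R a' b' + S a' b'))\<^sup>2 / (R a' b' + \<kappa>\<^sup>2)
      \<and> (\<bar>x - a'\<bar> + \<rho>)\<^sup>2 + (\<bar>y + b'\<bar> + \<rho>)\<^sup>2 \<le> E1" if "\<bar>a' - a\<bar> \<le> \<rho>" "\<bar>b' - b\<bar> \<le> \<rho>" for a' b'
    using \<rho>1(2)[of a' b'] cost[OF that] that \<rho>(2) by (auto intro: less_imp_le)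
  ultimately show thesis
    using \<kappa>0 A0(1,3,4) \<rho>(1) by (intro that[of \<kappa> A0 E1 \<rho> \<tau> x y])
qed

subsection \<open>The count process\<close>

lemma PiM_measure_component:
  assumes M: "\<And>i. prob_space (M i)" and J: "finite J" "i \<in> J" and A: "A \<in> sets (M i)"
  shows "{w \<in> space (PiM J M). w i \<in> A} \<in> sets (PiM J M)"
    and "measure (PiM J M) {w \<in> space (PiM J M). w i \<in> A} = measure (M i) A"
proof -
  interpret Mk: prob_space "M k" for k by (rule M)
  interpret product_prob_space M J ..
  have m: "(\<lambda>w. w i) \<in> PiM J M \<rightarrow>\<^sub>M M i" using J by (intro measurable_component_singleton)
  show sets: "{w \<in> space (PiM J M). w i \<in> A} \<in> sets (PiM J M)"
    using measurable_sets[OF m A] by (simp add: vimage_def Int_def conj_commute)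
  have "measure (PiM J M) {w \<in> space (PiM J M). w i \<in> A} = measure (distr (PiM J M) (M i) (\<lambda>w. w i)) A"
    using m A by (subst measure_distr) (auto simp: vimage_def Int_def conj_commute intro!: arg_cong[where f="measure _"])
  then show "measure (PiM J M) {w \<in> space (PiM J M). w i \<in> A} = measure (M i) A"
    using PiM_component[OF J(2)] by simp
qed

lemma grid_interval:
  fixes g :: "nat \<Rightarrow> real"
  assumes "g 0 \<le> t" "t \<le> g (Suc N)"
  shows "\<exists>k\<le>N. g k \<le> t \<and> t \<le> g (Suc k)"
  using assms
proof (induction N)
  case (Suc N)
  then show ?case by (cases "t \<le> g (Suc N)") (auto intro: le_SucI)
qed auto

text \<open>\<open>S\<close> is the tail used for centring and \<open>p\<close> the true one;
  \<open>bias\<close> limits their distance. Where \<open>m * S t\<close> is below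
  \<open>1 / h^4\<close> the count is zero with high probability. Elsewhere
  \<open>sqrt (m * S t)\<close> is at least \<open>1 / h\<^sup>2\<close>, so every error term is a
  multiple of it up to powers of \<open>h\<close> and \<open>L\<close>, which \<open>large2\<close>
  keeps below \<open>L^3\<close>.\<close>

lemma null_count_process:
  fixes Z :: "'i \<Rightarrow> 'a \<Rightarrow> real" and S p :: "real \<Rightarrow> real" and K h \<Lambda> :: real and n :: nat
  assumes M: "\<And>i. prob_space (M i)" and J: "finite J" "D \<subseteq> J"
    and Z: "\<And>i. i \<in> D \<Longrightarrow> Z i \<in> borel_measurable (M i)"
    and p: "\<And>i t. i \<in> D \<Longrightarrow> measure (M i) {x \<in> space (M i). Z i x > t * K} = p t"
  defines "m \<equiv> real (card D)" and "L \<equiv> ln (real n)"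
    and "N \<equiv> (\<lambda>w t. \<Sum>i\<in>D. of_bool (Z i (w i) > t * K)) :: ('i \<Rightarrow> 'a) \<Rightarrow> real \<Rightarrow> real"
  assumes D: "D \<noteq> {}" "card D \<le> n" and n: "n \<ge> 2" and K: "K > 0" and h: "h \<ge> 1" and L: "L \<ge> 1"
    and S_pos: "\<And>t. S t > 0" and S_mono: "\<And>t t'. t \<le> t' \<Longrightarrow> S t' \<le> S t"
    and S_Lip: "\<And>t t'. t \<le> t' \<Longrightarrow> S t - S t' \<le> \<Lambda> * (t' - t)"
    and bias: "\<And>t. m * \<bar>p t - S t\<bar> \<le> 2 * h * sqrt (m * S t)"
    and \<Lambda>: "\<Lambda> \<ge> 0" and large1: "2 * L * \<Lambda> * h^4 \<le> real n" and large2: "25 * h^3 \<le> L\<^sup>2"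
  shows "\<exists>B\<in>sets (PiM J M). measure (PiM J M) B \<le> 4 / (real n)\<^sup>2 + 6 / h \<and>
    (\<forall>w\<in>space (PiM J M) - B. \<forall>t. \<bar>t\<bar> \<le> L \<longrightarrow> \<bar>N w t - m * S t\<bar> \<le> L^3 * sqrt (m * S t))"
proof -
  interpret Mk: prob_space "M k" for k by (rule M)
  interpret product_prob_space M J ..
  have fin: "finite D" using J finite_subset by auto
  have m: "m > 0" "m \<le> real n" using D fin by (auto simp: m_def card_gt_0_iff)
  have p0: "p t \<ge> 0" for t using p D(1) by (metis ex_in_conv measure_nonneg)
  have mS: "m * S t > 0" for t using m S_pos by simp
  have mp_le: "m * p t \<le> m * S t + 2 * h * sqrt (m * S t)" for t
  proof -
    have "m * p t - m * S t \<le> m * \<bar>p t - S t\<bar>" using m by (simp add: right_diff_distrib[symmetric])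
    then show ?thesis using bias[of t] by linarith
  qed
  have ev: "{x \<in> space (M i). Z i x > t * K} \<in> sets (M i)" if "i \<in> D" for i t
    using Z[OF that] by measurable
  define b where "b = (\<lambda>t i x. Z i x > t * K)"
  define Np where "Np = n ^ 2 - 1"
  have Np: "Suc Np = n\<^sup>2" using n by (simp add: Np_def)
  \<comment> \<open>With \<open>n\<^sup>2\<close> equal cells, \<open>m * S\<close> changes by at
    most \<open>1 / h^4\<close> within a cell by the Lipschitz bound, while the Chernoff failures
    \<open>2 / n^4\<close> still add up to at most \<open>4 / n\<^sup>2\<close>.\<close>
  define \<Delta> where "\<Delta> = 2 * L / (real n)\<^sup>2"
  define g where "g = (\<lambda>k. - L + real k * \<Delta>)"
  have g0: "g 0 = - L" by (simp add: g_def)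
  have gN: "g (Suc Np) = L"
  proof -
    have "real (n\<^sup>2) * (2 * L / (real n)\<^sup>2) = 2 * L" using n by simp
    then show ?thesis unfolding g_def Np \<Delta>_def by simp
  qed
  have step: "m * \<Lambda> * \<Delta> \<le> 1 / h^4"
  proof -
    have "m * \<Lambda> * \<Delta> \<le> real n * \<Lambda> * \<Delta>"
      using m \<Lambda> L by (intro mult_right_mono) (auto simp: \<Delta>_def)
    also have "\<dots> = 2 * L * \<Lambda> / real n" using n by (simp add: \<Delta>_def power2_eq_square)
    also have "\<dots> \<le> 1 / h^4" using large1 n h by (simp add: field_simps)
    finally show ?thesis .
  qed
  have h4: "1 / h^4 \<le> 1" "0 < 1 / h^4" using h by (simp_all add: one_le_power)
  have next_S: "m * S (g k) \<le> m * S (g (Suc k)) + 1 / h^4" for k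
  proof -
    have "\<Delta> \<ge> 0" using L by (simp add: \<Delta>_def)
    then have "g (Suc k) - g k = \<Delta>" "g k \<le> g (Suc k)" by (auto simp: g_def algebra_simps)
    then have "S (g k) - S (g (Suc k)) \<le> \<Lambda> * \<Delta>" using S_Lip[of "g k" "g (Suc k)"] by simp
    then have "m * (S (g k) - S (g (Suc k))) \<le> m * (\<Lambda> * \<Delta>)" using m by (intro mult_left_mono) auto
    then show ?thesis using step by (simp add: right_diff_distrib mult.assoc)
  qed
  define B1 where "B1 = (\<lambda>k. {w \<in> space (PiM J M).
      \<bar>(\<Sum>i\<in>D. of_bool (b (g k) i (w i))) - card D * p (g k)\<bar> \<ge> 5 * (sqrt (L * (card D * p (g k))) + L)})"
  have bD: "{x \<in> space (M i). b t i x} \<in> sets (M i)" "measure (M i) {x \<in> space (M i). b t i x} = p t" if "i \<in> D" for i t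
    using ev[OF that] p[OF that] unfolding b_def by auto
  have N_meas: "(\<lambda>w. \<Sum>i\<in>D. of_bool (b t i (w i)) :: real) \<in> borel_measurable (PiM J M)" for t
  proof (intro borel_measurable_sum)
    fix i assume i: "i \<in> D"
    have "Measurable.pred (M i) (b t i)" using bD[OF i] by (simp add: pred_def)
    then have "(\<lambda>x. of_bool (b t i x) :: real) \<in> borel_measurable (M i)" by measurable
    then show "(\<lambda>w. of_bool (b t i (w i)) :: real) \<in> borel_measurable (PiM J M)"
      using J i by (intro measurable_compose[OF measurable_component_singleton]) auto
  qed
  have B1_sets: "B1 k \<in> sets (PiM J M)" for k
    unfolding B1_def using N_meas[of "g k"] by measurable
  have B1_meas: "measure (PiM J M) (B1 k) \<le> 2 / (real n)^4" for k
  proof -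
    have "measure (PiM J M) (B1 k) \<le> 2 * exp (- 4 * L)"
      unfolding B1_def using bD L p0 by (intro PiM_count_Chernoff M J) auto
    also have "exp (- 4 * L) = 1 / (real n)^4"
    proof -
      have "exp (- 4 * L) = inverse (exp (real 4 * L))" by (simp add: exp_minus)
      also have "exp (real 4 * L) = real n ^ 4" using n by (simp only: exp_of_nat_mult L_def exp_ln_iff[THEN iffD2])
      finally show ?thesis by (simp add: divide_inverse)
    qed
    finally show ?thesis by simp
  qed
  \<comment> \<open>Grid points where hardly any exceedance is expected. Counts decrease in
    \<open>t\<close>, so it is enough that none occurs at the leftmost one, \<open>ks\<close>. The 2
    allows for the variation of \<open>m * S\<close> within a cell.\<close>
  define G where "G = {k. k \<le> Suc Np \<and> m * S (g k) \<le> 2 / h^4}"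
  define ks where "ks = Min G"
  have finG: "finite G" by (simp add: G_def)
  define B2 where "B2 = (if G = {} then {} else (\<Union>i\<in>D. {w \<in> space (PiM J M). w i \<in> {x \<in> space (M i). b (g ks) i x}}))"
  have B2_sets: "B2 \<in> sets (PiM J M)"
    unfolding B2_def using fin J bD by (auto intro!: sets.finite_UN PiM_measure_component M)
  have B2_meas: "measure (PiM J M) B2 \<le> 6 / h"
  proof (cases "G = {}")
    case False
    then have ks: "ks \<in> G" using finG by (simp add: ks_def)
    have "measure (PiM J M) B2 \<le> (\<Sum>i\<in>D. measure (PiM J M) {w \<in> space (PiM J M). w i \<in> {x \<in> space (M i). b (g ks) i x}})"
      unfolding B2_def using False fin J bD
      by (simp only: if_False) (intro P.finite_measure_subadditive_finite, auto intro!: PiM_measure_component M)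
    also have "\<dots> = (\<Sum>i\<in>D. p (g ks))"
      using bD J by (intro sum.cong refl) (subst PiM_measure_component(2)[OF M J(1)], auto)
    also have "\<dots> = m * p (g ks)" by (simp add: m_def)
    also have "\<dots> \<le> m * S (g ks) + 2 * h * sqrt (m * S (g ks))" by (rule mp_le)
    also have "\<dots> \<le> 2 / h^4 + 2 * h * (2 / h\<^sup>2)"
    proof (intro add_mono mult_left_mono)
      show le: "m * S (g ks) \<le> 2 / h^4" using ks by (simp add: G_def)
      have "2 / h^4 \<le> (2 / h\<^sup>2)\<^sup>2" by (simp add: power_divide power_mult[symmetric] divide_right_mono)
      then show "sqrt (m * S (g ks)) \<le> 2 / h\<^sup>2" using le by (intro real_le_lsqrt) auto
    qed (use h in auto)
    also have "2 * h * (2 / h\<^sup>2) = 4 / h" using h by (simp add: power2_eq_square)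
    also have "2 / h^4 + 4 / h \<le> 2 / h + 4 / h"
      using h power_increasing[of 1 4 h] by (intro add_right_mono divide_left_mono) auto
    finally show ?thesis by simp
  qed (use h in \<open>auto simp: B2_def\<close>)
  define B where "B = (\<Union>k\<le>Suc Np. B1 k) \<union> B2"
  have B_sets: "B \<in> sets (PiM J M)" unfolding B_def using B1_sets B2_sets by auto
  have "measure (PiM J M) B \<le> measure (PiM J M) (\<Union>k\<le>Suc Np. B1 k) + measure (PiM J M) B2"
    unfolding B_def using B1_sets B2_sets by (intro measure_Un_le) auto
  also have "measure (PiM J M) (\<Union>k\<le>Suc Np. B1 k) \<le> (\<Sum>k\<le>Suc Np. measure (PiM J M) (B1 k))"
    using B1_sets by (intro P.finite_measure_subadditive_finite) auto
  also have "\<dots> \<le> (\<Sum>k\<le>Suc Np. 2 / (real n)^4)" by (intro sum_mono B1_meas)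
  also have "\<dots> = ((real n)\<^sup>2 + 1) * (2 / (real n)^4)" unfolding Np by simp
  also have "\<dots> \<le> (2 * (real n)\<^sup>2) * (2 / (real n)^4)"
    using n one_le_power[of "real n" 2] by (intro mult_right_mono) auto
  also have "\<dots> = 4 / (real n)\<^sup>2" using n by (simp add: power2_eq_square power4_eq_xxxx)
  finally have B_meas: "measure (PiM J M) B \<le> 4 / (real n)\<^sup>2 + 6 / h" using B2_meas by linarith
  have "\<bar>N w t - m * S t\<bar> \<le> L^3 * sqrt (m * S t)" if w: "w \<in> space (PiM J M)" "w \<notin> B" and t: "\<bar>t\<bar> \<le> L" for w t
  proof -
    have "g 0 \<le> t" "t \<le> g (Suc Np)" using t unfolding g0 gN by linarith+
    then obtain k where k: "k \<le> Np" "g k \<le> t" "t \<le> g (Suc k)" using grid_interval by blast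
    have N_mono: "N w t2 \<le> N w t1" if "t1 \<le> t2" for t1 t2
    proof -
      have "t1 * K \<le> t2 * K" using that K by simp
      then show ?thesis unfolding N_def by (intro sum_mono) auto
    qed
    have S_near: "m * S (g k) \<le> m * S t + 1 / h^4" "m * S t - 1 / h^4 \<le> m * S (g (Suc k))"
    proof -
      have "m * S (g (Suc k)) \<le> m * S t" "m * S t \<le> m * S (g k)" using S_mono k m by (auto intro: mult_left_mono)
      then show "m * S (g k) \<le> m * S t + 1 / h^4" "m * S t - 1 / h^4 \<le> m * S (g (Suc k))"
        using next_S[of k] by auto
    qed
    define s where "s = sqrt (m * S t)"
    have s: "s > 0" "s\<^sup>2 = m * S t" using mS[of t] by (auto simp: s_def)
    show ?thesis
    proof (cases "m * S t < 1 / h^4")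
      case True
      then have kG: "k \<in> G" using S_near(1) k(1) by (auto simp: G_def)
      then have "ks \<le> k" using finG by (simp add: ks_def)
      then have "g ks \<le> g k" using L unfolding g_def by (intro add_left_mono mult_right_mono) (auto simp: \<Delta>_def)
      have "\<not> b (g ks) i (w i)" if "i \<in> D" for i
      proof
        assume "b (g ks) i (w i)"
        moreover have "w i \<in> space (M i)" using w(1) that J by (auto simp: space_PiM)
        ultimately have "w \<in> B2" using w(1) that kG unfolding B2_def by auto
        then show False using w(2) by (simp add: B_def)
      qed
      then have "N w (g ks) = 0" unfolding N_def b_def by (intro sum.neutral) auto
      moreover have "N w t \<ge> 0" unfolding N_def by (intro sum_nonneg) auto
      ultimately have "N w t = 0" using N_mono[of "g ks" t] \<open>g ks \<le> g k\<close> k by linarith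
      moreover have "m * S t \<le> s"
      proof -
        have "s\<^sup>2 \<le> 1" using True h4 s by linarith
        then have "s \<le> 1" using s(1) power2_le_imp_le[of s 1] by simp
        then show ?thesis using s by (simp add: s(2)[symmetric] power2_eq_square mult_left_le_one_le)
      qed
      moreover have "1 * s \<le> L^3 * s" using L s by (intro mult_right_mono) (auto simp: one_le_power)
      ultimately show ?thesis unfolding s_def[symmetric] using mS[of t] by linarith
    next
      case False
      have dev: "\<bar>N w (g j) - m * S (g j)\<bar> \<le> 5 * (sqrt L * (s + 1 + h) + L) + 2 * h * (s + 1)"
        if j: "j = k \<or> j = Suc k" for j
      proof -
        have jN: "j \<le> Suc Np" using j k by auto
        then have "w \<notin> B1 j" using w(2) by (auto simp: B_def)
        then have d1: "\<bar>N w (g j) - m * p (g j)\<bar> \<le> 5 * (sqrt (L * (m * p (g j))) + L)"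
          using w(1) unfolding B1_def N_def b_def m_def by auto
        have d2: "\<bar>m * p (g j) - m * S (g j)\<bar> \<le> 2 * h * sqrt (m * S (g j))"
        proof -
          have "\<bar>m * p (g j) - m * S (g j)\<bar> = m * \<bar>p (g j) - S (g j)\<bar>"
            using m by (simp add: right_diff_distrib[symmetric] abs_mult)
          then show ?thesis using bias[of "g j"] by simp
        qed
        have "m * S (g j) \<le> s\<^sup>2 + 1"
        proof -
          have "m * S (g (Suc k)) \<le> m * S t" using S_mono k m by (auto intro: mult_left_mono)
          then have "m * S (g (Suc k)) \<le> s\<^sup>2 + 1" using mS[of t] s(2) by linarith
          moreover have "m * S (g k) \<le> s\<^sup>2 + 1" using S_near(1) h4(1) s(2) by linarith
          ultimately show ?thesis using j by blast
        qed
        also have "\<dots> \<le> (s + 1)\<^sup>2" using s by (simp add: power2_sum)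
        finally have sj: "sqrt (m * S (g j)) \<le> s + 1" using s by (intro real_le_lsqrt) auto
        \<comment> \<open>Completing the square turns the bias of the mean into an additive
          \<open>h\<close> in the standard deviation.\<close>
        have "m * p (g j) \<le> (sqrt (m * S (g j)) + h)\<^sup>2"
        proof -
          have "(sqrt (m * S (g j)) + h)\<^sup>2 = m * S (g j) + 2 * h * sqrt (m * S (g j)) + h\<^sup>2"
            using mS[of "g j"] by (simp add: power2_sum)
          then show ?thesis using mp_le[of "g j"] zero_le_power2[of h] by linarith
        qed
        also have "\<dots> \<le> (s + 1 + h)\<^sup>2" using sj h mS[of "g j"] by (intro power_mono add_mono) auto
        finally have "sqrt (m * p (g j)) \<le> s + 1 + h" using s h by (intro real_le_lsqrt) auto
        then have "sqrt (L * (m * p (g j))) \<le> sqrt L * (s + 1 + h)"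
          using L by (simp only: real_sqrt_mult) (intro mult_left_mono, auto)
        moreover have "2 * h * sqrt (m * S (g j)) \<le> 2 * h * (s + 1)" using sj h by (intro mult_left_mono) auto
        moreover have "\<bar>u - z\<bar> \<le> 5 * (x' + L) + y'"
          if "\<bar>u - v\<bar> \<le> 5 * (x + L)" "\<bar>v - z\<bar> \<le> y" "x \<le> x'" "y \<le> y'" for u v z x y x' y' :: real
          using that unfolding distrib_left by linarith
        ultimately show ?thesis using d1 d2 by blast
      qed
      have "N w t \<le> N w (g k)" "N w (g (Suc k)) \<le> N w t" using N_mono k by auto
      note near = this
      have "\<bar>N w t - m * S t\<bar> \<le> 1 + (5 * (sqrt L * (s + 1 + h) + L) + 2 * h * (s + 1))"
      proof -
        have "\<bar>u - v\<bar> \<le> 1 + x" if "u \<le> u1" "u2 \<le> u" "\<bar>u1 - v1\<bar> \<le> x" "\<bar>u2 - v2\<bar> \<le> x" "v1 \<le> v + e" "v - e \<le> v2" "e \<le> 1"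
          for u v u1 u2 v1 v2 x e :: real using that by linarith
        then show ?thesis using dev[of k] dev[of "Suc k"] S_near h4(1) near by blast
      qed
      also have "\<dots> \<le> (25 * h^3 * L) * s"
      proof -
        \<comment> \<open>Outside the sparse range \<open>s \<ge> 1 / h\<^sup>2\<close>, so even the
          terms without a factor \<open>s\<close> are bounded by \<open>Q = h^3 * L * s\<close>. The
          coefficients of the seven terms add up to 25, the constant in
          \<open>large2\<close>.\<close>
        have hs: "1 \<le> h\<^sup>2 * s"
        proof -
          have "(1 / h\<^sup>2)\<^sup>2 \<le> s\<^sup>2" using False s by (simp add: power_divide power_mult[symmetric])
          then have "1 / h\<^sup>2 \<le> s" by (rule power2_le_imp_le) (use s(1) in simp)
          then show ?thesis using h by (simp add: field_simps)
        qed
        define Q where "Q = h^3 * L * s"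
        have h23: "h\<^sup>2 \<le> h^3" "h \<le> h^3" "1 \<le> h^3"
          using h power_increasing[of 2 3 h] power_increasing[of 1 3 h] one_le_power[of h 3] by auto
        have sqL: "sqrt L \<le> L" "sqrt L \<ge> 1" "1 \<le> L"
          using L mult_left_mono[of 1 L L] by (auto intro!: real_le_lsqrt simp: power2_eq_square)
        have Qmul: "c * l * s \<le> Q" if "c \<le> h^3" "l \<le> L" "0 \<le> l" "0 \<le> c" for c l
          unfolding Q_def using that s(1) L h by (intro mult_right_mono mult_mono) auto
        have Qone: "c * l \<le> Q" if "0 \<le> c" "c \<le> h" "0 \<le> l" "l \<le> L" for c l
        proof -
          have "c * l * 1 \<le> c * l * (h\<^sup>2 * s)" using hs that by (intro mult_left_mono) auto
          also have "\<dots> = (c * h\<^sup>2) * l * s" by (simp only: mult_ac)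
          also have "\<dots> \<le> Q"
          proof (rule Qmul)
            have "c * h\<^sup>2 \<le> h * h\<^sup>2" using that h by (intro mult_right_mono) auto
            then show "c * h\<^sup>2 \<le> h^3" by (simp add: power2_eq_square power3_eq_cube)
          qed (use that in auto)
          finally show ?thesis by simp
        qed
        have q1: "1 \<le> Q" using Qone[of 1 1] h L by simp
        have q2: "sqrt L * s \<le> Q" using Qmul[of 1 "sqrt L"] h23 sqL L by simp
        have q3: "sqrt L \<le> Q" using Qone[of 1 "sqrt L"] h sqL by simp
        have q4: "sqrt L * h \<le> Q" using Qone[of h "sqrt L"] h sqL by (simp add: mult.commute)
        have q5: "L \<le> Q" using Qone[of 1 L] h L by simp
        have q6: "h * s \<le> Q" using Qmul[of h 1] h23 h L by simp
        have q7: "h \<le> Q" using Qone[of h 1] h L by simp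
        have "1 + (5 * (sqrt L * (s + 1 + h) + L) + 2 * h * (s + 1))
          = 1 + 5 * (sqrt L * s) + 5 * sqrt L + 5 * (sqrt L * h) + 5 * L + 2 * (h * s) + 2 * h"
          by (simp add: algebra_simps)
        also have "\<dots> \<le> 25 * Q" using q1 q2 q3 q4 q5 q6 q7 by linarith
        finally show ?thesis by (simp add: Q_def mult_ac)
      qed
      also have "\<dots> \<le> (L\<^sup>2 * L) * s" using large2 L s by (intro mult_right_mono) auto
      finally show ?thesis by (simp add: s_def power2_eq_square power3_eq_cube mult_ac)
    qed
  qed
  then show ?thesis using B_sets B_meas by (intro bexI[of _ B]) auto
qed

text \<open>A single threshold is involved, so Chebyshev suffices. With
  \<open>s = sqrt (m * S)\<close>, the indices in \<open>H\<close> raise the mean above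
  \<open>m * S\<close> by at least \<open>W / 2\<close>, up to the bias \<open>2 * h * s\<close> of
  the others, while the standard deviation is at most \<open>s + h + sqrt W\<close>.
  \<open>W1\<close> makes \<open>h * sqrt W\<close> and \<open>h\<^sup>2\<close> small fractions of
  \<open>W\<close>, and \<open>W2\<close> beats all terms in \<open>s\<close>.\<close>

lemma alternative_count_large:
  fixes Z :: "'i \<Rightarrow> 'a \<Rightarrow> real" and S p0 p1 T h c :: real
  assumes M: "\<And>i. prob_space (M i)" and J: "finite J" "D \<subseteq> J" and H: "H \<subseteq> D"
    and Z: "\<And>i. i \<in> D \<Longrightarrow> Z i \<in> borel_measurable (M i)"
    and p1: "\<And>i. i \<in> H \<Longrightarrow> measure (M i) {x \<in> space (M i). Z i x > T} = p1"
    and p0: "\<And>i. i \<in> D - H \<Longrightarrow> measure (M i) {x \<in> space (M i). Z i x > T} = p0"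
  defines "m \<equiv> real (card D)" and "W \<equiv> real (card H) * p1"
    and "N \<equiv> (\<lambda>w. \<Sum>i\<in>D. of_bool (Z i (w i) > T)) :: ('i \<Rightarrow> 'a) \<Rightarrow> real"
  assumes h: "h \<ge> 1" and S_pos: "S > 0" and p0_nonneg: "p0 \<ge> 0"
    and bias: "m * \<bar>p0 - S\<bar> \<le> 2 * h * sqrt (m * S)" and ratio: "S \<le> p1 / 2"
    and c: "c \<ge> 0" and W1: "W \<ge> 64 * h\<^sup>2" and W2: "W > 4 * (c + 3 * h) * sqrt (m * S)"
  shows "\<exists>B\<in>sets (PiM J M). measure (PiM J M) B \<le> 1 / h\<^sup>2 \<and>
    (\<forall>w\<in>space (PiM J M) - B. N w - m * S > c * sqrt (m * S))"
proof -
  interpret Mk: prob_space "M k" for k by (rule M)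
  interpret product_prob_space M J ..
  have fin: "finite D" "finite H" using finite_subset[OF J(2,1)] finite_subset[OF H] by auto
  have Wpos: "W > 0"
  proof -
    have "1 \<le> h\<^sup>2" using h by simp
    then show ?thesis using W1 by linarith
  qed
  define q where "q = (\<lambda>i. if i \<in> H then p1 else p0)"
  have p1_pos: "p1 \<ge> 0" using ratio S_pos by linarith
  have ev: "{x \<in> space (M i). Z i x > T} \<in> sets (M i)" if "i \<in> D" for i
    using Z[OF that] by measurable
  have q: "measure (M i) {x \<in> space (M i). Z i x > T} = q i" if "i \<in> D" for i
    using p1 p0 that by (auto simp: q_def)
  have q01: "0 \<le> q i" "q i \<le> 1" if "i \<in> D" for i
    using q[OF that] Mk.prob_le_1[of i] measure_nonneg[of "M i"] by metis+
  define f where "f = (\<lambda>i x. indicator {x \<in> space (M i). Z i x > T} x - q i :: real)"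
  have ind_int: "integrable (M i) (indicator {x \<in> space (M i). Z i x > T} :: 'a \<Rightarrow> real)" if "i \<in> D" for i
    using ev[OF that] by (intro integrable_real_indicator) (auto simp: Mk.emeasure_eq_measure)
  have ind_val: "(\<integral>x. indicator {x \<in> space (M i). Z i x > T} x \<partial>M i) = q i" if "i \<in> D" for i
    using ev[OF that] q[OF that] by (simp add: Int_absorb2)
  have f_sq: "(f i x)\<^sup>2 = (1 - 2 * q i) * indicator {x \<in> space (M i). Z i x > T} x + (q i)\<^sup>2" for i x
    by (simp add: f_def indicator_def power2_eq_square algebra_simps)
  define V where "V = (\<Sum>i\<in>D. q i)"
  have V_eq: "V = (m - card H) * p0 + W"
  proof -
    have "V = (\<Sum>i\<in>D - H. q i) + (\<Sum>i\<in>H. q i)" unfolding V_def using fin H by (simp add: sum.subset_diff)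
    also have "(\<Sum>i\<in>D - H. q i) = real (card (D - H)) * p0" by (simp add: q_def)
    also have "(\<Sum>i\<in>H. q i) = W" by (simp add: q_def W_def)
    also have "real (card (D - H)) = m - card H" using fin H by (simp add: m_def card_Diff_subset card_mono of_nat_diff)
    finally show ?thesis .
  qed
  have mk: "real (card H) \<le> m" unfolding m_def using fin H by (simp add: card_mono)
  have Vpos: "V > 0" using V_eq Wpos mk p0_nonneg by (simp add: add_nonneg_pos)
  have "measure (PiM J M) {w \<in> space (PiM J M). \<bar>\<Sum>i\<in>D. f i (w i)\<bar> \<ge> h * sqrt V} \<le> (\<Sum>i\<in>D. q i) / (h * sqrt V)\<^sup>2"
  proof (rule PiM_Chebyshev[OF M J])
    fix i assume i: "i \<in> D"
    show "f i \<in> borel_measurable (M i)" unfolding f_def using ev[OF i] by measurable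
    show "integrable (M i) (\<lambda>x. (f i x)\<^sup>2)" unfolding f_sq using ind_int[OF i] by auto
    show "(\<integral>x. f i x \<partial>M i) = 0"
      unfolding f_def using ind_int[OF i] ind_val[OF i] by (simp add: Mk.prob_space)
    have "(\<integral>x. (f i x)\<^sup>2 \<partial>M i) = (1 - 2 * q i) * q i + (q i)\<^sup>2"
      unfolding f_sq using ind_int[OF i] ind_val[OF i] by (simp add: Mk.prob_space)
    also have "\<dots> = q i - (q i)\<^sup>2" by (simp add: power2_eq_square algebra_simps)
    finally show "(\<integral>x. (f i x)\<^sup>2 \<partial>M i) \<le> q i" by simp
  qed (use h Vpos in auto)
  also have "\<dots> = 1 / h\<^sup>2" using Vpos by (simp add: power_mult_distrib V_def[symmetric])
  finally have prob: "measure (PiM J M) {w \<in> space (PiM J M). \<bar>\<Sum>i\<in>D. f i (w i)\<bar> \<ge> h * sqrt V} \<le> 1 / h\<^sup>2" .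
  let ?B = "{w \<in> space (PiM J M). \<bar>\<Sum>i\<in>D. f i (w i)\<bar> \<ge> h * sqrt V}"
  have f_meas: "(\<lambda>w. \<Sum>i\<in>D. f i (w i)) \<in> borel_measurable (PiM J M)"
  proof (intro borel_measurable_sum)
    fix i assume i: "i \<in> D"
    have "f i \<in> borel_measurable (M i)" unfolding f_def using ev[OF i] by measurable
    then show "(\<lambda>w. f i (w i)) \<in> borel_measurable (PiM J M)"
      using J i by (intro measurable_compose[OF measurable_component_singleton]) auto
  qed
  have B_sets: "?B \<in> sets (PiM J M)" using f_meas by measurable
  define s where "s = sqrt (m * S)"
  have m0: "m \<ge> 0" by (simp add: m_def)
  have s: "s \<ge> 0" "s\<^sup>2 = m * S" using m0 S_pos by (auto simp: s_def)
  have "N w - m * S > c * s" if w: "w \<in> space (PiM J M)" "w \<notin> ?B" for w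
  proof -
    have "(\<Sum>i\<in>D. f i (w i)) = N w - V"
    proof -
      have "f i (w i) = of_bool (Z i (w i) > T) - q i" if "i \<in> D" for i
      proof -
        have "w i \<in> space (M i)" using w(1) that J by (auto simp: space_PiM)
        then show ?thesis by (simp add: f_def indicator_def)
      qed
      then show ?thesis by (simp add: N_def V_def sum_subtractf)
    qed
    then have N1: "N w > V - h * sqrt V" using w by auto
    have b1: "(m - card H) * p0 - (m - card H) * S \<ge> - (2 * h * s)"
    proof -
      have "(m - card H) * \<bar>p0 - S\<bar> \<le> m * \<bar>p0 - S\<bar>" by (intro mult_right_mono) auto
      moreover have "- ((m - card H) * \<bar>p0 - S\<bar>) \<le> (m - card H) * (p0 - S)"
        using mk by (metis abs_ge_minus_self abs_mult abs_of_nonneg diff_ge_0_iff_ge minus_le_iff)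
      ultimately show ?thesis using bias by (simp add: right_diff_distrib s_def)
    qed
    have b2: "card H * S \<le> W / 2" unfolding W_def using ratio mult_left_mono[of S "p1 / 2" "card H"] by simp
    have b3: "V \<le> (s + h + sqrt W)\<^sup>2"
    proof -
      have "(m - card H) * p0 \<le> m * p0" using p0_nonneg by (intro mult_right_mono) auto
      also have "m * p0 \<le> m * S + m * \<bar>p0 - S\<bar>"
      proof -
        have "m * p0 - m * S \<le> m * \<bar>p0 - S\<bar>" unfolding right_diff_distrib[symmetric] using m0 by (intro mult_left_mono) auto
        then show ?thesis by linarith
      qed
      also have "\<dots> \<le> s\<^sup>2 + 2 * h * s" using bias s by (simp add: s_def)
      finally have "V \<le> s\<^sup>2 + 2 * h * s + W" unfolding V_eq by linarith
      also have "\<dots> \<le> (s + h + sqrt W)\<^sup>2"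
      proof -
        have "(s + h + sqrt W)\<^sup>2 = s\<^sup>2 + 2 * h * s + W + (h\<^sup>2 + 2 * s * sqrt W + 2 * h * sqrt W)"
          using Wpos by (simp add: power2_sum algebra_simps)
        moreover have "0 \<le> h\<^sup>2 + 2 * s * sqrt W + 2 * h * sqrt W" using s h Wpos by (intro add_nonneg_nonneg) auto
        ultimately show ?thesis by linarith
      qed
      finally show ?thesis .
    qed
    then have "sqrt V \<le> s + h + sqrt W" using s h Wpos by (intro real_le_lsqrt) auto
    then have b4: "h * sqrt V \<le> h * s + h\<^sup>2 + h * sqrt W"
      using h mult_left_mono[of "sqrt V" "s + h + sqrt W" h] by (simp add: power2_eq_square algebra_simps)
    have b5: "h * sqrt W \<le> W / 8"
    proof -
      have "8 * h \<le> sqrt W" using W1 h by (intro real_le_rsqrt) (simp add: power_mult_distrib)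
      then have "8 * h * sqrt W \<le> sqrt W * sqrt W" using Wpos by (intro mult_right_mono) auto
      then show ?thesis using Wpos by simp
    qed
    have "m * S = (m - card H) * S + card H * S" by (simp add: algebra_simps)
    then have "N w - m * S \<ge> W / 2 - 2 * h * s - (h * s + h\<^sup>2 + W / 8)"
      using N1 b1 b2 b4 b5 V_eq by linarith
    moreover have "W > 4 * (c * s) + 12 * (h * s)" using W2 by (simp add: s_def algebra_simps)
    moreover have "h\<^sup>2 \<le> W / 64" using W1 by simp
    ultimately show ?thesis using Wpos by linarith
  qed
  then show ?thesis using B_sets prob by (intro bexI[of _ ?B]) (auto simp: s_def)
qed

subsection \<open>Projected observations\<close>

definition obs_law :: "nat \<Rightarrow> nat \<Rightarrow> vec \<Rightarrow> vec \<Rightarrow> (nat \<Rightarrow> real) \<Rightarrow> (nat \<Rightarrow> real) \<Rightarrow> nat \<Rightarrow> (vec \<times> vec) measure" where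
  "obs_law p q \<theta> \<eta> z \<sigma> i = normal_vec p (\<lambda>j. z i * \<theta> j) \<Otimes>\<^sub>M normal_vec q (\<lambda>j. \<sigma> i * \<eta> j)"

definition proj :: "nat \<Rightarrow> vec \<Rightarrow> vec \<Rightarrow> real" where
  "proj p v X = inner_vec p v X / vnorm p v"

lemma prob_space_normal_vec: "prob_space (normal_vec p \<mu>)"
  unfolding normal_vec_def by (rule prob_space_PiM) (rule prob_space_normal1)

lemma prob_space_obs_law: "prob_space (obs_law p q \<theta> \<eta> z \<sigma> i)"
proof -
  interpret pair_prob_space "normal_vec p (\<lambda>j. z i * \<theta> j)" "normal_vec q (\<lambda>j. \<sigma> i * \<eta> j)"
    using prob_space_normal_vec
    by (intro pair_prob_space.intro pair_sigma_finite.intro prob_space_imp_sigma_finite)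
  show ?thesis unfolding obs_law_def by unfold_locales
qed

lemma sets_normal_vec: "sets (normal_vec p \<mu>) = sets (vec_space p)"
  unfolding normal_vec_def vec_space_def by (intro sets_PiM_cong) simp_all

lemma sets_obs_law: "sets (obs_law p q \<theta> \<eta> z \<sigma> i) = sets (vec_space p \<Otimes>\<^sub>M vec_space q)"
  unfolding obs_law_def by (intro sets_pair_measure_cong sets_normal_vec)

lemma proj_scale: "proj p v (\<lambda>j. c * \<mu> j) = c * proj p v \<mu>"
  by (simp add: proj_def inner_vec_def sum_distrib_left mult_ac)

lemma distr_proj:
  assumes "vnorm p v \<noteq> 0"
  shows "proj p v \<in> borel_measurable (normal_vec p \<mu>)"
    and "distr (normal_vec p \<mu>) borel (proj p v) = normal1 (proj p v \<mu>)"
  using normal_vec_projection[OF assms, of \<mu>] by (simp_all add: proj_def[abs_def])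

lemma distr_proj_signed:
  assumes "vnorm p v \<noteq> 0" and e: "e = 1 \<or> e = (-1 :: real)"
  shows "distr (normal_vec p \<mu>) borel (\<lambda>X. e * proj p v X) = normal1 (e * proj p v \<mu>)"
proof (cases "e = 1")
  case True
  then show ?thesis using distr_proj[OF assms(1), of \<mu>] by simp
next
  case False
  then have "e = -1" using e by auto
  have "distr (normal_vec p \<mu>) borel (\<lambda>X. e * proj p v X) = distr (distr (normal_vec p \<mu>) borel (proj p v)) borel uminus"
    using distr_proj[OF assms(1), of \<mu>] \<open>e = -1\<close> by (subst distr_distr) (auto simp: comp_def)
  then show ?thesis using distr_proj[OF assms(1), of \<mu>] normal1_uminus \<open>e = -1\<close> by simp
qed

lemma distr_obs_proj:
  assumes v: "vnorm p v \<noteq> 0" and u: "vnorm q u \<noteq> 0" and e: "e = 1 \<or> e = (-1 :: real)"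
  shows "(\<lambda>(X, Y). (proj p v X, e * proj q u Y)) \<in> obs_law p q \<theta> \<eta> z \<sigma> i \<rightarrow>\<^sub>M borel \<Otimes>\<^sub>M borel"
    and "distr (obs_law p q \<theta> \<eta> z \<sigma> i) (borel \<Otimes>\<^sub>M borel) (\<lambda>(X, Y). (proj p v X, e * proj q u Y))
      = normal1 (z i * proj p v \<theta>) \<Otimes>\<^sub>M normal1 (e * \<sigma> i * proj q u \<eta>)"
proof -
  note m1 = distr_proj(1)[OF v] and m2 = distr_proj(1)[OF u]
  have m2': "(\<lambda>Y. e * proj q u Y) \<in> borel_measurable (normal_vec q \<mu>)" for \<mu> using m2 by measurable
  show "(\<lambda>(X, Y). (proj p v X, e * proj q u Y)) \<in> obs_law p q \<theta> \<eta> z \<sigma> i \<rightarrow>\<^sub>M borel \<Otimes>\<^sub>M borel"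
    unfolding obs_law_def using m1 m2' by measurable
  have "distr (obs_law p q \<theta> \<eta> z \<sigma> i) (borel \<Otimes>\<^sub>M borel) (\<lambda>(X, Y). (proj p v X, e * proj q u Y))
     = distr (normal_vec p (\<lambda>j. z i * \<theta> j)) borel (proj p v) \<Otimes>\<^sub>M distr (normal_vec q (\<lambda>j. \<sigma> i * \<eta> j)) borel (\<lambda>Y. e * proj q u Y)"
    unfolding obs_law_def
    by (rule pair_measure_distr[symmetric, OF m1 m2'])
       (simp add: distr_proj_signed[OF u e] prob_space_imp_sigma_finite prob_space_normal1)
  then show "distr (obs_law p q \<theta> \<eta> z \<sigma> i) (borel \<Otimes>\<^sub>M borel) (\<lambda>(X, Y). (proj p v X, e * proj q u Y))
      = normal1 (z i * proj p v \<theta>) \<Otimes>\<^sub>M normal1 (e * \<sigma> i * proj q u \<eta>)"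
    using distr_proj_signed[OF u e] distr_proj(2)[OF v] by (simp add: proj_scale mult.assoc)
qed

lemma obs_C_minus_tail:
  fixes \<theta> \<eta> :: vec and z \<sigma> :: "nat \<Rightarrow> real" and i :: nat and a b :: real
  assumes v: "vnorm p v \<noteq> 0" and u: "vnorm q u \<noteq> 0" and e: "e = 1 \<or> e = (-1 :: real)"
  defines "M \<equiv> obs_law p q \<theta> \<eta> z \<sigma> i" and "Z \<equiv> \<lambda>x. C_minus (proj p v (fst x)) (e * proj q u (snd x)) a b"
  shows "Z \<in> borel_measurable M"
    and "measure M {x \<in> space M. Z x > T} = C_tail (z i * proj p v \<theta>) (e * \<sigma> i * proj q u \<eta>) a b T"
proof -
  let ?f = "\<lambda>(X, Y). (proj p v X, e * proj q u Y)"
  note f = distr_obs_proj[OF v u e, of \<theta> \<eta> z \<sigma> i]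
  have C: "(\<lambda>y. C_minus (fst y) (snd y) a b) \<in> borel_measurable (borel \<Otimes>\<^sub>M borel)"
    unfolding C_minus_def by measurable
  show "Z \<in> borel_measurable M"
    using measurable_compose[OF f(1) C] by (simp add: Z_def M_def case_prod_beta')
  have "C_tail (z i * proj p v \<theta>) (e * \<sigma> i * proj q u \<eta>) a b T = measure (distr M (borel \<Otimes>\<^sub>M borel) ?f) {(x, y). C_minus x y a b > T}"
    unfolding C_tail_def M_def f(2) ..
  also have "\<dots> = measure M (?f -` {(x, y). C_minus x y a b > T} \<inter> space M)"
    unfolding M_def by (rule measure_distr[OF f(1) C_minus_sets])
  also have "?f -` {(x, y). C_minus x y a b > T} \<inter> space M = {x \<in> space M. Z x > T}"
    by (auto simp: Z_def)
  finally show "measure M {x \<in> space M. Z x > T} = C_tail (z i * proj p v \<theta>) (e * \<sigma> i * proj q u \<eta>) a b T" ..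
qed

lemma obs_distr_component:
  assumes "vnorm p v \<noteq> 0" "vnorm q u \<noteq> 0"
  shows "distr (obs_law p q \<theta> \<eta> z \<sigma> i) borel (\<lambda>x. proj p v (fst x)) = normal1 (z i * proj p v \<theta>)"
    and "(\<lambda>x. proj p v (fst x)) \<in> borel_measurable (obs_law p q \<theta> \<eta> z \<sigma> i)"
    and "distr (obs_law p q \<theta> \<eta> z \<sigma> i) borel (\<lambda>x. proj q u (snd x)) = normal1 (\<sigma> i * proj q u \<eta>)"
    and "(\<lambda>x. proj q u (snd x)) \<in> borel_measurable (obs_law p q \<theta> \<eta> z \<sigma> i)"
proof -
  let ?f = "\<lambda>(X, Y). (proj p v X, 1 * proj q u Y)"
  note f = distr_obs_proj[OF assms, of 1 \<theta> \<eta> z \<sigma> i, simplified]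
  interpret pair_prob_space "normal1 (z i * proj p v \<theta>)" "normal1 (\<sigma> i * proj q u \<eta>)" by (rule pair_prob_space_normal1)
  show m1: "(\<lambda>x. proj p v (fst x)) \<in> borel_measurable (obs_law p q \<theta> \<eta> z \<sigma> i)"
    using measurable_compose[OF f(1) measurable_fst] by (simp add: case_prod_beta')
  show m2: "(\<lambda>x. proj q u (snd x)) \<in> borel_measurable (obs_law p q \<theta> \<eta> z \<sigma> i)"
    using measurable_compose[OF f(1) measurable_snd] by (simp add: case_prod_beta')
  have eq: "distr (normal1 a \<Otimes>\<^sub>M normal1 b) borel fst = normal1 a" "distr (normal1 a \<Otimes>\<^sub>M normal1 b) borel snd = normal1 b" for a b
  proof -
    interpret N: pair_prob_space "normal1 a" "normal1 b" by (rule pair_prob_space_normal1)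
    have "distr (normal1 a \<Otimes>\<^sub>M normal1 b) borel fst = distr (normal1 a \<Otimes>\<^sub>M normal1 b) (normal1 a) fst" by (intro distr_cong) auto
    then show "distr (normal1 a \<Otimes>\<^sub>M normal1 b) borel fst = normal1 a" using N.M2.distr_pair_fst by simp
    show "distr (normal1 a \<Otimes>\<^sub>M normal1 b) borel snd = normal1 b"
    proof (intro measure_eqI)
      fix A assume "A \<in> sets (distr (normal1 a \<Otimes>\<^sub>M normal1 b) borel snd)"
      then have A: "A \<in> sets borel" by simp
      have "emeasure (distr (normal1 a \<Otimes>\<^sub>M normal1 b) borel snd) A = emeasure (normal1 a \<Otimes>\<^sub>M normal1 b) (space (normal1 a) \<times> A)"
        using A by (subst emeasure_distr) (auto intro!: arg_cong2[where f=emeasure])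
      also have "\<dots> = emeasure (normal1 b) A"
        using A N.M1.emeasure_space_1 by (subst N.M2.emeasure_pair_measure_Times) auto
      finally show "emeasure (distr (normal1 a \<Otimes>\<^sub>M normal1 b) borel snd) A = emeasure (normal1 b) A" .
    qed simp
  qed
  have "distr (obs_law p q \<theta> \<eta> z \<sigma> i) borel (\<lambda>x. proj p v (fst x)) = distr (distr (obs_law p q \<theta> \<eta> z \<sigma> i) (borel \<Otimes>\<^sub>M borel) (\<lambda>(X, Y). (proj p v X, proj q u Y))) borel fst"
    using f(1) by (subst distr_distr) (auto simp: comp_def case_prod_beta')
  then show "distr (obs_law p q \<theta> \<eta> z \<sigma> i) borel (\<lambda>x. proj p v (fst x)) = normal1 (z i * proj p v \<theta>)"
    unfolding f(2) eq .
  have "distr (obs_law p q \<theta> \<eta> z \<sigma> i) borel (\<lambda>x. proj q u (snd x)) = distr (distr (obs_law p q \<theta> \<eta> z \<sigma> i) (borel \<Otimes>\<^sub>M borel) (\<lambda>(X, Y). (proj p v X, proj q u Y))) borel snd"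
    using f(1) by (subst distr_distr) (auto simp: comp_def case_prod_beta')
  then show "distr (obs_law p q \<theta> \<eta> z \<sigma> i) borel (\<lambda>x. proj q u (snd x)) = normal1 (\<sigma> i * proj q u \<eta>)"
    unfolding f(2) eq .
qed

subsection \<open>Estimated signal strengths\<close>

text \<open>Squaring removes the unknown labels \<open>s i\<close>: all indices share the mean
  \<open>1 + a\<^sup>2\<close> and the variance \<open>2 + 4 * a\<^sup>2\<close>, so the signal
  strength can be estimated without them.\<close>

lemma mean_square_concentration:
  fixes f :: "nat \<Rightarrow> 'a \<Rightarrow> real" and a :: real
  assumes M: "\<And>i. prob_space (M i)" and J: "finite J" "D \<subseteq> J" and D: "D \<noteq> {}"
    and f: "\<And>i. i \<in> D \<Longrightarrow> f i \<in> borel_measurable (M i)"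
    and distr_f: "\<And>i. i \<in> D \<Longrightarrow> distr (M i) borel (f i) = normal1 (s i * a)"
    and s: "\<And>i. i \<in> D \<Longrightarrow> (s i)\<^sup>2 = 1" and y: "y > 0"
  shows "\<exists>B\<in>sets (PiM J M). measure (PiM J M) B \<le> (2 + 4 * a\<^sup>2) / (real (card D) * y\<^sup>2) \<and>
    (\<forall>w\<in>space (PiM J M) - B. \<bar>1 / real (card D) * (\<Sum>i\<in>D. (f i (w i))\<^sup>2) - 1 - a\<^sup>2\<bar> < y)"
proof -
  have fin: "finite D" using finite_subset[OF J(2,1)] .
  then have m: "real (card D) > 0" using D by (simp add: card_gt_0_iff)
  define g where "g = (\<lambda>i x. (f i x)\<^sup>2 - 1 - a\<^sup>2)"
  have sa: "(s i * a)\<^sup>2 = a\<^sup>2" if "i \<in> D" for i using s[OF that] by (simp add: power_mult_distrib)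
  have g_meas: "g i \<in> borel_measurable (M i)" if "i \<in> D" for i
    unfolding g_def using f[OF that] by measurable
  let ?B = "{w \<in> space (PiM J M). \<bar>\<Sum>i\<in>D. g i (w i)\<bar> \<ge> card D * y}"
  have "(\<lambda>w. \<Sum>i\<in>D. g i (w i)) \<in> borel_measurable (PiM J M)"
  proof (intro borel_measurable_sum)
    fix i assume i: "i \<in> D"
    show "(\<lambda>w. g i (w i)) \<in> borel_measurable (PiM J M)"
      using J i g_meas[OF i] by (intro measurable_compose[OF measurable_component_singleton]) auto
  qed
  then have B: "?B \<in> sets (PiM J M)" by measurable
  have "measure (PiM J M) ?B \<le> (\<Sum>i\<in>D. 2 + 4 * a\<^sup>2) / (card D * y)\<^sup>2"
  proof (rule PiM_Chebyshev[OF M J])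
    fix i assume i: "i \<in> D"
    show "g i \<in> borel_measurable (M i)" using g_meas[OF i] .
    have 1: "integrable (distr (M i) borel (f i)) (\<lambda>x. (x\<^sup>2 - 1 - a\<^sup>2)\<^sup>2)"
      using normal1_sq_centred(1)[of "s i * a"] unfolding distr_f[OF i] sa[OF i] .
    show "integrable (M i) (\<lambda>x. (g i x)\<^sup>2)"
      using 1 f[OF i] by (subst (asm) integrable_distr_eq) (auto simp: g_def)
    have "(\<integral>x. x\<^sup>2 - 1 - a\<^sup>2 \<partial>distr (M i) borel (f i)) = (\<integral>x. g i x \<partial>M i)"
      using f[OF i] by (subst integral_distr) (auto simp: g_def)
    then show "(\<integral>x. g i x \<partial>M i) = 0"
      using normal1_sq_centred(2)[of "s i * a"] unfolding distr_f[OF i] sa[OF i] by simp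
    have "(\<integral>x. (x\<^sup>2 - 1 - a\<^sup>2)\<^sup>2 \<partial>distr (M i) borel (f i)) = (\<integral>x. (g i x)\<^sup>2 \<partial>M i)"
      using f[OF i] by (subst integral_distr) (auto simp: g_def)
    then show "(\<integral>x. (g i x)\<^sup>2 \<partial>M i) \<le> 2 + 4 * a\<^sup>2"
      using normal1_sq_centred(3)[of "s i * a"] unfolding distr_f[OF i] sa[OF i] by simp
  qed (use m y in simp)
  also have "\<dots> = (2 + 4 * a\<^sup>2) / (real (card D) * y\<^sup>2)"
    using m by (simp add: power2_eq_square)
  finally have prob: "measure (PiM J M) ?B \<le> (2 + 4 * a\<^sup>2) / (real (card D) * y\<^sup>2)" .
  have "\<bar>1 / real (card D) * (\<Sum>i\<in>D. (f i (w i))\<^sup>2) - 1 - a\<^sup>2\<bar> < y" if "w \<in> space (PiM J M) - ?B" for w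
  proof -
    have sum: "(\<Sum>i\<in>D. g i (w i)) = (\<Sum>i\<in>D. (f i (w i))\<^sup>2) - card D * (1 + a\<^sup>2)"
      by (simp add: g_def sum_subtractf algebra_simps)
    have "1 / real (card D) * (\<Sum>i\<in>D. (f i (w i))\<^sup>2) - 1 - a\<^sup>2 = (\<Sum>i\<in>D. g i (w i)) / card D"
      unfolding sum using m by (simp add: field_simps)
    moreover have "\<bar>\<Sum>i\<in>D. g i (w i)\<bar> < card D * y" using that by auto
    ultimately show ?thesis using m by (simp add: divide_less_eq mult.commute)
  qed
  then show ?thesis using B prob by (intro bexI[of _ ?B]) auto
qed

text \<open>The difference of squares is divided by the lower bound \<open>lo\<close> of
  \<open>\<bar>a\<bar>\<close>. Since \<open>y \<le> lo\<close>, the mean square minus 1 is positive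
  and the truncation in \<open>signal_hat\<close> is inactive.\<close>

lemma signal_hat_close:
  assumes close: "\<bar>1 / real (card D) * (\<Sum>i\<in>D. (x i)\<^sup>2) - 1 - a\<^sup>2\<bar> < lo * y" and lo: "0 < lo" "lo \<le> \<bar>a\<bar>" and y: "0 < y" "y \<le> lo"
  shows "\<bar>signal_hat D x - \<bar>a\<bar>\<bar> \<le> y"
proof -
  define t where "t = 1 / real (card D) * (\<Sum>i\<in>D. (x i)\<^sup>2) - 1"
  have t: "\<bar>t - a\<^sup>2\<bar> < lo * y" using close by (simp add: t_def)
  have "lo * y \<le> lo * lo" using y lo by (intro mult_left_mono) auto
  also have "\<dots> \<le> a\<^sup>2" using lo power_mono[of lo "\<bar>a\<bar>" 2] by (simp add: power2_eq_square)
  finally have t0: "t > 0" using t by linarith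
  have "signal_hat D x = sqrt (max t 0)" unfolding signal_hat_def t_def ..
  then have sh: "signal_hat D x = sqrt t" using t0 by simp
  have "(sqrt t - \<bar>a\<bar>) * (sqrt t + \<bar>a\<bar>) = t - a\<^sup>2"
    using t0 by (simp add: algebra_simps power2_eq_square[symmetric])
  then have "\<bar>sqrt t - \<bar>a\<bar>\<bar> * (sqrt t + \<bar>a\<bar>) = \<bar>t - a\<^sup>2\<bar>"
    using t0 by (metis abs_mult abs_of_nonneg add_nonneg_nonneg abs_ge_zero less_imp_le real_sqrt_ge_zero)
  moreover have "\<bar>sqrt t - \<bar>a\<bar>\<bar> * lo \<le> \<bar>sqrt t - \<bar>a\<bar>\<bar> * (sqrt t + \<bar>a\<bar>)"
    using lo t0 real_sqrt_ge_zero[of t] by (intro mult_left_mono) linarith+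
  ultimately have "\<bar>sqrt t - \<bar>a\<bar>\<bar> * lo \<le> y * lo" using t by (simp add: mult.commute)
  then show ?thesis unfolding sh using lo by simp
qed

text \<open>The estimate is close to \<open>s * \<theta>\<close> for some sign \<open>s\<close>
  only, hence the absolute values. The error \<open>e\<close> is paid twice: in the inner product,
  by Cauchy-Schwarz, and in replacing \<open>vnorm p v\<close> by
  \<open>vnorm p \<theta>\<close>.\<close>

lemma proj_close:
  assumes loss: "loss p v \<theta> \<le> e" and e: "0 \<le> e" "e < vnorm p \<theta>"
  shows "vnorm p v \<noteq> 0" and "vnorm p \<theta> - 2 * e \<le> \<bar>proj p v \<theta>\<bar>" and "\<bar>proj p v \<theta>\<bar> \<le> vnorm p \<theta>"
proof -
  have vnorm_abs: "L2_set (\<lambda>j. \<bar>u j\<bar>) {1..p} = vnorm p u" for u by (simp add: vnorm_def L2_set_def)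
  have cs: "\<bar>inner_vec p u w\<bar> \<le> vnorm p u * vnorm p w" for u w
  proof -
    have "\<bar>inner_vec p u w\<bar> \<le> (\<Sum>j=1..p. \<bar>u j\<bar> * \<bar>w j\<bar>)"
      unfolding inner_vec_def by (rule order_trans[OF sum_abs]) (simp add: abs_mult)
    also have "\<dots> \<le> vnorm p u * vnorm p w"
      unfolding vnorm_def by (rule L2_set_mult_ineq)
    finally show ?thesis .
  qed
  obtain s :: real where s: "s = 1 \<or> s = -1" and dist: "vnorm p (\<lambda>j. v j - s * \<theta> j) \<le> e"
  proof -
    have "vnorm p (\<lambda>j. v j - 1 * \<theta> j) \<le> e \<or> vnorm p (\<lambda>j. v j - (-1) * \<theta> j) \<le> e"
      using loss by (auto simp: loss_def min_def split: if_splits)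
    then show thesis using that by blast
  qed
  have s_norm: "vnorm p (\<lambda>j. s * \<theta> j) = vnorm p \<theta>"
    using s by (auto simp: vnorm_def L2_set_def)
  have tri: "vnorm p \<theta> \<le> vnorm p v + e"
  proof -
    have "vnorm p (\<lambda>j. s * \<theta> j) = vnorm p (\<lambda>j. v j + - (v j - s * \<theta> j))" by simp
    also have "\<dots> \<le> vnorm p v + vnorm p (\<lambda>j. - (v j - s * \<theta> j))"
      unfolding vnorm_def by (rule L2_set_triangle_ineq)
    also have "vnorm p (\<lambda>j. - (v j - s * \<theta> j)) = vnorm p (\<lambda>j. v j - s * \<theta> j)"
      by (simp add: vnorm_def L2_set_def power2_commute)
    finally show ?thesis using dist s_norm by simp
  qed
  then have pos: "vnorm p v > 0" using e by linarith
  then show "vnorm p v \<noteq> 0" by simp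
  have "\<bar>inner_vec p v \<theta>\<bar> \<le> vnorm p v * vnorm p \<theta>" by (rule cs)
  then show "\<bar>proj p v \<theta>\<bar> \<le> vnorm p \<theta>" using pos by (simp add: proj_def abs_divide divide_le_eq mult.commute)
  have "s * inner_vec p v \<theta> = inner_vec p v v - inner_vec p v (\<lambda>j. v j - s * \<theta> j)"
    by (simp add: inner_vec_def sum_distrib_left sum_subtractf[symmetric] algebra_simps)
  moreover have "inner_vec p v v = (vnorm p v)\<^sup>2"
    by (simp add: inner_vec_def vnorm_def L2_set_def sum_nonneg power2_eq_square)
  moreover have "inner_vec p v (\<lambda>j. v j - s * \<theta> j) \<le> vnorm p v * e"
    using cs[of v "\<lambda>j. v j - s * \<theta> j"] mult_left_mono[OF dist, of "vnorm p v"] pos by linarith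
  ultimately have "vnorm p v * (vnorm p v - e) \<le> s * inner_vec p v \<theta>"
    by (simp add: power2_eq_square algebra_simps)
  also have "\<dots> \<le> \<bar>inner_vec p v \<theta>\<bar>" using s by auto
  finally have "vnorm p v - e \<le> \<bar>proj p v \<theta>\<bar>"
    using pos by (simp add: proj_def abs_divide le_divide_eq mult.commute)
  then show "vnorm p \<theta> - 2 * e \<le> \<bar>proj p v \<theta>\<bar>" using tri by linarith
qed

subsection \<open>Random splitting\<close>

definition split_law :: "nat \<Rightarrow> (nat \<Rightarrow> nat) measure" where
  "split_law n = Pi\<^sub>M {1..n} (\<lambda>_. measure_pmf (pmf_of_set {0, 1, 2}))"

lemma prob_space_split_law: "prob_space (split_law n)"
  unfolding split_law_def by (rule prob_space_PiM) (rule prob_space_measure_pmf)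

text \<open>A third of \<open>K\<close> is expected in each class, and a quarter is guaranteed.
  \<open>K\<close> is a general subset because the bound is also needed for the set of mismatched
  indices.\<close>

lemma split_concentration:
  assumes K: "K \<subseteq> {1..n}" "K \<noteq> {}" and m: "m \<in> {0, 1, 2}"
  shows "\<exists>B\<in>sets (split_law n). measure (split_law n) B \<le> 32 / real (card K) \<and>
    (\<forall>d\<in>space (split_law n) - B. real (card K) / 4 \<le> real (card {i\<in>K. d i = m}))"
proof -
  let ?P = "measure_pmf (pmf_of_set {0, 1, 2 :: nat})"
  have fin: "finite K" using K finite_subset by blast
  then have k: "real (card K) > 0" using K by (simp add: card_gt_0_iff)
  define f :: "nat \<Rightarrow> nat \<Rightarrow> real" where "f = (\<lambda>_ x. of_bool (x = m) - 1 / 3)"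
  have E: "(\<integral>x. g x \<partial>?P) = (g 0 + g 1 + g 2) / 3" for g :: "nat \<Rightarrow> real"
    by (subst integral_pmf_of_set) simp_all
  \<comment> \<open>The deviation \<open>1 / 12\<close> per index is \<open>1 / 3 - 1 / 4\<close>;
    with variance \<open>2 / 9\<close> Chebyshev gives the constant
    \<open>144 * 2 / 9 = 32\<close>.\<close>
  let ?B = "{d \<in> space (split_law n). \<bar>\<Sum>i\<in>K. f i (d i)\<bar> \<ge> card K / 12}"
  have "(\<lambda>d. \<Sum>i\<in>K. f i (d i)) \<in> borel_measurable (split_law n)"
  proof (intro borel_measurable_sum)
    fix i assume "i \<in> K"
    then have "(\<lambda>d. d i) \<in> split_law n \<rightarrow>\<^sub>M ?P"
      unfolding split_law_def using K by (intro measurable_component_singleton) auto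
    then show "(\<lambda>d. f i (d i)) \<in> borel_measurable (split_law n)"
      by (rule measurable_compose) simp
  qed
  then have B: "?B \<in> sets (split_law n)" by measurable
  have "measure (split_law n) ?B \<le> (\<Sum>i\<in>K. 2 / 9) / (card K / 12)\<^sup>2"
    unfolding split_law_def
  proof (rule PiM_Chebyshev)
    fix i
    show "integrable ?P (\<lambda>x. (f i x)\<^sup>2)" by (intro integrable_measure_pmf_finite) simp
    show "(\<integral>x. f i x \<partial>?P) = 0" unfolding E using m by (auto simp: f_def)
    show "(\<integral>x. (f i x)\<^sup>2 \<partial>?P) \<le> 2 / 9" unfolding E using m by (auto simp: f_def power2_eq_square)
  qed (use K k in \<open>auto intro: prob_space_measure_pmf\<close>)
  also have "\<dots> = 32 / real (card K)" using k by (simp add: power2_eq_square field_simps)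
  finally have prob: "measure (split_law n) ?B \<le> 32 / real (card K)" .
  have "real (card K) / 4 \<le> real (card {i\<in>K. d i = m})" if "d \<in> space (split_law n) - ?B" for d
  proof -
    have "(\<Sum>i\<in>K. f i (d i)) = real (card {i\<in>K. d i = m}) - card K / 3"
      using fin by (simp add: f_def sum_subtractf Int_def)
    moreover have "\<bar>\<Sum>i\<in>K. f i (d i)\<bar> < card K / 12" using that by auto
    ultimately show ?thesis by linarith
  qed
  then show ?thesis using B prob by (intro bexI[of _ ?B]) auto
qed

subsection \<open>The higher criticism statistic\<close>

lemma HC_stat_le:
  assumes "\<And>t. \<bar>t\<bar> \<le> ln (real n) \<Longrightarrow>
     \<bar>(\<Sum>i\<in>I. of_bool (C (x i) (y i) a b > t * sqrt (2 * ln (real n)))) - real (card I) * S_tail n (r_hat n a b) (s_hat n a b) t\<bar>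
       \<le> c * sqrt (real (card I) * S_tail n (r_hat n a b) (s_hat n a b) t)"
    and pos: "\<And>t. \<bar>t\<bar> \<le> ln (real n) \<Longrightarrow> 0 < real (card I) * S_tail n (r_hat n a b) (s_hat n a b) t"
  shows "HC_stat n C I x y a b \<le> ereal c"
  unfolding HC_stat_def
proof (rule SUP_least)
  fix t assume "t \<in> {t. \<bar>t\<bar> \<le> ln (real n)}"
  then show "ereal (\<bar>(\<Sum>i\<in>I. of_bool (C (x i) (y i) a b > t * sqrt (2 * ln (real n))))
                 - real (card I) * S_tail n (r_hat n a b) (s_hat n a b) t\<bar>
               / sqrt (real (card I) * S_tail n (r_hat n a b) (s_hat n a b) t)) \<le> ereal c"
    using assms(1)[of t] pos[of t] by (simp add: divide_le_eq)
qed

lemma HC_stat_gt: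
  assumes t: "\<bar>t\<bar> \<le> ln (real n)"
    and gt: "(\<Sum>i\<in>I. of_bool (C (x i) (y i) a b > t * sqrt (2 * ln (real n)))) - real (card I) * S_tail n (r_hat n a b) (s_hat n a b) t
       > c * sqrt (real (card I) * S_tail n (r_hat n a b) (s_hat n a b) t)"
    and pos: "0 < real (card I) * S_tail n (r_hat n a b) (s_hat n a b) t"
  shows "HC_stat n C I x y a b > ereal c"
  unfolding HC_stat_def less_SUP_iff
proof (rule bexI[of _ t])
  let ?S = "real (card I) * S_tail n (r_hat n a b) (s_hat n a b) t"
  let ?N = "\<Sum>i\<in>I. of_bool (C (x i) (y i) a b > t * sqrt (2 * ln (real n))) :: real"
  have "c * sqrt ?S < \<bar>?N - ?S\<bar>" using gt by linarith
  then show "ereal c < ereal (\<bar>?N - ?S\<bar> / sqrt ?S)"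
    using pos by (simp add: less_divide_eq)
qed (use t in simp)

subsection \<open>The test statistics given the estimated directions and signal strengths\<close>

text \<open>Indexing the two statistics by a sign lets one argument serve both: the sign only
  multiplies the second coordinate of \<open>C_minus\<close>.\<close>

definition C_sgn :: "real \<Rightarrow> real \<Rightarrow> real \<Rightarrow> real \<Rightarrow> real \<Rightarrow> real" where
  "C_sgn e = (if e = 1 then C_minus else C_plus)"

lemma C_sgn_eq: "e = 1 \<or> e = -1 \<Longrightarrow> C_sgn e x y a b = C_minus x (e * y) a b"
  by (auto simp: C_sgn_def C_minus_def C_plus_def)

text \<open>The law of \<open>C_minus\<close> is unchanged when both means are reversed, so only the
  sign of their product matters: positive for an index that behaves as under the null, negative for
  a mismatched one.\<close>

lemma C_tail_abs:
  assumes z: "z = 1 \<or> z = (-1 :: real)" and w: "w = 1 \<or> w = (-1 :: real)"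
  shows "z * m1 * (w * m2) > 0 \<Longrightarrow> C_tail (z * m1) (w * m2) a b T = C_tail \<bar>m1\<bar> \<bar>m2\<bar> a b T"
    and "z * m1 * (w * m2) < 0 \<Longrightarrow> C_tail (z * m1) (w * m2) a b T = C_tail \<bar>m1\<bar> (- \<bar>m2\<bar>) a b T"
proof -
  define X Y where "X = z * m1" and "Y = w * m2"
  have abs: "\<bar>m1\<bar> = \<bar>X\<bar>" "\<bar>m2\<bar> = \<bar>Y\<bar>" using z w by (auto simp: X_def Y_def)
  have "C_tail X Y a b T = C_tail \<bar>X\<bar> \<bar>Y\<bar> a b T" if "X * Y > 0"
    using that C_tail_uminus[of X Y a b T] by (auto simp: zero_less_mult_iff abs_if)
  then show "z * m1 * (w * m2) > 0 \<Longrightarrow> C_tail (z * m1) (w * m2) a b T = C_tail \<bar>m1\<bar> \<bar>m2\<bar> a b T"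
    unfolding abs X_def[symmetric] Y_def[symmetric] by blast
  have "C_tail X Y a b T = C_tail \<bar>X\<bar> (- \<bar>Y\<bar>) a b T" if "X * Y < 0"
    using that C_tail_uminus[of X Y a b T] by (auto simp: mult_less_0_iff abs_if)
  then show "z * m1 * (w * m2) < 0 \<Longrightarrow> C_tail (z * m1) (w * m2) a b T = C_tail \<bar>m1\<bar> (- \<bar>m2\<bar>) a b T"
    unfolding abs X_def[symmetric] Y_def[symmetric] by blast
qed

text \<open>With both means off by at most \<open>h / sqrt n\<close>, the chi-square divergence is
  at most \<open>4 * h\<^sup>2 / n\<close>; the comparison proportional to the root of the null
  tail, multiplied by \<open>m \<le> n\<close>, then gives \<open>2 * h\<close> times the root of
  the expected count.\<close>

lemma C_tail_bias:
  assumes ab: "a > 0" "b > 0" and n: "n > 0" and h: "h \<ge> 1" "2 * h\<^sup>2 \<le> real n" and m: "0 \<le> m" "m \<le> real n"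
    and close: "\<bar>a - a1\<bar> \<le> h / sqrt (real n)" "\<bar>b - b1\<bar> \<le> h / sqrt (real n)"
  shows "m * \<bar>C_tail a1 b1 a b T - C_tail a b a b T\<bar> \<le> 2 * h * sqrt (m * C_tail a b a b T)"
proof -
  let ?S = "C_tail a b a b T"
  have S: "?S > 0" using C_tail_pos[OF ab] .
  define D where "D = (a1 - a)\<^sup>2 + (b1 - b)\<^sup>2"
  define K where "K = 2 * h / sqrt (real n)"
  have K: "K > 0" using h n by (simp add: K_def)
  have sq: "(h / sqrt (real n))\<^sup>2 = h\<^sup>2 / real n" by (simp add: power_divide)
  have "(a1 - a)\<^sup>2 \<le> h\<^sup>2 / real n" "(b1 - b)\<^sup>2 \<le> h\<^sup>2 / real n"
    using power_mono[OF close(1), of 2] power_mono[OF close(2), of 2] by (simp_all add: sq power2_commute)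
  then have D: "D \<le> 2 * h\<^sup>2 / real n" by (simp add: D_def)
  have "2 * h\<^sup>2 / real n \<le> 1" using h n by simp
  with D have D1: "D \<le> 1" by linarith
  have D0: "D \<ge> 0" by (simp add: D_def)
  have "exp D \<le> 1 + D + D\<^sup>2" using exp_bound[OF D0 D1] by simp
  also have "D\<^sup>2 \<le> D" using D0 D1 by (simp add: power2_eq_square mult_left_le_one_le)
  finally have "exp D - 1 \<le> 2 * D" by linarith
  also have "\<dots> \<le> K\<^sup>2" using D n by (simp add: K_def power_divide power_mult_distrib)
  finally have chi: "exp D - 1 \<le> K\<^sup>2" .
  have "\<bar>C_tail a1 b1 a b T - ?S\<bar> \<le> K * sqrt ?S"
    unfolding C_tail_def
    by (rule normal1_pair_chi_square_sqrt[OF C_minus_sets]) (use S K chi in \<open>simp_all add: C_tail_def D_def\<close>)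
  then have "m * \<bar>C_tail a1 b1 a b T - ?S\<bar> \<le> m * (K * sqrt ?S)" using m by (intro mult_left_mono)
  also have "\<dots> = K * sqrt m * sqrt (m * ?S)" using m by (simp add: real_sqrt_mult)
  also have "\<dots> \<le> K * sqrt (real n) * sqrt (m * ?S)"
    using m K S by (intro mult_right_mono mult_left_mono) auto
  also have "K * sqrt (real n) = 2 * h" using n by (simp add: K_def)
  finally show ?thesis .
qed

text \<open>By \<open>same\<close>, the sign \<open>e\<close> makes the projected means agree in
  sign for every index of \<open>D\<close>, so all indices share one exceedance probability. The
  Lipschitz constant of the null tail is \<open>1 / sqrt (r_hat n a b)\<close>, whence
  \<open>large\<close>.\<close>

lemma HC_stat_null:
  fixes z \<sigma> :: "nat \<Rightarrow> real" and \<theta> \<eta> v u :: vec and h a b e :: real and D J :: "nat set" and p q n :: nat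
  defines "M \<equiv> obs_law p q \<theta> \<eta> z \<sigma>" and "L \<equiv> ln (real n)"
  assumes n: "n \<ge> 2" and L: "L \<ge> 1" and h: "h \<ge> 1" "2 * h\<^sup>2 \<le> real n" "25 * h^3 \<le> L\<^sup>2"
    and large: "2 * L * (1 / sqrt (r_hat n a b)) * h^4 \<le> real n"
    and v: "vnorm p v \<noteq> 0" and u: "vnorm q u \<noteq> 0" and ab: "a > 0" "b > 0"
    and close: "\<bar>a - \<bar>proj p v \<theta>\<bar>\<bar> \<le> h / sqrt (real n)" "\<bar>b - \<bar>proj q u \<eta>\<bar>\<bar> \<le> h / sqrt (real n)"
    and J: "finite J" "D \<subseteq> J" and D: "D \<noteq> {}" "card D \<le> n"
    and e: "e = 1 \<or> e = -1" and signs: "\<And>i. i \<in> D \<Longrightarrow> (z i = 1 \<or> z i = -1) \<and> (\<sigma> i = 1 \<or> \<sigma> i = -1)"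
    and same: "\<And>i. i \<in> D \<Longrightarrow> z i * proj p v \<theta> * (e * \<sigma> i * proj q u \<eta>) > 0"
  shows "\<exists>B\<in>sets (PiM J M). measure (PiM J M) B \<le> 4 / (real n)\<^sup>2 + 6 / h \<and>
    (\<forall>w\<in>space (PiM J M) - B.
       HC_stat n (C_sgn e) D (\<lambda>i. proj p v (fst (w i))) (\<lambda>i. proj q u (snd (w i))) a b \<le> ereal (L^3))"
proof -
  define K where "K = sqrt (2 * L)"
  have K: "K > 0" using L by (simp add: K_def)
  define Z :: "nat \<Rightarrow> vec \<times> vec \<Rightarrow> real" where "Z = (\<lambda>i x. C_minus (proj p v (fst x)) (e * proj q u (snd x)) a b)"
  define S where "S = (\<lambda>t. S_tail n (r_hat n a b) (s_hat n a b) t)"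
  have S_eq: "S t = C_tail a b a b (t * K)" for t
    unfolding S_def S_tail_eq_C_tail[OF ab n] K_def L_def ..
  have r_pos: "r_hat n a b > 0" using ab n by (simp add: r_hat_def add_pos_pos)
  have fin: "finite D" using J finite_subset by blast
  have m: "real (card D) > 0" "real (card D) \<le> real n" using D fin by (auto simp: card_gt_0_iff)
  have S_pos: "S t > 0" for t unfolding S_eq by (rule C_tail_pos[OF ab])
  have "\<exists>B\<in>sets (PiM J M). measure (PiM J M) B \<le> 4 / (real n)\<^sup>2 + 6 / h \<and>
    (\<forall>w\<in>space (PiM J M) - B. \<forall>t. \<bar>t\<bar> \<le> ln (real n) \<longrightarrow>
       \<bar>(\<Sum>i\<in>D. of_bool (Z i (w i) > t * K)) - real (card D) * S t\<bar> \<le> ln (real n) ^ 3 * sqrt (real (card D) * S t))"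
  proof (rule null_count_process[where p = "\<lambda>t. C_tail \<bar>proj p v \<theta>\<bar> \<bar>proj q u \<eta>\<bar> a b (t * K)" and \<Lambda> = "1 / sqrt (r_hat n a b)"])
    show "prob_space (M i)" for i unfolding M_def by (rule prob_space_obs_law)
    show "Z i \<in> borel_measurable (M i)" for i
      unfolding Z_def M_def by (rule obs_C_minus_tail(1)[OF v u e])
    show "measure (M i) {x \<in> space (M i). Z i x > t * K} = C_tail \<bar>proj p v \<theta>\<bar> \<bar>proj q u \<eta>\<bar> a b (t * K)" if i: "i \<in> D" for i t
    proof -
      have "e * \<sigma> i = 1 \<or> e * \<sigma> i = -1" using e signs[OF i] by auto
      then show ?thesis
        unfolding Z_def M_def obs_C_minus_tail(2)[OF v u e] using signs[OF i] same[OF i] by (intro C_tail_abs(1)) auto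
    qed
    show "S t' \<le> S t" if "t \<le> t'" for t t' unfolding S_def by (rule S_tail_antimono[OF that])
    show "S t - S t' \<le> 1 / sqrt (r_hat n a b) * (t' - t)" if "t \<le> t'" for t t'
      using S_tail_Lipschitz[OF r_pos that] unfolding S_def by simp
    show "real (card D) * \<bar>C_tail \<bar>proj p v \<theta>\<bar> \<bar>proj q u \<eta>\<bar> a b (t * K) - S t\<bar> \<le> 2 * h * sqrt (real (card D) * S t)" for t
      unfolding S_eq by (rule C_tail_bias[OF ab _ h(1,2) _ _ close]) (use n m in auto)
    show "2 * ln (real n) * (1 / sqrt (r_hat n a b)) * h ^ 4 \<le> real n" using large by (simp add: L_def)
    show "25 * h ^ 3 \<le> (ln (real n))\<^sup>2" using h by (simp add: L_def)
    show "ln (real n) \<ge> 1" using L by (simp add: L_def)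
    show "0 \<le> 1 / sqrt (r_hat n a b)" using r_pos by simp
  qed (use J D n K h S_pos in auto)
  then obtain B where B: "B \<in> sets (PiM J M)" "measure (PiM J M) B \<le> 4 / (real n)\<^sup>2 + 6 / h"
    and dev: "\<And>w t. w \<in> space (PiM J M) - B \<Longrightarrow> \<bar>t\<bar> \<le> ln (real n) \<Longrightarrow>
       \<bar>(\<Sum>i\<in>D. of_bool (Z i (w i) > t * K)) - real (card D) * S t\<bar> \<le> ln (real n) ^ 3 * sqrt (real (card D) * S t)"
    by blast
  have "HC_stat n (C_sgn e) D (\<lambda>i. proj p v (fst (w i))) (\<lambda>i. proj q u (snd (w i))) a b \<le> ereal (L^3)"
    if w: "w \<in> space (PiM J M) - B" for w
  proof (rule HC_stat_le)
    fix t :: real assume t: "\<bar>t\<bar> \<le> ln (real n)"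
    show "\<bar>(\<Sum>i\<in>D. of_bool (t * sqrt (2 * ln (real n)) < C_sgn e (proj p v (fst (w i))) (proj q u (snd (w i))) a b)) -
          real (card D) * S_tail n (r_hat n a b) (s_hat n a b) t\<bar>
         \<le> L ^ 3 * sqrt (real (card D) * S_tail n (r_hat n a b) (s_hat n a b) t)"
      using dev[OF w t] unfolding C_sgn_eq[OF e] Z_def S_def K_def L_def .
    show "0 < real (card D) * S_tail n (r_hat n a b) (s_hat n a b) t" using m S_pos[of t] by (simp add: S_def)
  qed
  then show ?thesis using B by (intro bexI[of _ B]) auto
qed

text \<open>\<open>\<tau>\<close> is measured in units of \<open>K\<close>: the argument of the
  statistic is \<open>t = \<tau> * K\<close>, and the observations are compared with
  \<open>t * K\<close> in turn, hence the second \<open>K\<close> in \<open>p1\<close>.\<close>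

lemma HC_stat_alternative:
  fixes z \<sigma> :: "nat \<Rightarrow> real" and \<theta> \<eta> v u :: vec and h a b e \<tau> :: real and D J H :: "nat set" and p q n :: nat
  defines "M \<equiv> obs_law p q \<theta> \<eta> z \<sigma>" and "L \<equiv> ln (real n)" and "K \<equiv> sqrt (2 * ln (real n))"
  defines "S \<equiv> S_tail n (r_hat n a b) (s_hat n a b) (\<tau> * K)"
    and "p1 \<equiv> C_tail \<bar>proj p v \<theta>\<bar> (- \<bar>proj q u \<eta>\<bar>) a b (\<tau> * K * K)"
  assumes n: "n \<ge> 2" and h: "h \<ge> 1" "2 * h\<^sup>2 \<le> real n"
    and v: "vnorm p v \<noteq> 0" and u: "vnorm q u \<noteq> 0" and ab: "a > 0" "b > 0"
    and close: "\<bar>a - \<bar>proj p v \<theta>\<bar>\<bar> \<le> h / sqrt (real n)" "\<bar>b - \<bar>proj q u \<eta>\<bar>\<bar> \<le> h / sqrt (real n)"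
    and J: "finite J" "D \<subseteq> J" and D: "D \<noteq> {}" "card D \<le> n" and H: "H \<subseteq> D"
    and e: "e = 1 \<or> e = -1" and signs: "\<And>i. i \<in> D \<Longrightarrow> (z i = 1 \<or> z i = -1) \<and> (\<sigma> i = 1 \<or> \<sigma> i = -1)"
    and same: "\<And>i. i \<in> D - H \<Longrightarrow> z i * proj p v \<theta> * (e * \<sigma> i * proj q u \<eta>) > 0"
    and opp: "\<And>i. i \<in> H \<Longrightarrow> z i * proj p v \<theta> * (e * \<sigma> i * proj q u \<eta>) < 0"
    and t: "\<bar>\<tau> * K\<bar> \<le> L" and ratio: "S \<le> p1 / 2"
    and W1: "real (card H) * p1 \<ge> 64 * h\<^sup>2" and W2: "real (card H) * p1 > 4 * (L^3 + 3 * h) * sqrt (real (card D) * S)"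
  shows "\<exists>B\<in>sets (PiM J M). measure (PiM J M) B \<le> 1 / h\<^sup>2 \<and>
    (\<forall>w\<in>space (PiM J M) - B.
       HC_stat n (C_sgn e) D (\<lambda>i. proj p v (fst (w i))) (\<lambda>i. proj q u (snd (w i))) a b > ereal (L^3))"
proof -
  define Z :: "nat \<Rightarrow> vec \<times> vec \<Rightarrow> real" where "Z = (\<lambda>i x. C_minus (proj p v (fst x)) (e * proj q u (snd x)) a b)"
  have S_eq: "S = C_tail a b a b (\<tau> * K * K)"
    unfolding S_def S_tail_eq_C_tail[OF ab n] K_def ..
  have fin: "finite D" using J finite_subset by blast
  have m: "real (card D) > 0" "real (card D) \<le> real n" using D fin by (auto simp: card_gt_0_iff)
  have S_pos: "S > 0" unfolding S_eq by (rule C_tail_pos[OF ab])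
  have L: "L \<ge> 0" using n by (simp add: L_def)
  have es: "e * \<sigma> i = 1 \<or> e * \<sigma> i = -1" if "i \<in> D" for i using e signs[OF that] by auto
  have "\<exists>B\<in>sets (PiM J M). measure (PiM J M) B \<le> 1 / h\<^sup>2 \<and>
    (\<forall>w\<in>space (PiM J M) - B. (\<Sum>i\<in>D. of_bool (Z i (w i) > \<tau> * K * K)) - real (card D) * S > L^3 * sqrt (real (card D) * S))"
  proof (rule alternative_count_large[where ?p1.0 = p1 and ?p0.0 = "C_tail \<bar>proj p v \<theta>\<bar> \<bar>proj q u \<eta>\<bar> a b (\<tau> * K * K)"])
    show "prob_space (M i)" for i unfolding M_def by (rule prob_space_obs_law)
    show "Z i \<in> borel_measurable (M i)" for i
      unfolding Z_def M_def by (rule obs_C_minus_tail(1)[OF v u e])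
    show "measure (M i) {x \<in> space (M i). Z i x > \<tau> * K * K} = p1" if i: "i \<in> H" for i
    proof -
      have i': "i \<in> D" using i H by auto
      show ?thesis
        unfolding Z_def M_def obs_C_minus_tail(2)[OF v u e] p1_def using signs[OF i'] opp[OF i] es[OF i'] by (intro C_tail_abs(2)) auto
    qed
    show "measure (M i) {x \<in> space (M i). Z i x > \<tau> * K * K} = C_tail \<bar>proj p v \<theta>\<bar> \<bar>proj q u \<eta>\<bar> a b (\<tau> * K * K)" if i: "i \<in> D - H" for i
    proof -
      have i': "i \<in> D" using i by auto
      show ?thesis
        unfolding Z_def M_def obs_C_minus_tail(2)[OF v u e] using signs[OF i'] same[OF i] es[OF i'] by (intro C_tail_abs(1)) auto
    qed
    show "0 \<le> C_tail \<bar>proj p v \<theta>\<bar> \<bar>proj q u \<eta>\<bar> a b (\<tau> * K * K)" by (simp add: C_tail_def)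
    show "real (card D) * \<bar>C_tail \<bar>proj p v \<theta>\<bar> \<bar>proj q u \<eta>\<bar> a b (\<tau> * K * K) - S\<bar> \<le> 2 * h * sqrt (real (card D) * S)"
      unfolding S_eq by (rule C_tail_bias[OF ab _ h(1,2) _ _ close]) (use n m in auto)
    show "0 \<le> L^3" using L by simp
  qed (use J H h S_pos ratio W1 W2 in auto)
  then obtain B where B: "B \<in> sets (PiM J M)" "measure (PiM J M) B \<le> 1 / h\<^sup>2"
    and dev: "\<And>w. w \<in> space (PiM J M) - B \<Longrightarrow>
       (\<Sum>i\<in>D. of_bool (Z i (w i) > \<tau> * K * K)) - real (card D) * S > L^3 * sqrt (real (card D) * S)"
    by blast
  have "HC_stat n (C_sgn e) D (\<lambda>i. proj p v (fst (w i))) (\<lambda>i. proj q u (snd (w i))) a b > ereal (L^3)"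
    if w: "w \<in> space (PiM J M) - B" for w
  proof (rule HC_stat_gt[where t = "\<tau> * K"])
    show "\<bar>\<tau> * K\<bar> \<le> ln (real n)" using t by (simp add: L_def)
    show "L ^ 3 * sqrt (real (card D) * S_tail n (r_hat n a b) (s_hat n a b) (\<tau> * K))
      < (\<Sum>i\<in>D. of_bool (\<tau> * K * sqrt (2 * ln (real n)) < C_sgn e (proj p v (fst (w i))) (proj q u (snd (w i))) a b)) -
         real (card D) * S_tail n (r_hat n a b) (s_hat n a b) (\<tau> * K)"
      using dev[OF w] unfolding C_sgn_eq[OF e] Z_def S_def K_def .
    show "0 < real (card D) * S_tail n (r_hat n a b) (s_hat n a b) (\<tau> * K)" using m S_pos by (simp add: S_def)
  qed
  then show ?thesis using B by (intro bexI[of _ B]) auto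
qed

text \<open>The lower bound integrates the Gaussian density over a box around the witness point.\<close>

lemma C_tail_box_lower:
  fixes K L :: real
  assumes K: "K > 0" "K\<^sup>2 = 2 * L" "2 * K * \<rho> \<ge> sqrt (2 * pi)" and \<rho>: "\<rho> > 0"
    and box: "\<And>x' y'. \<bar>x' - x\<bar> \<le> \<rho> \<Longrightarrow> \<bar>y' - y\<bar> \<le> \<rho> \<Longrightarrow> \<tau> < C_minus x' y' (a / K) (b / K)"
    and cost: "(\<bar>x - a1 / K\<bar> + \<rho>)\<^sup>2 + (\<bar>y + b1 / K\<bar> + \<rho>)\<^sup>2 \<le> E1" and L: "L \<ge> 0"
  shows "exp (- E1 * L) \<le> C_tail a1 (- b1) a b (\<tau> * K * K)"
proof -
  \<comment> \<open>The half-width \<open>K * \<rho>\<close> is large enough for the length of the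
    interval to make up for the density constant \<open>1 / sqrt (2 * pi)\<close>, so the bound is a
    pure exponential.\<close>
  have one: "exp (- ((\<bar>c - m / K\<bar> + \<rho>)\<^sup>2 * L)) \<le> measure (normal1 m) {K * c - K * \<rho>..K * c + K * \<rho>}" for c m
  proof -
    have "1 \<le> 2 * (K * \<rho>) / sqrt (2 * pi)" using K(3) by (simp add: le_divide_eq mult.assoc)
    moreover have "(\<bar>K * c - m\<bar> + K * \<rho>)\<^sup>2 / 2 = (\<bar>c - m / K\<bar> + \<rho>)\<^sup>2 * L"
    proof -
      have "K * c - m = K * (c - m / K)" using K by (simp add: right_diff_distrib)
      then have "\<bar>K * c - m\<bar> + K * \<rho> = K * (\<bar>c - m / K\<bar> + \<rho>)" using K by (simp add: abs_mult distrib_left)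
      then show ?thesis using K(2) by (simp add: power_mult_distrib)
    qed
    ultimately have "exp (- ((\<bar>c - m / K\<bar> + \<rho>)\<^sup>2 * L)) \<le> 2 * (K * \<rho>) / sqrt (2 * pi) * exp (- ((\<bar>K * c - m\<bar> + K * \<rho>)\<^sup>2 / 2))"
      using mult_right_mono[of 1 "2 * (K * \<rho>) / sqrt (2 * pi)" "exp (- ((\<bar>K * c - m\<bar> + K * \<rho>)\<^sup>2 / 2))"] by simp
    also have "\<dots> \<le> measure (normal1 m) {K * c - K * \<rho>..K * c + K * \<rho>}"
      using K \<rho> by (intro normal1_interval_ge) auto
    finally show ?thesis .
  qed
  have scale: "\<bar>x' / K - c\<bar> \<le> \<rho>" if "x' \<in> {K * c - K * \<rho>..K * c + K * \<rho>}" for x' c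
  proof -
    have "\<bar>x' - K * c\<bar> \<le> K * \<rho>" using that by auto
    moreover have "x' / K - c = (x' - K * c) / K" using K by (simp add: field_simps)
    ultimately show ?thesis using K by (simp add: abs_divide divide_le_eq mult.commute)
  qed
  have "{K * x - K * \<rho>..K * x + K * \<rho>} \<times> {K * y - K * \<rho>..K * y + K * \<rho>} \<subseteq> {(x, y). C_minus x y a b > \<tau> * K * K}"
  proof safe
    fix x' y' assume xy: "x' \<in> {K * x - K * \<rho>..K * x + K * \<rho>}" "y' \<in> {K * y - K * \<rho>..K * y + K * \<rho>}"
    have "\<tau> < C_minus (x' / K) (y' / K) (a / K) (b / K)" by (rule box[OF scale[OF xy(1)] scale[OF xy(2)]])
    also have "C_minus (x' / K) (y' / K) (a / K) (b / K) = C_minus x' y' a b / (K * K)"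
    proof -
      have "\<bar>a / K * (x' / K) - b / K * (y' / K)\<bar> = \<bar>a * x' - b * y'\<bar> / (K * K)"
        unfolding times_divide_times_eq diff_divide_distrib[symmetric] abs_divide using K by simp
      moreover have "\<bar>a / K * (x' / K) + b / K * (y' / K)\<bar> = \<bar>a * x' + b * y'\<bar> / (K * K)"
        unfolding times_divide_times_eq add_divide_distrib[symmetric] abs_divide using K by simp
      ultimately show ?thesis by (simp only: C_minus_def diff_divide_distrib)
    qed
    finally show "\<tau> * K * K < C_minus x' y' a b" using K by (simp add: less_divide_eq mult.assoc)
  qed
  then have "measure (normal1 a1) {K * x - K * \<rho>..K * x + K * \<rho>} * measure (normal1 (- b1)) {K * y - K * \<rho>..K * y + K * \<rho>}
     \<le> C_tail a1 (- b1) a b (\<tau> * K * K)"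
    unfolding C_tail_def by (intro normal1_pair_box_le C_minus_sets) auto
  moreover have "exp (- E1 * L) \<le> exp (- ((\<bar>x - a1 / K\<bar> + \<rho>)\<^sup>2 * L)) * exp (- ((\<bar>y - (- b1) / K\<bar> + \<rho>)\<^sup>2 * L))"
  proof -
    have "((\<bar>x - a1 / K\<bar> + \<rho>)\<^sup>2 + (\<bar>y + b1 / K\<bar> + \<rho>)\<^sup>2) * L \<le> E1 * L" using cost L by (intro mult_right_mono)
    then show ?thesis by (simp add: exp_add[symmetric] distrib_right)
  qed
  moreover have "\<dots> \<le> measure (normal1 a1) {K * x - K * \<rho>..K * x + K * \<rho>} * measure (normal1 (- b1)) {K * y - K * \<rho>..K * y + K * \<rho>}"
    using one[of x a1] one[of y "- b1"] by (intro mult_mono) auto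
  ultimately show ?thesis by linarith
qed

text \<open>In the scaled variables \<open>a / K\<close> and \<open>b / K\<close> the plug-in
  parameters are fixed functions free of \<open>n\<close>, namely \<open>R\<close> and
  \<open>S\<close> of \<open>beta_star_witness_robust\<close>.\<close>

lemma r_hat_s_hat_scale:
  assumes n: "n \<ge> 2" and K: "K = sqrt (2 * ln (real n))"
  shows "r_hat n a b = (2 * (a / K) * (b / K))\<^sup>2 / ((a / K)\<^sup>2 + (b / K)\<^sup>2)"
    and "s_hat n a b = ((a / K)\<^sup>2 - (b / K)\<^sup>2)\<^sup>2 / ((a / K)\<^sup>2 + (b / K)\<^sup>2)"
proof -
  have K0: "K > 0" "2 * ln (real n) = K\<^sup>2" using n by (auto simp: K)
  have den: "(a / K)\<^sup>2 + (b / K)\<^sup>2 = (a\<^sup>2 + b\<^sup>2) / K\<^sup>2" by (simp add: power_divide add_divide_distrib)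
  have "(2 * \<bar>a\<bar> * \<bar>b\<bar>)\<^sup>2 = (2 * a * b)\<^sup>2" by (simp add: power_mult_distrib)
  moreover have "2 * (a / K) * (b / K) = 2 * a * b / K\<^sup>2" by (simp add: power2_eq_square)
  ultimately show "r_hat n a b = (2 * (a / K) * (b / K))\<^sup>2 / ((a / K)\<^sup>2 + (b / K)\<^sup>2)"
    unfolding r_hat_def den K0(2) using K0(1) by (simp add: power_divide power2_eq_square)
  have "(a / K)\<^sup>2 - (b / K)\<^sup>2 = (a\<^sup>2 - b\<^sup>2) / K\<^sup>2" by (simp add: power_divide diff_divide_distrib)
  then show "s_hat n a b = ((a / K)\<^sup>2 - (b / K)\<^sup>2)\<^sup>2 / ((a / K)\<^sup>2 + (b / K)\<^sup>2)"
    unfolding s_hat_def den K0(2) using K0(1) by (simp add: power_divide power2_eq_square)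
qed

subsection \<open>Conditioning on the subsamples\<close>

text \<open>The integral is folded in the order of the subsamples; each stage is charged the
  probability of its exceptional set, and off all three the integrand vanishes. \<open>B1\<close>
  and \<open>B2\<close> may depend arbitrarily on the earlier coordinates, since each is used only
  inside an inner integral.\<close>

lemma three_stage_bound:
  fixes f :: "('i \<Rightarrow> 'a) \<Rightarrow> ennreal"
  assumes M: "\<And>i. prob_space (M i)" and fin: "finite I0" "finite I1" "finite J"
    and disj: "I0 \<inter> I1 = {}" "I0 \<inter> J = {}" "I1 \<inter> J = {}"
    and f: "f \<in> borel_measurable (PiM (I0 \<union> (I1 \<union> J)) M)" and f1: "\<And>w. f w \<le> 1"
    and B0: "B0 \<in> sets (PiM I0 M)"
    and stage: "\<And>w0. w0 \<in> space (PiM I0 M) - B0 \<Longrightarrow> \<exists>B1\<in>sets (PiM I1 M). measure (PiM I1 M) B1 \<le> d1 \<and>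
      (\<forall>w1\<in>space (PiM I1 M) - B1. \<exists>B2\<in>sets (PiM J M). measure (PiM J M) B2 \<le> d2 \<and>
        (\<forall>w2\<in>space (PiM J M) - B2. f (merge I0 (I1 \<union> J) (w0, merge I1 J (w1, w2))) = 0))"
  shows "(\<integral>\<^sup>+w. f w \<partial>PiM (I0 \<union> (I1 \<union> J)) M) \<le> emeasure (PiM I0 M) B0 + (ennreal d1 + ennreal d2)"
proof -
  interpret Mk: prob_space "M k" for k by (rule M)
  interpret product_prob_space M "I0 \<union> (I1 \<union> J)" ..
  have P: "prob_space (PiM I M)" for I by (rule prob_space_PiM) (rule M)
  have "(\<integral>\<^sup>+w. f w \<partial>PiM (I0 \<union> (I1 \<union> J)) M) = (\<integral>\<^sup>+w0. \<integral>\<^sup>+w'. f (merge I0 (I1 \<union> J) (w0, w')) \<partial>PiM (I1 \<union> J) M \<partial>PiM I0 M)"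
    using disj fin f by (intro product_nn_integral_fold) auto
  also have "\<dots> \<le> emeasure (PiM I0 M) B0 + (ennreal d1 + ennreal d2)"
  proof (rule prob_space.nn_integral_le_bad[OF P B0])
    fix w0 assume w0: "w0 \<in> space (PiM I0 M)"
    have "(\<integral>\<^sup>+w'. f (merge I0 (I1 \<union> J) (w0, w')) \<partial>PiM (I1 \<union> J) M) \<le> (\<integral>\<^sup>+w'. 1 \<partial>PiM (I1 \<union> J) M)"
      by (intro nn_integral_mono f1)
    also have "\<dots> = 1" using prob_space.emeasure_space_1[OF P] by simp
    finally show "(\<integral>\<^sup>+w'. f (merge I0 (I1 \<union> J) (w0, w')) \<partial>PiM (I1 \<union> J) M) \<le> 1" .
    assume "w0 \<notin> B0"
    then obtain B1 where B1: "B1 \<in> sets (PiM I1 M)" "measure (PiM I1 M) B1 \<le> d1"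
      and stage1: "\<And>w1. w1 \<in> space (PiM I1 M) - B1 \<Longrightarrow> \<exists>B2\<in>sets (PiM J M). measure (PiM J M) B2 \<le> d2 \<and>
        (\<forall>w2\<in>space (PiM J M) - B2. f (merge I0 (I1 \<union> J) (w0, merge I1 J (w1, w2))) = 0)"
      using stage[of w0] w0 by blast
    have fm: "(\<lambda>w'. f (merge I0 (I1 \<union> J) (w0, w'))) \<in> borel_measurable (PiM (I1 \<union> J) M)"
      using measurable_compose[OF measurable_Pair1' [OF w0] measurable_compose[OF measurable_merge f]] by simp
    have "(\<integral>\<^sup>+w'. f (merge I0 (I1 \<union> J) (w0, w')) \<partial>PiM (I1 \<union> J) M)
      = (\<integral>\<^sup>+w1. \<integral>\<^sup>+w2. f (merge I0 (I1 \<union> J) (w0, merge I1 J (w1, w2))) \<partial>PiM J M \<partial>PiM I1 M)"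
      using disj fin fm by (intro product_nn_integral_fold) auto
    also have "\<dots> \<le> emeasure (PiM I1 M) B1 + ennreal d2"
    proof (rule prob_space.nn_integral_le_bad[OF P B1(1)])
      fix w1 assume w1: "w1 \<in> space (PiM I1 M)"
      have "(\<integral>\<^sup>+w2. f (merge I0 (I1 \<union> J) (w0, merge I1 J (w1, w2))) \<partial>PiM J M) \<le> (\<integral>\<^sup>+w'. 1 \<partial>PiM J M)"
        by (intro nn_integral_mono f1)
      also have "\<dots> = 1" using prob_space.emeasure_space_1[OF P] by simp
      finally show "(\<integral>\<^sup>+w2. f (merge I0 (I1 \<union> J) (w0, merge I1 J (w1, w2))) \<partial>PiM J M) \<le> 1" .
      assume "w1 \<notin> B1"
      then obtain B2 where B2: "B2 \<in> sets (PiM J M)" "measure (PiM J M) B2 \<le> d2"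
        "\<And>w2. w2 \<in> space (PiM J M) - B2 \<Longrightarrow> f (merge I0 (I1 \<union> J) (w0, merge I1 J (w1, w2))) = 0"
        using stage1[of w1] w1 by blast
      have "(\<integral>\<^sup>+w2. f (merge I0 (I1 \<union> J) (w0, merge I1 J (w1, w2))) \<partial>PiM J M) \<le> emeasure (PiM J M) B2 + 0"
        using B2(3) by (intro prob_space.nn_integral_le_bad[OF P B2(1)] f1) auto
      also have "\<dots> \<le> ennreal d2" using emeasure_to_measure_bound[OF P B2(2)] by simp
      finally show "(\<integral>\<^sup>+w2. f (merge I0 (I1 \<union> J) (w0, merge I1 J (w1, w2))) \<partial>PiM J M) \<le> ennreal d2" .
    qed
    also have "\<dots> \<le> ennreal d1 + ennreal d2"
      using emeasure_to_measure_bound[OF P B1(2)] by (intro add_right_mono)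
    finally show "(\<integral>\<^sup>+w'. f (merge I0 (I1 \<union> J) (w0, w')) \<partial>PiM (I1 \<union> J) M) \<le> ennreal d1 + ennreal d2" .
  qed
  finally show ?thesis .
qed

section \<open>Disintegration along the random split\<close>

lemma law_eq: "law n p q \<theta> \<eta> z \<sigma> = PiM {1..n} (obs_law p q \<theta> \<eta> z \<sigma>) \<Otimes>\<^sub>M split_law n"
  unfolding law_def split_law_def obs_law_def by simp

lemma loss_measurable: "(\<lambda>v. loss p v \<theta>) \<in> borel_measurable (vec_space p)"
proof -
  have "(\<lambda>v. v j) \<in> borel_measurable (vec_space p)" if "j \<in> {1..p}" for j
    unfolding vec_space_def using that by (rule measurable_component_singleton)
  then show ?thesis
    unfolding loss_def vnorm_def L2_set_def
    by (intro borel_measurable_min borel_measurable_sqrt borel_measurable_sum borel_measurable_power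
        borel_measurable_diff borel_measurable_add borel_measurable_const measurable_compose[OF _ borel_measurable_sqrt]) auto
qed

text \<open>An event over the coordinates in \<open>I\<close> alone, so that it can serve as the
  first exceptional set once the split is fixed.\<close>

definition bad_estimates :: "nat \<Rightarrow> nat \<Rightarrow> algorithm \<Rightarrow> algorithm \<Rightarrow> vec \<Rightarrow> vec \<Rightarrow> real \<Rightarrow> (nat \<Rightarrow> vec \<times> vec) measure \<Rightarrow> nat set \<Rightarrow> (nat \<Rightarrow> vec \<times> vec) set" where
  "bad_estimates p q thalg etalg \<theta> \<eta> g N I = {w \<in> space N. max (loss p (thalg I w) \<theta>) (loss q (etalg I w) \<eta>) > g}"

lemma bad_estimates_sets:
  assumes alg: "measurable_algorithm n p q p thalg" "measurable_algorithm n p q q etalg" and I: "I \<subseteq> {1..n}"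
  shows "bad_estimates p q thalg etalg \<theta> \<eta> g (PiM I (obs_law p q \<theta> \<eta> z \<sigma>)) I \<in> sets (PiM I (obs_law p q \<theta> \<eta> z \<sigma>))"
proof -
  let ?N = "PiM I (obs_law p q \<theta> \<eta> z \<sigma>)"
  have "sets ?N = sets (PiM I (\<lambda>_. vec_space p \<Otimes>\<^sub>M vec_space q))"
    by (intro sets_PiM_cong refl sets_obs_law)
  then have "thalg I \<in> ?N \<rightarrow>\<^sub>M vec_space p" "etalg I \<in> ?N \<rightarrow>\<^sub>M vec_space q"
    using alg I unfolding measurable_algorithm_def by (auto cong: measurable_cong_sets)
  then have "(\<lambda>w. loss p (thalg I w) \<theta>) \<in> borel_measurable ?N" "(\<lambda>w. loss q (etalg I w) \<eta>) \<in> borel_measurable ?N"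
    by (auto intro: measurable_compose[OF _ loss_measurable])
  then show ?thesis unfolding bad_estimates_def by measurable
qed

lemma split_class_sets:
  assumes S: "S \<subseteq> {1..n}"
  shows "{d \<in> space (split_law n). {i\<in>{1..n}. d i = m} = S} \<in> sets (split_law n)"
proof -
  have "({i\<in>{1..n}. d i = m} = S) \<longleftrightarrow> (\<forall>i\<in>{1..n}. (d i = m) = (i \<in> S))" for d
    using S by blast
  moreover have "{d \<in> space (split_law n). \<forall>i\<in>{1..n}. (d i = m) = (i \<in> S)} \<in> sets (split_law n)"
  proof (rule sets.sets_Collect_finite_All)
    fix i assume i: "i \<in> {1..n}"
    have "(\<lambda>d. d i) \<in> split_law n \<rightarrow>\<^sub>M count_space UNIV"
      unfolding split_law_def using measurable_component_singleton[OF i, of "\<lambda>_. measure_pmf (pmf_of_set {0, 1, 2 :: nat})"]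
      by (simp add: measurable_def)
    from measurable_sets[OF this, of "{k. (k = m) = (i \<in> S)}"]
    show "{d \<in> space (split_law n). (d i = m) = (i \<in> S)} \<in> sets (split_law n)"
      by (simp add: vimage_def Int_def conj_commute)
  qed simp
  ultimately show ?thesis by simp
qed

text \<open>Given the split, the estimators read only the coordinates of the first subsample;
  averaging the conditional failure probabilities over the split returns the probability that the
  theorem assumes to vanish.\<close>

lemma bad_estimates_law:
  fixes n p q :: nat and \<theta> \<eta> :: vec and z \<sigma> :: "nat \<Rightarrow> real"
  assumes alg: "measurable_algorithm n p q p thalg" "measurable_algorithm n p q q etalg"
  defines "N \<equiv> law n p q \<theta> \<eta> z \<sigma>" and "M \<equiv> obs_law p q \<theta> \<eta> z \<sigma>"
  shows "(\<integral>\<^sup>+d. emeasure (PiM {i\<in>{1..n}. d i = 0} M) (bad_estimates p q thalg etalg \<theta> \<eta> g (PiM {i\<in>{1..n}. d i = 0} M) {i\<in>{1..n}. d i = 0}) \<partial>split_law n)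
    = emeasure N {\<omega> \<in> space N. max (loss p (estimate n thalg \<omega>) \<theta>) (loss q (estimate n etalg \<omega>) \<eta>) > g}"
proof -
  interpret Mk: prob_space "M k" for k unfolding M_def by (rule prob_space_obs_law)
  interpret product_prob_space M "{1..n}" ..
  interpret D: prob_space "split_law n" by (rule prob_space_split_law)
  interpret PD: pair_prob_space "PiM {1..n} M" "split_law n" ..
  define I where "I = (\<lambda>d :: nat \<Rightarrow> nat. {i\<in>{1..n}. d i = 0})"
  define B where "B = (\<lambda>I. bad_estimates p q thalg etalg \<theta> \<eta> g (PiM I M) I)"
  let ?A = "{\<omega> \<in> space N. max (loss p (estimate n thalg \<omega>) \<theta>) (loss q (estimate n etalg \<omega>) \<eta>) > g}"
  have N: "N = PiM {1..n} M \<Otimes>\<^sub>M split_law n" unfolding N_def M_def by (rule law_eq)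
  have B_sets: "B I \<in> sets (PiM I M)" if "I \<subseteq> {1..n}" for I
    unfolding B_def M_def using bad_estimates_sets[OF alg that] .
  have emb: "{w \<in> space (PiM {1..n} M). restrict w I \<in> B I} \<in> sets (PiM {1..n} M)"
    "emeasure (PiM {1..n} M) {w \<in> space (PiM {1..n} M). restrict w I \<in> B I} = emeasure (PiM I M) (B I)" if "I \<subseteq> {1..n}" for I
  proof -
    have r: "(\<lambda>w. restrict w I) \<in> PiM {1..n} M \<rightarrow>\<^sub>M PiM I M" using that by (rule measurable_restrict_subset)
    have eq: "{w \<in> space (PiM {1..n} M). restrict w I \<in> B I} = (\<lambda>w. restrict w I) -` B I \<inter> space (PiM {1..n} M)" by auto
    show "{w \<in> space (PiM {1..n} M). restrict w I \<in> B I} \<in> sets (PiM {1..n} M)"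
      unfolding eq by (rule measurable_sets[OF r B_sets[OF that]])
    show "emeasure (PiM {1..n} M) {w \<in> space (PiM {1..n} M). restrict w I \<in> B I} = emeasure (PiM I M) (B I)"
      using emeasure_distr[OF r B_sets[OF that]] unfolding eq distr_restrict[OF that finite_atLeastAtMost, symmetric] by (rule sym)
  qed
  have sect: "(w, d) \<in> ?A \<longleftrightarrow> w \<in> space (PiM {1..n} M) \<and> d \<in> space (split_law n) \<and> restrict w (I d) \<in> B (I d)" for w d
  proof -
    have "restrict w (I d) \<in> space (PiM (I d) M)" if "w \<in> space (PiM {1..n} M)"
      using that by (auto simp: space_PiM I_def)
    then show ?thesis
      by (auto simp: N space_pair_measure B_def bad_estimates_def estimate_def subsample_def I_def)
  qed
  \<comment> \<open>A finite union of rectangles, one for each possible first subsample.\<close>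
  have A_sets: "?A \<in> sets (PiM {1..n} M \<Otimes>\<^sub>M split_law n)"
  proof -
    have "{d \<in> space (split_law n). I d = S} \<in> sets (split_law n)" if "S \<subseteq> {1..n}" for S
      unfolding I_def by (rule split_class_sets[OF that])
    then have "(\<Union>S\<in>Pow {1..n}. {w \<in> space (PiM {1..n} M). restrict w S \<in> B S} \<times> {d \<in> space (split_law n). I d = S}) \<in> sets (PiM {1..n} M \<Otimes>\<^sub>M split_law n)"
      using emb by (intro sets.finite_UN pair_measureI) auto
    also have "(\<Union>S\<in>Pow {1..n}. {w \<in> space (PiM {1..n} M). restrict w S \<in> B S} \<times> {d \<in> space (split_law n). I d = S}) = ?A"
    proof (rule set_eqI)
      fix \<omega> :: "(nat \<Rightarrow> vec \<times> vec) \<times> (nat \<Rightarrow> nat)"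
      obtain w d where \<omega>: "\<omega> = (w, d)" by (cases \<omega>)
      have "I d \<subseteq> {1..n}" by (auto simp: I_def)
      then show "\<omega> \<in> (\<Union>S\<in>Pow {1..n}. {w \<in> space (PiM {1..n} M). restrict w S \<in> B S} \<times> {d \<in> space (split_law n). I d = S}) \<longleftrightarrow> \<omega> \<in> ?A"
        unfolding \<omega> sect by blast
    qed
    finally show ?thesis .
  qed
  have "emeasure N ?A = (\<integral>\<^sup>+d. emeasure (PiM {1..n} M) ((\<lambda>w. (w, d)) -` ?A) \<partial>split_law n)"
    using PD.emeasure_pair_measure_alt2[OF A_sets] unfolding N .
  also have "\<dots> = (\<integral>\<^sup>+d. emeasure (PiM (I d) M) (B (I d)) \<partial>split_law n)"
  proof (intro nn_integral_cong)
    fix d assume "d \<in> space (split_law n)"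
    then have sec: "(\<lambda>w. (w, d)) -` ?A = {w \<in> space (PiM {1..n} M). restrict w (I d) \<in> B (I d)}"
      using sect by auto
    have "I d \<subseteq> {1..n}" by (auto simp: I_def)
    then show "emeasure (PiM {1..n} M) ((\<lambda>w. (w, d)) -` ?A) = emeasure (PiM (I d) M) (B (I d))"
      unfolding sec by (rule emb(2))
  qed
  finally show ?thesis unfolding B_def I_def by simp
qed

text \<open>If the test is not measurable, its Bochner integral is 0 and there is nothing to show;
  otherwise Fubini's theorem applies.\<close>

lemma split_expectation_bound:
  fixes n p q :: nat and \<theta> \<eta> :: vec and z \<sigma> :: "nat \<Rightarrow> real" and f :: "sample \<Rightarrow> real"
  assumes alg: "measurable_algorithm n p q p thalg" "measurable_algorithm n p q q etalg"
  defines "N \<equiv> law n p q \<theta> \<eta> z \<sigma>" and "M \<equiv> obs_law p q \<theta> \<eta> z \<sigma>"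
  assumes f: "\<And>\<omega>. 0 \<le> f \<omega>" "\<And>\<omega>. f \<omega> \<le> 1"
    and Bd: "Bd \<in> sets (split_law n)" "measure (split_law n) Bd \<le> cd" and pos: "0 \<le> c"
    and cond: "\<And>d. d \<in> space (split_law n) - Bd \<Longrightarrow> (\<lambda>w. f (w, d)) \<in> borel_measurable (PiM {1..n} M) \<Longrightarrow>
      (\<integral>\<^sup>+w. ennreal (f (w, d)) \<partial>PiM {1..n} M) \<le>
        emeasure (PiM {i\<in>{1..n}. d i = 0} M) (bad_estimates p q thalg etalg \<theta> \<eta> g (PiM {i\<in>{1..n}. d i = 0} M) {i\<in>{1..n}. d i = 0}) + ennreal c"
  shows "(\<integral>\<omega>. f \<omega> \<partial>N) \<le> cd + measure N {\<omega> \<in> space N. max (loss p (estimate n thalg \<omega>) \<theta>) (loss q (estimate n etalg \<omega>) \<eta>) > g} + c"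
proof (cases "f \<in> borel_measurable N")
  case False
  then have "\<not> integrable N f" using borel_measurable_integrable by blast
  then have "(\<integral>\<omega>. f \<omega> \<partial>N) = 0" by (rule not_integrable_integral_eq)
  moreover have "0 \<le> cd" using Bd(2) measure_nonneg[of "split_law n" Bd] by linarith
  ultimately show ?thesis using pos by simp
next
  case True
  interpret Mk: prob_space "M k" for k unfolding M_def by (rule prob_space_obs_law)
  interpret product_prob_space M "{1..n}" ..
  interpret D: prob_space "split_law n" by (rule prob_space_split_law)
  interpret PD: pair_prob_space "PiM {1..n} M" "split_law n" ..
  let ?A = "{\<omega> \<in> space N. max (loss p (estimate n thalg \<omega>) \<theta>) (loss q (estimate n etalg \<omega>) \<eta>) > g}"
  define l where "l = (\<lambda>d :: nat \<Rightarrow> nat. emeasure (PiM {i\<in>{1..n}. d i = 0} M) (bad_estimates p q thalg etalg \<theta> \<eta> g (PiM {i\<in>{1..n}. d i = 0} M) {i\<in>{1..n}. d i = 0}))"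
  have l: "(\<integral>\<^sup>+d. l d \<partial>split_law n) = emeasure N ?A"
    unfolding l_def N_def M_def by (rule bad_estimates_law[OF alg])
  \<comment> \<open>\<open>l\<close> factors through the first subsample, which takes finitely many
    values.\<close>
  have l_meas: "l \<in> borel_measurable (split_law n)"
  proof -
    have "l = (\<lambda>S. emeasure (PiM S M) (bad_estimates p q thalg etalg \<theta> \<eta> g (PiM S M) S)) \<circ> (\<lambda>d. {i\<in>{1..n}. d i = 0})"
      by (simp add: l_def comp_def)
    moreover have "(\<lambda>d :: nat \<Rightarrow> nat. {i\<in>{1..n}. d i = 0}) \<in> split_law n \<rightarrow>\<^sub>M count_space (Pow {1..n})"
    proof (subst measurable_count_space_eq2, simp, intro conjI ballI)
      show "(\<lambda>d :: nat \<Rightarrow> nat. {i\<in>{1..n}. d i = 0}) \<in> space (split_law n) \<rightarrow> Pow {1..n}" by auto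
      fix S assume S: "S \<in> Pow {1..n}"
      then show "(\<lambda>d :: nat \<Rightarrow> nat. {i\<in>{1..n}. d i = 0}) -` {S} \<inter> space (split_law n) \<in> sets (split_law n)"
        using split_class_sets[of S n 0] by (simp add: vimage_def Int_def conj_commute)
    qed
    ultimately show ?thesis by (simp add: measurable_comp)
  qed
  have N: "N = PiM {1..n} M \<Otimes>\<^sub>M split_law n" unfolding N_def M_def by (rule law_eq)
  have f_meas: "f \<in> borel_measurable (PiM {1..n} M \<Otimes>\<^sub>M split_law n)" using True unfolding N .
  have "(\<integral>\<^sup>+\<omega>. ennreal (f \<omega>) \<partial>N) = (\<integral>\<^sup>+d. \<integral>\<^sup>+w. ennreal (f (w, d)) \<partial>PiM {1..n} M \<partial>split_law n)"
    unfolding N using f_meas by (subst PD.nn_integral_snd[symmetric]) auto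
  also have "\<dots> \<le> (\<integral>\<^sup>+d. indicator Bd d + (l d + ennreal c) \<partial>split_law n)"
  proof (intro nn_integral_mono)
    fix d assume d: "d \<in> space (split_law n)"
    show "(\<integral>\<^sup>+w. ennreal (f (w, d)) \<partial>PiM {1..n} M) \<le> indicator Bd d + (l d + ennreal c)"
    proof (cases "d \<in> Bd")
      case True
      have "(\<integral>\<^sup>+w. ennreal (f (w, d)) \<partial>PiM {1..n} M) \<le> (\<integral>\<^sup>+w. 1 \<partial>PiM {1..n} M)"
        using f by (intro nn_integral_mono) (simp add: ennreal_le_1)
      also have "\<dots> = 1" using P.emeasure_space_1 by simp
      finally show ?thesis using True by (simp add: add_increasing2)
    next
      case False
      have "(\<lambda>w. f (w, d)) \<in> borel_measurable (PiM {1..n} M)"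
        using measurable_compose[OF measurable_Pair2'[OF d] f_meas] by simp
      then show ?thesis using cond[of d] d False unfolding l_def by simp
    qed
  qed
  also have "\<dots> = emeasure (split_law n) Bd + (emeasure N ?A + ennreal c)"
    using Bd(1) l_meas by (simp add: nn_integral_add l D.emeasure_space_1)
  also have "\<dots> \<le> ennreal cd + (ennreal (measure N ?A) + ennreal c)"
  proof -
    have "prob_space N" unfolding N by unfold_locales
    then show ?thesis
      using emeasure_to_measure_bound[OF prob_space_split_law Bd(2)]
      by (intro add_mono order_refl) (auto simp: finite_measure.emeasure_eq_measure prob_space.finite_measure)
  qed
  also have "\<dots> = ennreal (cd + measure N ?A + c)"
  proof -
    have "0 \<le> cd" using Bd(2) measure_nonneg[of "split_law n" Bd] by linarith
    then show ?thesis using pos by (simp add: ennreal_plus[symmetric] add.assoc del: ennreal_plus)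
  qed
  finally have "(\<integral>\<^sup>+\<omega>. ennreal (f \<omega>) \<partial>N) \<le> ennreal (cd + measure N ?A + c)" .
  moreover have "0 \<le> cd + measure N ?A + c" using Bd(2) measure_nonneg[of "split_law n" Bd] measure_nonneg[of N ?A] pos by linarith
  ultimately show ?thesis
    using f(1) True by (subst integral_eq_nn_integral) (auto intro: enn2real_leI)
qed

subsection \<open>Risk bound for a fixed sample size\<close>

text \<open>The conditions at one fixed sample size; the numerical ones hold for all large
  \<open>n\<close>. \<open>\<alpha>\<close> and \<open>\<beta>0\<close> are the norms in units of
  \<open>K\<close> (\<open>\<beta>0\<close> is unrelated to the sparsity exponent), \<open>g\<close>
  is the estimation error, \<open>h\<close> the slowly growing slack, \<open>\<rho>\<close> the
  scaled radius within which the witness persists, and \<open>r0\<close> a lower bound for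
  \<open>r_hat\<close> there.\<close>

locale adaptive_setting =
  fixes n p q :: nat and \<theta> \<eta> :: vec and thalg etalg :: algorithm and dflt :: "sample \<Rightarrow> real"
    and \<alpha> \<beta>0 g h \<rho> r0 K :: real
  assumes alg: "measurable_algorithm n p q p thalg" "measurable_algorithm n p q q etalg"
    and dflt: "\<And>\<omega>. 0 \<le> dflt \<omega> \<and> dflt \<omega> \<le> 1"
    and n: "n \<ge> 2" and L: "ln (real n) \<ge> 1" and K_def: "K = sqrt (2 * ln (real n))"
    and h: "h \<ge> 1" "2 * h\<^sup>2 \<le> real n" "25 * h^3 \<le> (ln (real n))\<^sup>2"
    and ab0: "\<alpha> > 0" "\<beta>0 > 0" and norms: "vnorm p \<theta> = \<alpha> * K" "vnorm q \<eta> = \<beta>0 * K"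
    and g: "0 \<le> g" "2 * g \<le> min \<alpha> \<beta>0 * K / 2"
    and small: "h / sqrt (real n) \<le> min \<alpha> \<beta>0 * K / 2"
    and near: "h / sqrt (real n) + 2 * g \<le> \<rho> * K"
    and nbhd: "\<And>a b. \<bar>a / K - \<alpha>\<bar> \<le> \<rho> \<Longrightarrow> \<bar>b / K - \<beta>0\<bar> \<le> \<rho> \<Longrightarrow> a > 0 \<and> b > 0 \<and> r0 \<le> r_hat n a b"
    and r0: "r0 > 0" "2 * ln (real n) * (1 / sqrt r0) * h^4 \<le> real n"
begin

text \<open>The interface between the first two subsamples and the third: later bounds know the
  directions and the plug-in values only through this predicate.\<close>

definition close_estimates :: "vec \<Rightarrow> vec \<Rightarrow> real \<Rightarrow> real \<Rightarrow> bool" where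
  "close_estimates v u a b \<longleftrightarrow> vnorm p v \<noteq> 0 \<and> vnorm q u \<noteq> 0 \<and> proj p v \<theta> \<noteq> 0 \<and> proj q u \<eta> \<noteq> 0
    \<and> \<bar>a - \<bar>proj p v \<theta>\<bar>\<bar> \<le> h / sqrt (real n) \<and> \<bar>b - \<bar>proj q u \<eta>\<bar>\<bar> \<le> h / sqrt (real n)
    \<and> \<bar>a / K - \<alpha>\<bar> \<le> \<rho> \<and> \<bar>b / K - \<beta>0\<bar> \<le> \<rho>
    \<and> \<bar>\<bar>proj p v \<theta>\<bar> / K - \<alpha>\<bar> \<le> \<rho> \<and> \<bar>\<bar>proj q u \<eta>\<bar> / K - \<beta>0\<bar> \<le> \<rho>"

definition HC_value :: "nat set \<Rightarrow> vec \<Rightarrow> vec \<Rightarrow> real \<Rightarrow> real \<Rightarrow> (nat \<Rightarrow> vec \<times> vec) \<Rightarrow> real" where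
  "HC_value D v u a b w = of_bool (min (HC_stat n (C_sgn 1) D (\<lambda>i. proj p v (fst (w i))) (\<lambda>i. proj q u (snd (w i))) a b)
     (HC_stat n (C_sgn (-1)) D (\<lambda>i. proj p v (fst (w i))) (\<lambda>i. proj q u (snd (w i))) a b) > ereal (ln (real n) ^ 3))"

text \<open>The second subsample fails with probability at most \<open>c1 / h\<^sup>2\<close>; the
  two terms come from \<open>signal_stage\<close> for the two projections.\<close>

definition c1 :: real where
  "c1 = 16 * (1 + 4 * \<alpha>\<^sup>2) / (min \<alpha> \<beta>0)\<^sup>2 + 16 * (1 + 4 * \<beta>0\<^sup>2) / (min \<alpha> \<beta>0)\<^sup>2"

lemma K_pos: "K > 0" and K_sq: "K\<^sup>2 = 2 * ln (real n)"
  using L by (auto simp: K_def)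

text \<open>The mean square has variance of order \<open>K\<^sup>2 / n\<close>, and passing to the
  root divides its error by a signal of order \<open>K\<close>. The powers of \<open>K\<close>
  cancel, so the accuracy \<open>h / sqrt n\<close> is missed with probability of order
  \<open>1 / h\<^sup>2\<close>.\<close>

lemma signal_stage:
  fixes f :: "nat \<Rightarrow> vec \<times> vec \<Rightarrow> real"
  assumes M: "\<And>i. prob_space (M i)" and D: "finite D" "real (card D) \<ge> real n / 4"
    and f: "\<And>i. i \<in> D \<Longrightarrow> f i \<in> borel_measurable (M i)"
    and distr_f: "\<And>i. i \<in> D \<Longrightarrow> distr (M i) borel (f i) = normal1 (s i * a')"
    and s: "\<And>i. i \<in> D \<Longrightarrow> (s i)\<^sup>2 = 1"
    and a': "min \<alpha> \<beta>0 * K / 2 \<le> \<bar>a'\<bar>" "\<bar>a'\<bar> \<le> c * K"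
  shows "\<exists>B\<in>sets (PiM D M). measure (PiM D M) B \<le> (16 * (1 + 4 * c\<^sup>2) / (min \<alpha> \<beta>0)\<^sup>2) / h\<^sup>2 \<and>
    (\<forall>w\<in>space (PiM D M) - B. \<bar>signal_hat D (\<lambda>i. f i (w i)) - \<bar>a'\<bar>\<bar> \<le> h / sqrt (real n))"
proof -
  define \<mu> where "\<mu> = min \<alpha> \<beta>0"
  have \<mu>: "\<mu> > 0" using ab0 by (simp add: \<mu>_def)
  define lo where "lo = \<mu> * K / 2"
  define y where "y = h / sqrt (real n)"
  have lo: "lo > 0" using \<mu> K_pos by (simp add: lo_def)
  have y: "y > 0" "y \<le> lo" using h n small by (auto simp: y_def lo_def \<mu>_def)
  have D0: "D \<noteq> {}" using D n by auto
  have "\<exists>B\<in>sets (PiM D M). measure (PiM D M) B \<le> (2 + 4 * a'\<^sup>2) / (real (card D) * (lo * y)\<^sup>2) \<and>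
    (\<forall>w\<in>space (PiM D M) - B. \<bar>1 / real (card D) * (\<Sum>i\<in>D. (f i (w i))\<^sup>2) - 1 - a'\<^sup>2\<bar> < lo * y)"
    by (rule mean_square_concentration[OF M D(1) subset_refl D0 f distr_f s mult_pos_pos[OF lo y(1)]])
  then obtain B where B: "B \<in> sets (PiM D M)" "measure (PiM D M) B \<le> (2 + 4 * a'\<^sup>2) / (real (card D) * (lo * y)\<^sup>2)"
    "\<And>w. w \<in> space (PiM D M) - B \<Longrightarrow> \<bar>1 / real (card D) * (\<Sum>i\<in>D. (f i (w i))\<^sup>2) - 1 - a'\<^sup>2\<bar> < lo * y"
    by blast
  have "(2 + 4 * a'\<^sup>2) / (real (card D) * (lo * y)\<^sup>2) \<le> (K\<^sup>2 * (1 + 4 * c\<^sup>2)) / (\<mu>\<^sup>2 * K\<^sup>2 * h\<^sup>2 / 16)"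
  proof (rule frac_le)
    have "a'\<^sup>2 \<le> (c * K)\<^sup>2" using a'(2) by (metis abs_ge_zero power2_abs power_mono)
    moreover have "2 \<le> K\<^sup>2" using L by (simp add: K_sq)
    ultimately show "2 + 4 * a'\<^sup>2 \<le> K\<^sup>2 * (1 + 4 * c\<^sup>2)" by (simp add: power_mult_distrib algebra_simps)
    have "(lo * y)\<^sup>2 = \<mu>\<^sup>2 * K\<^sup>2 * h\<^sup>2 / (4 * real n)"
      using n by (simp add: lo_def y_def power_mult_distrib power_divide)
    moreover have "real n / 4 * (lo * y)\<^sup>2 \<le> real (card D) * (lo * y)\<^sup>2" using D by (intro mult_right_mono) auto
    ultimately show "\<mu>\<^sup>2 * K\<^sup>2 * h\<^sup>2 / 16 \<le> real (card D) * (lo * y)\<^sup>2" using n by simp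
  qed (use \<mu> K_pos h in auto)
  also have "\<dots> = (16 * (1 + 4 * c\<^sup>2) / \<mu>\<^sup>2) / h\<^sup>2" using K_pos by simp
  finally have prob: "measure (PiM D M) B \<le> (16 * (1 + 4 * c\<^sup>2) / \<mu>\<^sup>2) / h\<^sup>2" using B(2) by linarith
  have "\<bar>signal_hat D (\<lambda>i. f i (w i)) - \<bar>a'\<bar>\<bar> \<le> y" if "w \<in> space (PiM D M) - B" for w
    using a'(1) by (intro signal_hat_close[OF B(3)[OF that] lo _ y]) (simp add: lo_def \<mu>_def)
  then show ?thesis using B(1) prob unfolding y_def \<mu>_def by blast
qed

text \<open>Nonempty subsamples and close estimates put the test on its main branch, where the first
  two blocks enter only through \<open>v\<close>, \<open>u\<close>, \<open>a\<close>,
  \<open>b\<close>.\<close>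

lemma test_value:
  assumes D: "D0 = {i\<in>{1..n}. d i = 0}" "D1 = {i\<in>{1..n}. d i = 1}" "D2 = {i\<in>{1..n}. d i = (2 :: nat)}"
    and ne: "D0 \<noteq> {}" "D1 \<noteq> {}" "D2 \<noteq> {}"
    and w0: "w0 \<in> extensional D0" and J: "J = {1..n} - D0 - D1"
    and W: "W = merge D0 (D1 \<union> J) (w0, merge D1 J (w1, w2))"
    and vu: "v = thalg D0 w0" "u = etalg D0 w0"
    and ab: "a = signal_hat D1 (\<lambda>i. proj p v (fst (w1 i)))" "b = signal_hat D1 (\<lambda>i. proj q u (snd (w1 i)))"
    and close: "close_estimates v u a b"
  shows "ada_HC_test n p q thalg etalg dflt (W, d) = HC_value D2 v u a b w2"
proof -
  have disj: "D0 \<inter> D1 = {}" "D0 \<inter> D2 = {}" "D1 \<inter> D2 = {}" "D2 \<subseteq> J" using D J by auto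
  have W0: "restrict W D0 = w0"
    using w0 unfolding W by (auto simp: merge_def restrict_def extensional_def)
  have W1: "W i = w1 i" if "i \<in> D1" for i using that disj unfolding W by (auto simp: merge_def)
  have W2: "W i = w2 i" if "i \<in> D2" for i using that disj unfolding W by (auto simp: merge_def)
  have sub: "subsample n (W, d) 0 = D0" "subsample n (W, d) 1 = D1" "subsample n (W, d) 2 = D2"
    using D by (auto simp: subsample_def)
  have est: "estimate n thalg (W, d) = v" "estimate n etalg (W, d) = u"
    unfolding estimate_def sub using W0 vu by simp_all
  have xy: "x_hat n p thalg (W, d) = (\<lambda>i. proj p v (fst (W i)))" "y_hat n q etalg (W, d) = (\<lambda>i. proj q u (snd (W i)))"
    by (auto simp: x_hat_def y_hat_def est proj_def)
  have sig: "signal_hat D1 (\<lambda>i. proj p v (fst (W i))) = a" "signal_hat D1 (\<lambda>i. proj q u (snd (W i))) = b"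
    unfolding ab signal_hat_def using W1 by (simp_all cong: sum.cong)
  have HC: "HC_stat n C D2 (\<lambda>i. proj p v (fst (W i))) (\<lambda>i. proj q u (snd (W i))) a b
     = HC_stat n C D2 (\<lambda>i. proj p v (fst (w2 i))) (\<lambda>i. proj q u (snd (w2 i))) a b" for C
  proof -
    have "(\<Sum>i\<in>D2. of_bool (C (proj p v (fst (W i))) (proj q u (snd (W i))) a b > s)) =
      (\<Sum>i\<in>D2. of_bool (C (proj p v (fst (w2 i))) (proj q u (snd (w2 i))) a b > s) :: real)" for s
      using W2 by (intro sum.cong refl) auto
    then show ?thesis unfolding HC_stat_def by simp
  qed
  have ab_pos: "a > 0" "b > 0" using nbhd[of a b] close by (auto simp: close_estimates_def)
  have defined: "n \<ge> 2 \<and> (\<forall>m\<in>{0, 1, 2}. subsample n (W, d) m \<noteq> {})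
            \<and> vnorm p (estimate n thalg (W, d)) \<noteq> 0 \<and> vnorm q (estimate n etalg (W, d)) \<noteq> 0
            \<and> a\<^sup>2 + b\<^sup>2 \<noteq> 0
            \<and> (\<forall>t. \<bar>t\<bar> \<le> ln (real n) \<longrightarrow> S_tail n (r_hat n a b) (s_hat n a b) t \<noteq> 0)"
  proof (intro conjI allI impI)
    show "\<forall>m\<in>{0, 1, 2}. subsample n (W, d) m \<noteq> {}" using ne sub by auto
    show "a\<^sup>2 + b\<^sup>2 \<noteq> 0" using ab_pos by (simp add: sum_power2_eq_zero_iff)
    show "S_tail n (r_hat n a b) (s_hat n a b) t \<noteq> 0" for t
      using S_tail_eq_C_tail[OF ab_pos n, of t] C_tail_pos[OF ab_pos] by (metis less_irrefl)
  qed (use n close in \<open>auto simp: est close_estimates_def\<close>)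
  have C: "C_sgn 1 = C_minus" "C_sgn (-1) = C_plus" by (auto simp: C_sgn_def)
  show ?thesis
    unfolding ada_HC_test_def Let_def xy sub(2,3) sig HC_value_def C
    unfolding HC by (subst if_P[OF defined]) (rule refl)
qed

text \<open>\<open>f\<close> is the identity for the error of the first kind and
  \<open>1 - x\<close> for the second. The last block \<open>J\<close> collects all indices outside
  \<open>D0\<close> and \<open>D1\<close> rather than just \<open>D2\<close>, since every coordinate
  has to be integrated.\<close>

lemma conditional_bound:
  assumes zs: "z \<in> signs n" "\<sigma> \<in> signs n"
  defines "M \<equiv> obs_law p q \<theta> \<eta> z \<sigma>"
  assumes D: "D0 = {i\<in>{1..n}. d i = 0}" "D1 = {i\<in>{1..n}. d i = 1}" "D2 = {i\<in>{1..n}. d i = (2 :: nat)}"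
    and card: "real n / 4 \<le> real (card D0)" "real n / 4 \<le> real (card D1)" "real n / 4 \<le> real (card D2)"
    and J: "J = {1..n} - D0 - D1"
    and f: "\<And>x. 0 \<le> x \<Longrightarrow> x \<le> 1 \<Longrightarrow> 0 \<le> f x \<and> f x \<le> (1 :: real)"
    and meas: "(\<lambda>w. f (ada_HC_test n p q thalg etalg dflt (w, d))) \<in> borel_measurable (PiM {1..n} M)"
    and d2: "0 \<le> d2"
    and stage: "\<And>v u a b. close_estimates v u a b \<Longrightarrow> \<exists>B\<in>sets (PiM J M). measure (PiM J M) B \<le> d2 \<and>
      (\<forall>w\<in>space (PiM J M) - B. f (HC_value D2 v u a b w) = 0)"
  shows "(\<integral>\<^sup>+w. ennreal (f (ada_HC_test n p q thalg etalg dflt (w, d))) \<partial>PiM {1..n} M)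
    \<le> emeasure (PiM D0 M) (bad_estimates p q thalg etalg \<theta> \<eta> g (PiM D0 M) D0) + ennreal (c1 / h\<^sup>2 + d2)"
proof -
  interpret Mk: prob_space "M k" for k unfolding M_def by (rule prob_space_obs_law)
  have Mp: "\<And>i. prob_space (M i)" unfolding M_def by (rule prob_space_obs_law)
  let ?T = "\<lambda>w. ada_HC_test n p q thalg etalg dflt (w, d)"
  have T01: "0 \<le> ?T w \<and> ?T w \<le> 1" for w
    using dflt by (simp add: ada_HC_test_def Let_def)
  have I_eq: "{1..n} = D0 \<union> (D1 \<union> J)" using D J by auto
  have fin: "finite D0" "finite D1" "finite J" using D J by auto
  have disj: "D0 \<inter> D1 = {}" "D0 \<inter> J = {}" "D1 \<inter> J = {}" using D J by auto
  have ne: "D0 \<noteq> {}" "D1 \<noteq> {}" "D2 \<noteq> {}" using card n by auto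
  have sub0: "D0 \<subseteq> {1..n}" using D by auto
  have sgn: "(z i)\<^sup>2 = 1" "(\<sigma> i)\<^sup>2 = 1" if "i \<in> D1" for i
  proof -
    have "i \<in> {1..n}" using that D by auto
    then have "z i \<in> {-1, 1}" "\<sigma> i \<in> {-1, 1}" using zs by (auto simp: signs_def PiE_iff)
    then show "(z i)\<^sup>2 = 1" "(\<sigma> i)\<^sup>2 = 1" by auto
  qed
  have c1_nonneg: "0 \<le> c1 / h\<^sup>2" by (simp add: c1_def)
  have "(\<integral>\<^sup>+w. ennreal (f (?T w)) \<partial>PiM (D0 \<union> (D1 \<union> J)) M)
    \<le> emeasure (PiM D0 M) (bad_estimates p q thalg etalg \<theta> \<eta> g (PiM D0 M) D0) + (ennreal (c1 / h\<^sup>2) + ennreal d2)"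
  proof (rule three_stage_bound[OF Mp fin disj])
    show "(\<lambda>w. ennreal (f (?T w))) \<in> borel_measurable (PiM (D0 \<union> (D1 \<union> J)) M)"
      using meas unfolding I_eq[symmetric] by measurable
    show "ennreal (f (?T w)) \<le> 1" for w using f T01 by (simp add: ennreal_le_1)
    show "bad_estimates p q thalg etalg \<theta> \<eta> g (PiM D0 M) D0 \<in> sets (PiM D0 M)"
      unfolding M_def by (rule bad_estimates_sets[OF alg sub0])
    fix w0 assume w0: "w0 \<in> space (PiM D0 M) - bad_estimates p q thalg etalg \<theta> \<eta> g (PiM D0 M) D0"
    define v where "v = thalg D0 w0"
    define u where "u = etalg D0 w0"
    have loss: "loss p v \<theta> \<le> g" "loss q u \<eta> \<le> g"
      using w0 by (auto simp: bad_estimates_def v_def u_def)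
    have min_le: "min \<alpha> \<beta>0 * K \<le> \<alpha> * K" "min \<alpha> \<beta>0 * K \<le> \<beta>0 * K" "min \<alpha> \<beta>0 * K > 0"
      using K_pos ab0 by (auto intro: mult_right_mono)
    have g_lt: "g < vnorm p \<theta>" "g < vnorm q \<eta>" using g min_le unfolding norms by linarith+
    note pv = proj_close[OF loss(1) g(1) g_lt(1)] and pu = proj_close[OF loss(2) g(1) g_lt(2)]
    have lo: "min \<alpha> \<beta>0 * K / 2 \<le> \<bar>proj p v \<theta>\<bar>" "min \<alpha> \<beta>0 * K / 2 \<le> \<bar>proj q u \<eta>\<bar>"
      using pv(2) pu(2) g min_le unfolding norms by linarith+
    have up: "\<bar>proj p v \<theta>\<bar> \<le> \<alpha> * K" "\<bar>proj q u \<eta>\<bar> \<le> \<beta>0 * K" using pv(3) pu(3) unfolding norms by auto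
    note comp = obs_distr_component[OF pv(1) pu(1), of \<theta> \<eta> z \<sigma>, folded M_def]
    obtain Ba where Ba: "Ba \<in> sets (PiM D1 M)" "measure (PiM D1 M) Ba \<le> (16 * (1 + 4 * \<alpha>\<^sup>2) / (min \<alpha> \<beta>0)\<^sup>2) / h\<^sup>2"
      "\<And>w. w \<in> space (PiM D1 M) - Ba \<Longrightarrow> \<bar>signal_hat D1 (\<lambda>i. proj p v (fst (w i))) - \<bar>proj p v \<theta>\<bar>\<bar> \<le> h / sqrt (real n)"
      using signal_stage[of M D1 "\<lambda>i x. proj p v (fst x)" z, OF Mp fin(2) card(2) comp(2) comp(1) sgn(1) lo(1) up(1)] by blast
    obtain Bb where Bb: "Bb \<in> sets (PiM D1 M)" "measure (PiM D1 M) Bb \<le> (16 * (1 + 4 * \<beta>0\<^sup>2) / (min \<alpha> \<beta>0)\<^sup>2) / h\<^sup>2"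
      "\<And>w. w \<in> space (PiM D1 M) - Bb \<Longrightarrow> \<bar>signal_hat D1 (\<lambda>i. proj q u (snd (w i))) - \<bar>proj q u \<eta>\<bar>\<bar> \<le> h / sqrt (real n)"
      using signal_stage[of M D1 "\<lambda>i x. proj q u (snd x)" \<sigma>, OF Mp fin(2) card(2) comp(4) comp(3) sgn(2) lo(2) up(2)] by blast
    have est: "close_estimates v u a b" if a: "\<bar>a - \<bar>proj p v \<theta>\<bar>\<bar> \<le> h / sqrt (real n)" and b: "\<bar>b - \<bar>proj q u \<eta>\<bar>\<bar> \<le> h / sqrt (real n)" for a b
    proof -
      have quot: "\<bar>x / K - c\<bar> \<le> \<rho>" if "\<bar>x - c * K\<bar> \<le> h / sqrt (real n) + 2 * g" for x c
      proof -
        have "x / K - c = (x - c * K) / K" using K_pos by (simp add: field_simps)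
        then show ?thesis using that near K_pos by (simp add: abs_divide divide_le_eq)
      qed
      have h0: "0 \<le> h / sqrt (real n)" using h by simp
      have pa: "\<bar>\<bar>proj p v \<theta>\<bar> - \<alpha> * K\<bar> \<le> 2 * g" "\<bar>\<bar>proj q u \<eta>\<bar> - \<beta>0 * K\<bar> \<le> 2 * g"
        using pv(2,3) pu(2,3) g(1) unfolding norms by linarith+
      show ?thesis unfolding close_estimates_def
      proof (intro conjI quot)
        show "\<bar>a - \<alpha> * K\<bar> \<le> h / sqrt (real n) + 2 * g" "\<bar>b - \<beta>0 * K\<bar> \<le> h / sqrt (real n) + 2 * g"
          "\<bar>\<bar>proj p v \<theta>\<bar> - \<alpha> * K\<bar> \<le> h / sqrt (real n) + 2 * g" "\<bar>\<bar>proj q u \<eta>\<bar> - \<beta>0 * K\<bar> \<le> h / sqrt (real n) + 2 * g"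
          using a b pa h0 by linarith+
        show "proj p v \<theta> \<noteq> 0" "proj q u \<eta> \<noteq> 0" using lo min_le by auto
      qed (use pv pu a b in auto)
    qed
    show "\<exists>B1\<in>sets (PiM D1 M). measure (PiM D1 M) B1 \<le> c1 / h\<^sup>2 \<and>
      (\<forall>w1\<in>space (PiM D1 M) - B1. \<exists>B2\<in>sets (PiM J M). measure (PiM J M) B2 \<le> d2 \<and>
        (\<forall>w2\<in>space (PiM J M) - B2. ennreal (f (?T (merge D0 (D1 \<union> J) (w0, merge D1 J (w1, w2))))) = 0))"
    proof (rule bexI[of _ "Ba \<union> Bb"], intro conjI ballI)
      show "Ba \<union> Bb \<in> sets (PiM D1 M)" using Ba Bb by auto
      have "measure (PiM D1 M) (Ba \<union> Bb) \<le> measure (PiM D1 M) Ba + measure (PiM D1 M) Bb"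
        using Ba Bb by (intro measure_Un_le)
      then show "measure (PiM D1 M) (Ba \<union> Bb) \<le> c1 / h\<^sup>2"
        using Ba(2) Bb(2) unfolding c1_def add_divide_distrib by linarith
      fix w1 assume w1: "w1 \<in> space (PiM D1 M) - (Ba \<union> Bb)"
      define a where "a = signal_hat D1 (\<lambda>i. proj p v (fst (w1 i)))"
      define b where "b = signal_hat D1 (\<lambda>i. proj q u (snd (w1 i)))"
      have close: "close_estimates v u a b" unfolding a_def b_def using Ba(3) Bb(3) w1 by (intro est) auto
      from stage[OF this] obtain B where B: "B \<in> sets (PiM J M)" "measure (PiM J M) B \<le> d2"
        "\<And>w. w \<in> space (PiM J M) - B \<Longrightarrow> f (HC_value D2 v u a b w) = 0" by blast
      have w0e: "w0 \<in> extensional D0" using w0 by (auto simp: space_PiM PiE_def)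
      have "?T (merge D0 (D1 \<union> J) (w0, merge D1 J (w1, w2))) = HC_value D2 v u a b w2" for w2
        by (rule test_value[OF D ne w0e J refl v_def u_def a_def b_def close])
      then show "\<exists>B2\<in>sets (PiM J M). measure (PiM J M) B2 \<le> d2 \<and>
        (\<forall>w2\<in>space (PiM J M) - B2. ennreal (f (?T (merge D0 (D1 \<union> J) (w0, merge D1 J (w1, w2))))) = 0)"
        using B by (intro bexI[of _ B]) auto
    qed
  qed
  then show ?thesis using c1_nonneg d2 unfolding I_eq[symmetric] by (simp add: ennreal_plus)
qed

lemma split_good:
  "\<exists>B\<in>sets (split_law n). measure (split_law n) B \<le> 96 / real n \<and>
    (\<forall>d\<in>space (split_law n) - B. \<forall>m\<in>{0, 1, 2}. real n / 4 \<le> real (card {i\<in>{1..n}. d i = m}))"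
proof -
  have "\<exists>B\<in>sets (split_law n). measure (split_law n) B \<le> 32 / real n \<and>
    (\<forall>d\<in>space (split_law n) - B. real n / 4 \<le> real (card {i\<in>{1..n}. d i = m}))" if "m \<in> {0, 1, 2}" for m
    using split_concentration[of "{1..n}" n m] n that by simp
  then obtain B where B: "\<And>m. m \<in> {0, 1, 2} \<Longrightarrow> B m \<in> sets (split_law n) \<and> measure (split_law n) (B m) \<le> 32 / real n \<and>
    (\<forall>d\<in>space (split_law n) - B m. real n / 4 \<le> real (card {i\<in>{1..n}. d i = m}))" by metis
  have "measure (split_law n) (B 0 \<union> (B 1 \<union> B 2)) \<le> measure (split_law n) (B 0) + measure (split_law n) (B 1 \<union> B 2)"
    using B by (intro measure_Un_le) auto
  also have "measure (split_law n) (B 1 \<union> B 2) \<le> measure (split_law n) (B 1) + measure (split_law n) (B 2)"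
    using B by (intro measure_Un_le) auto
  finally have "measure (split_law n) (B 0 \<union> (B 1 \<union> B 2)) \<le> 96 / real n"
    using B[of 0] B[of 1] B[of 2] by auto
  then show ?thesis using B by (intro bexI[of _ "B 0 \<union> (B 1 \<union> B 2)"]) auto
qed

definition bad_prob :: "(nat \<Rightarrow> real) \<Rightarrow> (nat \<Rightarrow> real) \<Rightarrow> real" where
  "bad_prob z \<sigma> = measure (law n p q \<theta> \<eta> z \<sigma>) {\<omega> \<in> space (law n p q \<theta> \<eta> z \<sigma>).
     max (loss p (estimate n thalg \<omega>) \<theta>) (loss q (estimate n etalg \<omega>) \<eta>) > g}"

lemma test_range: "0 \<le> ada_HC_test n p q thalg etalg dflt \<omega>" "ada_HC_test n p q thalg etalg dflt \<omega> \<le> 1"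
  using dflt by (simp_all add: ada_HC_test_def Let_def)

lemma null_bound:
  assumes zs: "z \<in> signs n" "\<sigma> \<in> signs n" and null: "ell n z \<sigma> = 0"
  shows "(\<integral>\<omega>. ada_HC_test n p q thalg etalg dflt \<omega> \<partial>law n p q \<theta> \<eta> z \<sigma>)
    \<le> 96 / real n + bad_prob z \<sigma> + (c1 / h\<^sup>2 + (4 / (real n)\<^sup>2 + 6 / h))"
proof -
  define M where "M = obs_law p q \<theta> \<eta> z \<sigma>"
  have sgn: "(z i = 1 \<or> z i = -1) \<and> (\<sigma> i = 1 \<or> \<sigma> i = -1)" if "i \<in> {1..n}" for i
    using zs that by (auto simp: signs_def PiE_iff)
  obtain s :: real where s: "s = 1 \<or> s = -1" "\<And>i. i \<in> {1..n} \<Longrightarrow> z i = s * \<sigma> i"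
  proof -
    have "card {i\<in>{1..n}. z i \<noteq> \<sigma> i} = 0 \<or> card {i\<in>{1..n}. z i \<noteq> - \<sigma> i} = 0"
      using null n by (auto simp: ell_def min_def split: if_splits)
    then have "(\<forall>i\<in>{1..n}. z i = 1 * \<sigma> i) \<or> (\<forall>i\<in>{1..n}. z i = (-1) * \<sigma> i)"
      by auto
    then show thesis using that by blast
  qed
  obtain Bd where Bd: "Bd \<in> sets (split_law n)" "measure (split_law n) Bd \<le> 96 / real n"
    "\<And>d m. d \<in> space (split_law n) - Bd \<Longrightarrow> m \<in> {0, 1, 2} \<Longrightarrow> real n / 4 \<le> real (card {i\<in>{1..n}. d i = m})"
    using split_good by blast
  show ?thesis unfolding bad_prob_def
  proof (rule split_expectation_bound[where z = z and \<sigma> = \<sigma> and \<theta> = \<theta> and \<eta> = \<eta>, OF alg test_range Bd(1,2), folded M_def])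
    show "0 \<le> c1 / h\<^sup>2 + (4 / (real n)\<^sup>2 + 6 / h)" using h by (simp add: c1_def)
    fix d assume d: "d \<in> space (split_law n) - Bd"
      and meas: "(\<lambda>w. ada_HC_test n p q thalg etalg dflt (w, d)) \<in> borel_measurable (PiM {1..n} M)"
    define D2 where "D2 = {i\<in>{1..n}. d i = 2}"
    define J where "J = {1..n} - {i\<in>{1..n}. d i = 0} - {i\<in>{1..n}. d i = 1}"
    have D2: "D2 \<noteq> {}" "card D2 \<le> n" "D2 \<subseteq> J" "D2 \<subseteq> {1..n}"
    proof -
      show sub: "D2 \<subseteq> {1..n}" and "D2 \<subseteq> J" by (auto simp: D2_def J_def)
      then show "card D2 \<le> n" using card_mono[OF _ sub] by simp
      have "real n / 4 \<le> real (card D2)" using Bd(3)[OF d, of 2] by (simp add: D2_def)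
      then show "D2 \<noteq> {}" using n by auto
    qed
    show "(\<integral>\<^sup>+w. ennreal (ada_HC_test n p q thalg etalg dflt (w, d)) \<partial>PiM {1..n} M) \<le>
        emeasure (PiM {i\<in>{1..n}. d i = 0} M) (bad_estimates p q thalg etalg \<theta> \<eta> g (PiM {i\<in>{1..n}. d i = 0} M) {i\<in>{1..n}. d i = 0})
        + ennreal (c1 / h\<^sup>2 + (4 / (real n)\<^sup>2 + 6 / h))"
    proof (rule conditional_bound[OF zs refl refl refl _ _ _ refl, where f = "\<lambda>x. x" and d = d, folded M_def D2_def J_def])
      show "real n / 4 \<le> real (card {i\<in>{1..n}. d i = 0})" "real n / 4 \<le> real (card {i\<in>{1..n}. d i = 1})" "real n / 4 \<le> real (card D2)"
        unfolding D2_def using Bd(3)[OF d] by auto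
      show "0 \<le> 4 / (real n)\<^sup>2 + 6 / h" using h by simp
      fix v u a b assume close: "close_estimates v u a b"
      then have vu: "vnorm p v \<noteq> 0" "vnorm q u \<noteq> 0" and nz: "proj p v \<theta> \<noteq> 0" "proj q u \<eta> \<noteq> 0"
        and cl: "\<bar>a - \<bar>proj p v \<theta>\<bar>\<bar> \<le> h / sqrt (real n)" "\<bar>b - \<bar>proj q u \<eta>\<bar>\<bar> \<le> h / sqrt (real n)"
        and ab: "a > 0" "b > 0" and rh: "r0 \<le> r_hat n a b"
        using nbhd[of a b] by (auto simp: close_estimates_def)
      \<comment> \<open>The signs of the two estimated directions and the global sign
        \<open>s\<close> together decide which statistic is calibrated. It alone has to stay below
        the threshold, because the test takes a minimum.\<close>
      define e :: real where "e = sgn (s * proj p v \<theta> * proj q u \<eta>)"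
      have e: "e = 1 \<or> e = -1" and e_pos: "s * proj p v \<theta> * proj q u \<eta> * e > 0"
      proof -
        have "s * proj p v \<theta> * proj q u \<eta> \<noteq> 0" using nz s(1) by auto
        moreover have "sgn x = 1 \<or> sgn x = -1" "x * sgn x > 0" if "x \<noteq> 0" for x :: real
          using that by (auto simp: sgn_if)
        ultimately show "e = 1 \<or> e = -1" "s * proj p v \<theta> * proj q u \<eta> * e > 0"
          unfolding e_def by blast+
      qed
      have "2 * ln (real n) * (1 / sqrt (r_hat n a b)) * h^4 \<le> 2 * ln (real n) * (1 / sqrt r0) * h^4"
        using rh r0 L h by (intro mult_right_mono mult_left_mono divide_left_mono) auto
      then have large: "2 * ln (real n) * (1 / sqrt (r_hat n a b)) * h^4 \<le> real n" using r0 by linarith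
      have same: "z i * proj p v \<theta> * (e * \<sigma> i * proj q u \<eta>) > 0" if "i \<in> D2" for i
      proof -
        have i: "i \<in> {1..n}" using that D2 by auto
        have "z i * proj p v \<theta> * (e * \<sigma> i * proj q u \<eta>) = (\<sigma> i)\<^sup>2 * (s * proj p v \<theta> * proj q u \<eta> * e)"
          unfolding s(2)[OF i] by (simp add: power2_eq_square mult_ac)
        moreover have "(\<sigma> i)\<^sup>2 = 1" using sgn[OF i] by auto
        ultimately show ?thesis using e_pos by (simp only: mult_1_left)
      qed
      have sgn2: "(z i = 1 \<or> z i = -1) \<and> (\<sigma> i = 1 \<or> \<sigma> i = -1)" if "i \<in> D2" for i using sgn D2(4) that by blast
      have finJ: "finite J" by (simp add: J_def)
      have "\<exists>B\<in>sets (PiM J M). measure (PiM J M) B \<le> 4 / (real n)\<^sup>2 + 6 / h \<and> (\<forall>w\<in>space (PiM J M) - B.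
           HC_stat n (C_sgn e) D2 (\<lambda>i. proj p v (fst (w i))) (\<lambda>i. proj q u (snd (w i))) a b \<le> ereal (ln (real n) ^ 3))"
        unfolding M_def by (rule HC_stat_null[OF n L h large vu ab cl finJ D2(3,1,2) e sgn2 same])
      then obtain B where B: "B \<in> sets (PiM J M)" "measure (PiM J M) B \<le> 4 / (real n)\<^sup>2 + 6 / h"
        and HC: "\<And>w. w \<in> space (PiM J M) - B \<Longrightarrow>
           HC_stat n (C_sgn e) D2 (\<lambda>i. proj p v (fst (w i))) (\<lambda>i. proj q u (snd (w i))) a b \<le> ereal (ln (real n) ^ 3)"
        by blast
      have "HC_value D2 v u a b w = 0" if "w \<in> space (PiM J M) - B" for w
        using HC[OF that] e unfolding HC_value_def by (auto simp: not_less min_le_iff_disj)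
      then show "\<exists>B\<in>sets (PiM J M). measure (PiM J M) B \<le> 4 / (real n)\<^sup>2 + 6 / h \<and>
        (\<forall>w\<in>space (PiM J M) - B. HC_value D2 v u a b w = 0)"
        using B by (intro bexI[of _ B]) auto
    qed (use meas in auto)
  qed
qed

lemma alternative_bound:
  assumes zs: "z \<in> signs n" "\<sigma> \<in> signs n" and alt: "ell n z \<sigma> > \<epsilon>" and eps: "\<epsilon> > 0"
    and wit: "\<And>a b a1 b1. \<bar>a / K - \<alpha>\<bar> \<le> \<rho> \<Longrightarrow> \<bar>b / K - \<beta>0\<bar> \<le> \<rho> \<Longrightarrow> \<bar>a1 / K - \<alpha>\<bar> \<le> \<rho> \<Longrightarrow> \<bar>b1 / K - \<beta>0\<bar> \<le> \<rho> \<Longrightarrow>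
      S_tail n (r_hat n a b) (s_hat n a b) (\<tau> * K) \<le> S0 \<and> P1 \<le> C_tail a1 (- b1) a b (\<tau> * K * K)"
    and num: "\<bar>\<tau> * K\<bar> \<le> ln (real n)" "S0 \<le> P1 / 2" "64 * h\<^sup>2 \<le> real n * \<epsilon> / 4 * P1"
      "4 * (ln (real n) ^ 3 + 3 * h) * sqrt (real n * S0) < real n * \<epsilon> / 4 * P1"
  shows "(\<integral>\<omega>. 1 - ada_HC_test n p q thalg etalg dflt \<omega> \<partial>law n p q \<theta> \<eta> z \<sigma>)
    \<le> (96 / real n + 64 / (real n * \<epsilon>)) + bad_prob z \<sigma> + (c1 / h\<^sup>2 + 2 / h\<^sup>2)"
proof -
  define M where "M = obs_law p q \<theta> \<eta> z \<sigma>"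
  have sgn: "(z i = 1 \<or> z i = -1) \<and> (\<sigma> i = 1 \<or> \<sigma> i = -1)" if "i \<in> {1..n}" for i
    using zs that by (auto simp: signs_def PiE_iff)
  \<comment> \<open>The bound on \<open>ell\<close> controls the mismatches for both global signs;
    whatever signs the estimated directions have, the mismatches seen by either statistic are those
    of \<open>Hs 1\<close> or of \<open>Hs (-1)\<close>.\<close>
  define Hs where "Hs = (\<lambda>s :: real. {i\<in>{1..n}. z i \<noteq> s * \<sigma> i})"
  have ne: "real n * \<epsilon> > 0" using n eps by simp
  have Hs: "real n * \<epsilon> \<le> real (card (Hs s))" if "s = 1 \<or> s = -1" for s
  proof -
    have "\<epsilon> < real (card (Hs s)) / real n" using alt that by (auto simp: ell_def Hs_def)
    then show ?thesis using n by (simp add: less_divide_eq mult.commute)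
  qed
  obtain Bd0 where Bd0: "Bd0 \<in> sets (split_law n)" "measure (split_law n) Bd0 \<le> 96 / real n"
    "\<And>d m. d \<in> space (split_law n) - Bd0 \<Longrightarrow> m \<in> {0, 1, 2} \<Longrightarrow> real n / 4 \<le> real (card {i\<in>{1..n}. d i = m})"
    using split_good by blast
  define Q where "Q = (\<lambda>s B. measure (split_law n) B \<le> 32 / (real n * \<epsilon>) \<and>
    (\<forall>d\<in>space (split_law n) - B. real n * \<epsilon> / 4 \<le> real (card {i\<in>Hs s. d i = 2})))"
  have ex_Bs: "\<exists>B\<in>sets (split_law n). Q s B" if s: "s = 1 \<or> s = -1" for s
  proof -
    have sub: "Hs s \<subseteq> {1..n}" by (auto simp: Hs_def)
    have nonempty: "Hs s \<noteq> {}" using Hs[OF s] ne by auto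
    have two: "2 \<in> {0, 1, 2 :: nat}" by simp
    obtain B where B: "B \<in> sets (split_law n)" "measure (split_law n) B \<le> 32 / real (card (Hs s))"
      "\<And>d. d \<in> space (split_law n) - B \<Longrightarrow> real (card (Hs s)) / 4 \<le> real (card {i\<in>Hs s. d i = 2})"
      using split_concentration[OF sub nonempty two] by blast
    have "32 / real (card (Hs s)) \<le> 32 / (real n * \<epsilon>)" using Hs[OF s] ne by (intro divide_left_mono) auto
    moreover have "real n * \<epsilon> / 4 \<le> real (card {i\<in>Hs s. d i = 2})" if "d \<in> space (split_law n) - B" for d
      using B(3)[OF that] Hs[OF s] by linarith
    ultimately show ?thesis using B(1,2) unfolding Q_def by (intro bexI[of _ B]) auto
  qed
  obtain Bs where "\<And>s. s = 1 \<or> s = -1 \<Longrightarrow> Bs s \<in> sets (split_law n) \<and> Q s (Bs s)"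
    using ex_Bs by metis
  note Bs = this[unfolded Q_def]
  have Bs_sets: "Bs 1 \<in> sets (split_law n)" "Bs (-1) \<in> sets (split_law n)"
    and Bs_meas: "measure (split_law n) (Bs 1) \<le> 32 / (real n * \<epsilon>)" "measure (split_law n) (Bs (-1)) \<le> 32 / (real n * \<epsilon>)"
    using Bs[of 1] Bs[of "-1"] by blast+
  define Bd where "Bd = Bd0 \<union> (Bs 1 \<union> Bs (-1))"
  have Bd: "Bd \<in> sets (split_law n)" unfolding Bd_def by (intro sets.Un Bd0(1) Bs_sets)
  have "measure (split_law n) Bd \<le> measure (split_law n) Bd0 + measure (split_law n) (Bs 1 \<union> Bs (-1))"
    unfolding Bd_def by (intro measure_Un_le sets.Un Bd0(1) Bs_sets)
  also have "measure (split_law n) (Bs 1 \<union> Bs (-1)) \<le> measure (split_law n) (Bs 1) + measure (split_law n) (Bs (-1))"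
    by (intro measure_Un_le Bs_sets)
  finally have Bd_meas: "measure (split_law n) Bd \<le> 96 / real n + 64 / (real n * \<epsilon>)"
    using Bd0(2) Bs_meas by (simp add: field_simps)
  have rng: "0 \<le> 1 - ada_HC_test n p q thalg etalg dflt \<omega>" "1 - ada_HC_test n p q thalg etalg dflt \<omega> \<le> 1" for \<omega>
    using test_range[of \<omega>] by auto
  show ?thesis unfolding bad_prob_def
  proof (rule split_expectation_bound[where z = z and \<sigma> = \<sigma> and \<theta> = \<theta> and \<eta> = \<eta>, OF alg rng Bd Bd_meas, folded M_def])
    show "0 \<le> c1 / h\<^sup>2 + 2 / h\<^sup>2" using h by (simp add: c1_def)
    fix d assume d: "d \<in> space (split_law n) - Bd"
      and meas: "(\<lambda>w. 1 - ada_HC_test n p q thalg etalg dflt (w, d)) \<in> borel_measurable (PiM {1..n} M)"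
    have d0: "d \<in> space (split_law n) - Bd0" using d by (auto simp: Bd_def)
    define D2 where "D2 = {i\<in>{1..n}. d i = 2}"
    define J where "J = {1..n} - {i\<in>{1..n}. d i = 0} - {i\<in>{1..n}. d i = 1}"
    have D2: "D2 \<noteq> {}" "card D2 \<le> n" "D2 \<subseteq> J" "D2 \<subseteq> {1..n}"
    proof -
      show sub: "D2 \<subseteq> {1..n}" and "D2 \<subseteq> J" by (auto simp: D2_def J_def)
      then show "card D2 \<le> n" using card_mono[OF _ sub] by simp
      have "real n / 4 \<le> real (card D2)" using Bd0(3)[OF d0, of 2] by (simp add: D2_def)
      then show "D2 \<noteq> {}" using n by auto
    qed
    show "(\<integral>\<^sup>+w. ennreal (1 - ada_HC_test n p q thalg etalg dflt (w, d)) \<partial>PiM {1..n} M) \<le>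
        emeasure (PiM {i\<in>{1..n}. d i = 0} M) (bad_estimates p q thalg etalg \<theta> \<eta> g (PiM {i\<in>{1..n}. d i = 0} M) {i\<in>{1..n}. d i = 0})
        + ennreal (c1 / h\<^sup>2 + 2 / h\<^sup>2)"
    proof (rule conditional_bound[OF zs refl refl refl _ _ _ refl, where f = "\<lambda>x. 1 - x" and d = d, folded M_def D2_def J_def])
      show "real n / 4 \<le> real (card {i\<in>{1..n}. d i = 0})" "real n / 4 \<le> real (card {i\<in>{1..n}. d i = 1})" "real n / 4 \<le> real (card D2)"
        unfolding D2_def using Bd0(3)[OF d0] by auto
      show "0 \<le> 2 / h\<^sup>2" using h by simp
      fix v u a b assume close: "close_estimates v u a b"
      then have vu: "vnorm p v \<noteq> 0" "vnorm q u \<noteq> 0" and nz: "proj p v \<theta> \<noteq> 0" "proj q u \<eta> \<noteq> 0"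
        and cl: "\<bar>a - \<bar>proj p v \<theta>\<bar>\<bar> \<le> h / sqrt (real n)" "\<bar>b - \<bar>proj q u \<eta>\<bar>\<bar> \<le> h / sqrt (real n)"
        and ab: "a > 0" "b > 0"
        and near_ab: "\<bar>a / K - \<alpha>\<bar> \<le> \<rho>" "\<bar>b / K - \<beta>0\<bar> \<le> \<rho>" "\<bar>\<bar>proj p v \<theta>\<bar> / K - \<alpha>\<bar> \<le> \<rho>" "\<bar>\<bar>proj q u \<eta>\<bar> / K - \<beta>0\<bar> \<le> \<rho>"
        using nbhd[of a b] by (auto simp: close_estimates_def)
      define S where "S = S_tail n (r_hat n a b) (s_hat n a b) (\<tau> * K)"
      define p1 where "p1 = C_tail \<bar>proj p v \<theta>\<bar> (- \<bar>proj q u \<eta>\<bar>) a b (\<tau> * K * K)"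
      have SP: "S \<le> S0" "P1 \<le> p1" using wit[OF near_ab] by (simp_all add: S_def p1_def)
      have S_pos: "S > 0" unfolding S_def S_tail_eq_C_tail[OF ab n] by (rule C_tail_pos[OF ab])
      have P1_pos: "P1 > 0" using SP(1) S_pos num(2) by linarith
      define R where "R = (\<lambda>e B. measure (PiM J M) B \<le> 1 / h\<^sup>2 \<and> (\<forall>w\<in>space (PiM J M) - B.
           HC_stat n (C_sgn e) D2 (\<lambda>i. proj p v (fst (w i))) (\<lambda>i. proj q u (snd (w i))) a b > ereal (ln (real n) ^ 3)))"
      \<comment> \<open>The minimum exceeds the threshold only if both statistics do, so an
        exceptional set is found for each sign \<open>e\<close>.\<close>
      have ex_B: "\<exists>B\<in>sets (PiM J M). R e B" if e: "e = 1 \<or> e = -1" for e :: real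
      proof -
        define H where "H = {i\<in>D2. z i * proj p v \<theta> * (e * \<sigma> i * proj q u \<eta>) < 0}"
        define s where "s = sgn (e * proj p v \<theta> * proj q u \<eta>)"
        have X: "e * proj p v \<theta> * proj q u \<eta> \<noteq> 0" using nz e by auto
        have s: "s = 1 \<or> s = -1" using X by (auto simp: s_def sgn_if)
        have H_iff: "z i * proj p v \<theta> * (e * \<sigma> i * proj q u \<eta>) < 0 \<longleftrightarrow> z i \<noteq> s * \<sigma> i"
          and nonzero: "z i * proj p v \<theta> * (e * \<sigma> i * proj q u \<eta>) \<noteq> 0" if "i \<in> {1..n}" for i
        proof -
          have eq: "z i * proj p v \<theta> * (e * \<sigma> i * proj q u \<eta>) = z i * \<sigma> i * (e * proj p v \<theta> * proj q u \<eta>)" by (simp only: mult_ac)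
          have "x * y * X < 0 \<longleftrightarrow> x \<noteq> sgn X * y" if "X \<noteq> 0" "x = 1 \<or> x = -1" "y = 1 \<or> y = -1" for x y X :: real
            using that by (auto simp: sgn_if)
          then show "z i * proj p v \<theta> * (e * \<sigma> i * proj q u \<eta>) < 0 \<longleftrightarrow> z i \<noteq> s * \<sigma> i"
            unfolding eq s_def using X sgn[OF that] by blast
          show "z i * proj p v \<theta> * (e * \<sigma> i * proj q u \<eta>) \<noteq> 0" unfolding eq using X sgn[OF that] by auto
        qed
        have H_eq: "H = {i\<in>Hs s. d i = 2}" using H_iff by (auto simp: H_def D2_def Hs_def)
        have "d \<in> space (split_law n) - Bs s" using d s by (auto simp: Bd_def)
        then have cardH: "real n * \<epsilon> / 4 \<le> real (card H)" unfolding H_eq using Bs[OF s] by blast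
        have Hp: "real n * \<epsilon> / 4 * P1 \<le> real (card H) * p1"
          using cardH SP(2) ne P1_pos by (intro mult_mono) auto
        show ?thesis unfolding R_def M_def
        proof (rule HC_stat_alternative[OF n h(1,2) vu ab cl, where \<tau> = \<tau> and H = H])
          show "finite J" by (simp add: J_def)
          show "D2 \<subseteq> J" "D2 \<noteq> {}" "card D2 \<le> n" by (rule D2)+
          show "H \<subseteq> D2" by (auto simp: H_def)
          show "e = 1 \<or> e = -1" by (rule e)
          show "(z i = 1 \<or> z i = -1) \<and> (\<sigma> i = 1 \<or> \<sigma> i = -1)" if "i \<in> D2" for i using sgn D2(4) that by blast
          show "0 < z i * proj p v \<theta> * (e * \<sigma> i * proj q u \<eta>)" if "i \<in> D2 - H" for i
          proof -
            have "i \<in> {1..n}" using that D2(4) by blast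
            then have "z i * proj p v \<theta> * (e * \<sigma> i * proj q u \<eta>) \<noteq> 0" by (rule nonzero)
            moreover have "\<not> z i * proj p v \<theta> * (e * \<sigma> i * proj q u \<eta>) < 0" using that by (simp add: H_def)
            ultimately show ?thesis by linarith
          qed
          show "z i * proj p v \<theta> * (e * \<sigma> i * proj q u \<eta>) < 0" if "i \<in> H" for i using that by (simp add: H_def)
          show "\<bar>\<tau> * sqrt (2 * ln (real n))\<bar> \<le> ln (real n)" using num(1) unfolding K_def .
          show "S_tail n (r_hat n a b) (s_hat n a b) (\<tau> * sqrt (2 * ln (real n)))
             \<le> C_tail \<bar>proj p v \<theta>\<bar> (- \<bar>proj q u \<eta>\<bar>) a b (\<tau> * sqrt (2 * ln (real n)) * sqrt (2 * ln (real n))) / 2"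
            using SP num(2) unfolding S_def p1_def K_def by linarith
          show "64 * h\<^sup>2 \<le> real (card H) * C_tail \<bar>proj p v \<theta>\<bar> (- \<bar>proj q u \<eta>\<bar>) a b (\<tau> * sqrt (2 * ln (real n)) * sqrt (2 * ln (real n)))"
            using Hp num(3) unfolding p1_def K_def by linarith
          have "real (card D2) * S \<le> real n * S0" using D2(2) SP(1) S_pos by (intro mult_mono) auto
          then have "4 * (ln (real n) ^ 3 + 3 * h) * sqrt (real (card D2) * S) \<le> 4 * (ln (real n) ^ 3 + 3 * h) * sqrt (real n * S0)"
            using h L by (intro mult_left_mono) auto
          then show "4 * (ln (real n) ^ 3 + 3 * h) * sqrt (real (card D2) * S_tail n (r_hat n a b) (s_hat n a b) (\<tau> * sqrt (2 * ln (real n))))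
             < real (card H) * C_tail \<bar>proj p v \<theta>\<bar> (- \<bar>proj q u \<eta>\<bar>) a b (\<tau> * sqrt (2 * ln (real n)) * sqrt (2 * ln (real n)))"
            using Hp num(4) unfolding S_def p1_def K_def by linarith
        qed
      qed
      obtain B where "\<And>e. e = 1 \<or> e = -1 \<Longrightarrow> B e \<in> sets (PiM J M) \<and> R e (B e)"
        using ex_B by metis
      note B = this[unfolded R_def]
      have B_sets: "B 1 \<in> sets (PiM J M)" "B (-1) \<in> sets (PiM J M)"
        and B_meas: "measure (PiM J M) (B 1) \<le> 1 / h\<^sup>2" "measure (PiM J M) (B (-1)) \<le> 1 / h\<^sup>2"
        using B[of 1] B[of "-1"] by blast+
      show "\<exists>B\<in>sets (PiM J M). measure (PiM J M) B \<le> 2 / h\<^sup>2 \<and>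
        (\<forall>w\<in>space (PiM J M) - B. 1 - HC_value D2 v u a b w = 0)"
      proof (rule bexI[of _ "B 1 \<union> B (-1)"], intro conjI ballI)
        have "measure (PiM J M) (B 1 \<union> B (-1)) \<le> measure (PiM J M) (B 1) + measure (PiM J M) (B (-1))"
          by (intro measure_Un_le B_sets)
        then show "measure (PiM J M) (B 1 \<union> B (-1)) \<le> 2 / h\<^sup>2" using B_meas by simp
        show "B 1 \<union> B (-1) \<in> sets (PiM J M)" by (intro sets.Un B_sets)
        fix w assume w: "w \<in> space (PiM J M) - (B 1 \<union> B (-1))"
        have "HC_stat n (C_sgn e) D2 (\<lambda>i. proj p v (fst (w i))) (\<lambda>i. proj q u (snd (w i))) a b > ereal (ln (real n) ^ 3)"
          if "e = 1 \<or> e = -1" for e using B[OF that] w that by blast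
        then show "1 - HC_value D2 v u a b w = 0" unfolding HC_value_def by simp
      qed
    qed (use meas in auto)
  qed
qed

end

lemma finite_signs: "finite (signs n)"
  unfolding signs_def by (intro finite_PiE) auto

lemma ell_null_exists: "\<exists>z \<in> signs n. ell n z z = 0"
  by (rule bexI[of _ "\<lambda>i\<in>{1..n}. 1"]) (auto simp: ell_def signs_def)

text \<open>Half of the signs are flipped, so about half of the indices mismatch under either global
  sign. The bound on the second supremum in \<open>risk\<close> needs its index set to be
  nonempty.\<close>

lemma ell_alternative_exists:
  assumes n: "n \<ge> 2" and eps: "\<epsilon> < 1 / 3"
  shows "\<exists>z\<in>signs n. \<exists>\<sigma>\<in>signs n. ell n z \<sigma> > \<epsilon>"
proof -
  define z :: "nat \<Rightarrow> real" where "z = (\<lambda>i\<in>{1..n}. 1)"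
  define \<sigma> :: "nat \<Rightarrow> real" where "\<sigma> = (\<lambda>i\<in>{1..n}. if i \<le> n div 2 then 1 else -1)"
  have "{i\<in>{1..n}. z i \<noteq> \<sigma> i} = {Suc (n div 2)..n}" by (auto simp: z_def \<sigma>_def split: if_splits)
  then have 1: "card {i\<in>{1..n}. z i \<noteq> \<sigma> i} = n - n div 2" by simp
  have "{i\<in>{1..n}. z i \<noteq> - \<sigma> i} = {1..n div 2}" by (auto simp: z_def \<sigma>_def split: if_splits)
  then have 2: "card {i\<in>{1..n}. z i \<noteq> - \<sigma> i} = n div 2" by simp
  have "n \<le> 3 * (n div 2)" "n \<le> 3 * (n - n div 2)" using n by presburger+
  then have "1 / 3 \<le> real (n div 2) / real n" "1 / 3 \<le> real (n - n div 2) / real n"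
    using n by (simp_all add: field_simps)
  note third = this
  have "\<epsilon> < real (n div 2) / real n" by (rule less_le_trans[OF eps third(1)])
  moreover have "\<epsilon> < real (n - n div 2) / real n" by (rule less_le_trans[OF eps third(2)])
  ultimately have "ell n z \<sigma> > \<epsilon>" unfolding ell_def 1 2 min_less_iff_conj by blast
  moreover have "z \<in> signs n" "\<sigma> \<in> signs n" by (auto simp: z_def \<sigma>_def signs_def)
  ultimately show ?thesis by blast
qed

context adaptive_setting
begin

lemma risk_bound:
  fixes \<epsilon> B :: real
  assumes eps: "0 < \<epsilon>" "\<epsilon> < 1 / 3"
    and B: "\<And>z \<sigma>. z \<in> signs n \<Longrightarrow> \<sigma> \<in> signs n \<Longrightarrow> bad_prob z \<sigma> \<le> B"
    and wit: "\<And>a b a1 b1. \<bar>a / K - \<alpha>\<bar> \<le> \<rho> \<Longrightarrow> \<bar>b / K - \<beta>0\<bar> \<le> \<rho> \<Longrightarrow> \<bar>a1 / K - \<alpha>\<bar> \<le> \<rho> \<Longrightarrow> \<bar>b1 / K - \<beta>0\<bar> \<le> \<rho> \<Longrightarrow>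
      S_tail n (r_hat n a b) (s_hat n a b) (\<tau> * K) \<le> S0 \<and> P1 \<le> C_tail a1 (- b1) a b (\<tau> * K * K)"
    and num: "\<bar>\<tau> * K\<bar> \<le> ln (real n)" "S0 \<le> P1 / 2" "64 * h\<^sup>2 \<le> real n * \<epsilon> / 4 * P1"
      "4 * (ln (real n) ^ 3 + 3 * h) * sqrt (real n * S0) < real n * \<epsilon> / 4 * P1"
  shows "risk n p q (ada_HC_test n p q thalg etalg dflt) \<theta> \<eta> \<epsilon> \<le>
    2 * B + (192 / real n + 64 / (real n * \<epsilon>) + 4 / (real n)\<^sup>2 + 6 / h + (2 * c1 + 2) / h\<^sup>2)"
    and "0 \<le> risk n p q (ada_HC_test n p q thalg etalg dflt) \<theta> \<eta> \<epsilon>"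
proof -
  let ?T = "ada_HC_test n p q thalg etalg dflt"
  define A where "A = {(z, \<sigma>). z \<in> signs n \<and> \<sigma> \<in> signs n \<and> ell n z \<sigma> = 0}"
  define A' where "A' = {(z, \<sigma>). z \<in> signs n \<and> \<sigma> \<in> signs n \<and> ell n z \<sigma> > \<epsilon>}"
  have fin: "finite A" "finite A'"
    unfolding A_def A'_def
    by (rule finite_subset[OF _ finite_cartesian_product[OF finite_signs[of n] finite_signs[of n]]], auto)+
  have ne: "A \<noteq> {}" "A' \<noteq> {}"
    using ell_null_exists[of n] ell_alternative_exists[OF n eps(2)] by (auto simp: A_def A'_def)
  define F where "F = (\<lambda>(z, \<sigma>). \<integral>\<omega>. ?T \<omega> \<partial>law n p q \<theta> \<eta> z \<sigma>)"
  define G where "G = (\<lambda>(z, \<sigma>). \<integral>\<omega>. 1 - ?T \<omega> \<partial>law n p q \<theta> \<eta> z \<sigma>)"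
  have risk: "risk n p q ?T \<theta> \<eta> \<epsilon> = (SUP x\<in>A. F x) + (SUP x\<in>A'. G x)"
    unfolding risk_def A_def A'_def F_def G_def ..
  have "(SUP x\<in>A. F x) \<le> 96 / real n + B + (c1 / h\<^sup>2 + (4 / (real n)\<^sup>2 + 6 / h))"
  proof (rule cSUP_least[OF ne(1)])
    fix x assume "x \<in> A"
    then obtain z \<sigma> where x: "x = (z, \<sigma>)" "z \<in> signs n" "\<sigma> \<in> signs n" "ell n z \<sigma> = 0" by (auto simp: A_def)
    show "F x \<le> 96 / real n + B + (c1 / h\<^sup>2 + (4 / (real n)\<^sup>2 + 6 / h))"
      using null_bound[OF x(2,3,4)] B[OF x(2,3)] unfolding x(1) F_def by simp
  qed
  moreover have "(SUP x\<in>A'. G x) \<le> (96 / real n + 64 / (real n * \<epsilon>)) + B + (c1 / h\<^sup>2 + 2 / h\<^sup>2)"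
  proof (rule cSUP_least[OF ne(2)])
    fix x assume "x \<in> A'"
    then obtain z \<sigma> where x: "x = (z, \<sigma>)" "z \<in> signs n" "\<sigma> \<in> signs n" "ell n z \<sigma> > \<epsilon>" by (auto simp: A'_def)
    show "G x \<le> (96 / real n + 64 / (real n * \<epsilon>)) + B + (c1 / h\<^sup>2 + 2 / h\<^sup>2)"
      using alternative_bound[OF x(2,3,4) eps(1) wit num] B[OF x(2,3)] unfolding x(1) G_def by simp
  qed
  ultimately show "risk n p q ?T \<theta> \<eta> \<epsilon> \<le>
    2 * B + (192 / real n + 64 / (real n * \<epsilon>) + 4 / (real n)\<^sup>2 + 6 / h + (2 * c1 + 2) / h\<^sup>2)"
    unfolding risk by (simp add: add_divide_distrib)
  have "0 \<le> F x" for x unfolding F_def by (auto split: prod.split intro!: Bochner_Integration.integral_nonneg test_range)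
  then have "0 \<le> (SUP x\<in>A. F x)" using ne(1) fin(1) by (metis (no_types, lifting) cSUP_upper bdd_above_finite finite_imageI ex_in_conv order_trans)
  moreover have "0 \<le> G x" for x
    unfolding G_def using test_range(2) by (auto split: prod.split intro!: Bochner_Integration.integral_nonneg)
  then have "0 \<le> (SUP x\<in>A'. G x)" using ne(2) fin(2) by (metis (no_types, lifting) cSUP_upper bdd_above_finite finite_imageI ex_in_conv order_trans)
  ultimately show "0 \<le> risk n p q ?T \<theta> \<eta> \<epsilon>" unfolding risk by simp
qed

end

subsection \<open>Asymptotics\<close>

text \<open>Uniform in dimensions, parameters and algorithms for given scaled norms, because the
  norms in the theorem are determined only up to exchange and their order may change with
  \<open>n\<close>: the asymptotic statement is proved for both orders and then applied at each
  \<open>n\<close>.\<close>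

definition uniform_risk_bound :: "nat \<Rightarrow> real \<Rightarrow> real \<Rightarrow> real \<Rightarrow> real \<Rightarrow> real \<Rightarrow> bool" where
  "uniform_risk_bound n \<beta> \<gamma> \<alpha> \<beta>0 d \<longleftrightarrow> (\<forall>p q \<theta> \<eta> thalg etalg dflt B.
     measurable_algorithm n p q p thalg \<longrightarrow> measurable_algorithm n p q q etalg \<longrightarrow> (\<forall>\<omega>. 0 \<le> dflt \<omega> \<and> dflt \<omega> \<le> 1) \<longrightarrow>
     vnorm p \<theta> = \<alpha> * sqrt (2 * ln (real n)) \<longrightarrow> vnorm q \<eta> = \<beta>0 * sqrt (2 * ln (real n)) \<longrightarrow>
     (\<forall>z\<in>signs n. \<forall>\<sigma>\<in>signs n. measure (law n p q \<theta> \<eta> z \<sigma>) {\<omega> \<in> space (law n p q \<theta> \<eta> z \<sigma>).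
        max (loss p (estimate n thalg \<omega>) \<theta>) (loss q (estimate n etalg \<omega>) \<eta>) > real n powr (- \<gamma>)} \<le> B) \<longrightarrow>
     0 \<le> risk n p q (ada_HC_test n p q thalg etalg dflt) \<theta> \<eta> (real n powr (- \<beta>)) \<and>
     risk n p q (ada_HC_test n p q thalg etalg dflt) \<theta> \<eta> (real n powr (- \<beta>)) \<le> 2 * B + d)"

lemma eventually_risk_bound:
  fixes r s \<beta> \<gamma> \<alpha> \<beta>0 :: real
  assumes r: "r > 0" and s: "s \<ge> 0" and beta: "\<beta> > 0" "\<beta> < beta_star r s" and gam: "\<gamma> > 0"
    and ab: "\<alpha> > 0" "\<beta>0 > 0" "2 * \<alpha> * \<beta>0 = sqrt (r + s) * sqrt r" "\<bar>\<alpha>\<^sup>2 - \<beta>0\<^sup>2\<bar> = sqrt (r + s) * sqrt s"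
  shows "\<exists>\<delta>. \<delta> \<longlonglongrightarrow> 0 \<and> (\<forall>\<^sub>F n in sequentially. uniform_risk_bound n \<beta> \<gamma> \<alpha> \<beta>0 (\<delta> n))"
proof -
  obtain \<tau> \<kappa> x y A0 E1 \<rho>' where wit: "0 \<le> \<kappa>" "A0 \<le> 1" "E1 < A0" "\<beta> < 1/2 + A0 / 2 - E1" "\<rho>' > 0"
    and wit1: "\<And>a' b'. \<bar>a' - \<alpha>\<bar> \<le> \<rho>' \<Longrightarrow> \<bar>b' - \<beta>0\<bar> \<le> \<rho>' \<Longrightarrow> a' > 0 \<and> b' > 0
      \<and> \<kappa> \<le> sqrt ((2 * a' * b')\<^sup>2 / (a'\<^sup>2 + b'\<^sup>2) + (a'\<^sup>2 - b'\<^sup>2)\<^sup>2 / (a'\<^sup>2 + b'\<^sup>2)) - sqrt ((a'\<^sup>2 - b'\<^sup>2)\<^sup>2 / (a'\<^sup>2 + b'\<^sup>2))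
      \<and> 0 \<le> \<tau> + \<kappa> * sqrt ((2 * a' * b')\<^sup>2 / (a'\<^sup>2 + b'\<^sup>2) + (a'\<^sup>2 - b'\<^sup>2)\<^sup>2 / (a'\<^sup>2 + b'\<^sup>2))
      \<and> A0 \<le> (\<tau> + \<kappa> * sqrt ((2 * a' * b')\<^sup>2 / (a'\<^sup>2 + b'\<^sup>2) + (a'\<^sup>2 - b'\<^sup>2)\<^sup>2 / (a'\<^sup>2 + b'\<^sup>2)))\<^sup>2 / ((2 * a' * b')\<^sup>2 / (a'\<^sup>2 + b'\<^sup>2) + \<kappa>\<^sup>2)
      \<and> (\<bar>x - a'\<bar> + \<rho>')\<^sup>2 + (\<bar>y + b'\<bar> + \<rho>')\<^sup>2 \<le> E1"
    and wit2: "\<And>a' b' x' y'. \<bar>a' - \<alpha>\<bar> \<le> \<rho>' \<Longrightarrow> \<bar>b' - \<beta>0\<bar> \<le> \<rho>' \<Longrightarrow> \<bar>x' - x\<bar> \<le> \<rho>' \<Longrightarrow> \<bar>y' - y\<bar> \<le> \<rho>' \<Longrightarrow> \<tau> < C_minus x' y' a' b'"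
    by (rule beta_star_witness_robust[OF r s beta(2) ab]) (rule that)
  define \<mu> where "\<mu> = min \<alpha> \<beta>0"
  have \<mu>: "\<mu> > 0" "\<mu> \<le> \<alpha>" "\<mu> \<le> \<beta>0" using ab by (auto simp: \<mu>_def)
  \<comment> \<open>The cap \<open>\<mu> / 2\<close> keeps the scaled estimates between half and
    twice their limits, which is what \<open>r0\<close> is built from.\<close>
  define \<rho> where "\<rho> = min \<rho>' (\<mu> / 2)"
  have \<rho>: "\<rho> > 0" "\<rho> \<le> \<rho>'" "\<rho> \<le> \<mu> / 2" using wit(5) \<mu> by (auto simp: \<rho>_def)
  define r0 where "r0 = (2 * (\<alpha> / 2) * (\<beta>0 / 2))\<^sup>2 / ((2 * \<alpha>)\<^sup>2 + (2 * \<beta>0)\<^sup>2)"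
  have r0: "r0 > 0" using ab by (simp add: r0_def add_pos_pos)
  \<comment> \<open>\<open>d1\<close> is the exponent in the lower bound for the expected number of
    mismatched exceedances; \<open>d2\<close> is what remains after division by the null standard
    deviation, of order \<open>n powr ((1 - A0) / 2)\<close>. The witness inequality says that
    \<open>d2\<close> is positive.\<close>
  define d1 where "d1 = 1 - \<beta> - E1"
  define d2 where "d2 = d1 - (1 - A0) / 2"
  have E1: "E1 \<ge> 0"
  proof -
    have "(\<bar>x - \<alpha>\<bar> + \<rho>')\<^sup>2 + (\<bar>y + \<beta>0\<bar> + \<rho>')\<^sup>2 \<le> E1" using wit1[of \<alpha> \<beta>0] wit(5) by auto
    then show ?thesis by (smt (verit) zero_le_power2)
  qed
  have d: "d1 > 0" "d2 > 0" "A0 - E1 > 0" "1 - \<beta> > 0"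
    using wit E1 by (auto simp: d1_def d2_def field_simps)
  define h where "h = (\<lambda>n :: nat. ln (real n) powr (1 / 8))" \<comment> \<open>any $h \to \infty$ slower than $(\log n)^{2/3}$ would do\<close>
  define K where "K = (\<lambda>n :: nat. sqrt (2 * ln (real n)))"
  define c where "c = 16 * (1 + 4 * \<alpha>\<^sup>2) / \<mu>\<^sup>2 + 16 * (1 + 4 * \<beta>0\<^sup>2) / \<mu>\<^sup>2"
  define \<delta> where "\<delta> = (\<lambda>n. 192 / real n + 64 / (real n * real n powr (- \<beta>)) + 4 / (real n)\<^sup>2 + 6 / h n + (2 * c + 2) / (h n)\<^sup>2)"
  have "\<delta> \<longlonglongrightarrow> 0"
  proof -
    have "(\<lambda>n. 192 / real n) \<longlonglongrightarrow> 0" "(\<lambda>n. 4 / (real n)\<^sup>2) \<longlonglongrightarrow> 0" "(\<lambda>n. 6 / h n) \<longlonglongrightarrow> 0" "(\<lambda>n. 1 / (h n)\<^sup>2) \<longlonglongrightarrow> 0"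
      unfolding h_def by real_asymp+
    moreover have "(\<lambda>n. 64 / (real n * real n powr (- \<beta>))) \<longlonglongrightarrow> 0"
    proof -
      have "(\<lambda>n. 64 * real n powr (- (1 - \<beta>))) \<longlonglongrightarrow> 0" using d(4) by real_asymp
      moreover have "\<forall>\<^sub>F n in sequentially. 64 * real n powr (- (1 - \<beta>)) = 64 / (real n * real n powr (- \<beta>))"
        using eventually_gt_at_top[of 0]
      proof eventually_elim
        case (elim n)
        then have eq: "real n * real n powr (- \<beta>) = real n powr (1 - \<beta>)" by (simp add: powr_diff powr_minus divide_inverse)
        show ?case unfolding eq by (simp only: powr_minus divide_inverse)
      qed
      ultimately show ?thesis by (rule Lim_transform_eventually)
    qed
    ultimately have "\<delta> \<longlonglongrightarrow> 0 + 0 + 0 + 0 + (2 * c + 2) * 0"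
      unfolding \<delta>_def by (subst divide_inverse, subst inverse_eq_divide) (intro tendsto_add tendsto_mult tendsto_const)
    then show ?thesis by simp
  qed
  moreover have "\<forall>\<^sub>F n in sequentially. uniform_risk_bound n \<beta> \<gamma> \<alpha> \<beta>0 (\<delta> n)"
  proof -
    \<comment> \<open>These facts are cited by position below: \<open>elim(1)\<close> to
      \<open>elim(9)\<close> are conditions of the locale, \<open>elim(10)\<close> to
      \<open>elim(15)\<close> serve the box around the witness point and the final numerical
      comparison.\<close>
    have "\<forall>\<^sub>F n :: nat in sequentially. n \<ge> 2" by (rule eventually_ge_at_top)
    moreover have "\<forall>\<^sub>F n :: nat in sequentially. ln (real n) \<ge> 1" by real_asymp
    moreover have "\<forall>\<^sub>F n :: nat in sequentially. h n \<ge> 1" unfolding h_def by real_asymp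
    moreover have "\<forall>\<^sub>F n :: nat in sequentially. 2 * (h n)\<^sup>2 \<le> real n" unfolding h_def by real_asymp
    moreover have "\<forall>\<^sub>F n :: nat in sequentially. 25 * h n ^ 3 \<le> (ln (real n))\<^sup>2" unfolding h_def by real_asymp
    moreover have "\<forall>\<^sub>F n :: nat in sequentially. 2 * real n powr (- \<gamma>) \<le> \<mu> * K n / 2" unfolding K_def using gam \<mu>(1) by real_asymp
    moreover have "\<forall>\<^sub>F n :: nat in sequentially. h n / sqrt (real n) \<le> \<mu> * K n / 2" unfolding K_def h_def using \<mu>(1) by real_asymp
    moreover have "\<forall>\<^sub>F n :: nat in sequentially. h n / sqrt (real n) + 2 * real n powr (- \<gamma>) \<le> \<rho> * K n"
    proof -
      have "\<forall>\<^sub>F n :: nat in sequentially. h n / sqrt (real n) \<le> \<rho> / 2 * K n" unfolding K_def h_def using \<rho>(1) by real_asymp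
      moreover have "\<forall>\<^sub>F n :: nat in sequentially. 2 * real n powr (- \<gamma>) \<le> \<rho> / 2 * K n" unfolding K_def using gam \<rho>(1) by real_asymp
      ultimately show ?thesis by eventually_elim argo
    qed
    moreover have "\<forall>\<^sub>F n :: nat in sequentially. 2 * ln (real n) * (1 / sqrt r0) * h n ^ 4 \<le> real n"
    proof -
      have "1 / sqrt r0 > 0" using r0 by simp
      then show ?thesis unfolding h_def by real_asymp
    qed
    moreover have "\<forall>\<^sub>F n :: nat in sequentially. sqrt (2 * pi) \<le> 2 * K n * \<rho>" unfolding K_def using \<rho>(1) by real_asymp
    moreover have "\<forall>\<^sub>F n :: nat in sequentially. \<bar>\<tau>\<bar> * K n \<le> ln (real n)"
    proof -
      have "\<forall>\<^sub>F n :: nat in sequentially. (\<bar>\<tau>\<bar> + 1) * K n \<le> ln (real n)"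
      proof -
        have "\<bar>\<tau>\<bar> + 1 > 0" by linarith
        then show ?thesis unfolding K_def by real_asymp
      qed
      moreover have "\<forall>\<^sub>F n :: nat in sequentially. 0 \<le> K n" unfolding K_def by real_asymp
      ultimately show ?thesis by eventually_elim argo
    qed
    moreover have "\<forall>\<^sub>F n :: nat in sequentially. 4 \<le> real n powr (A0 - E1)" using d(3) by real_asymp
    moreover have "\<forall>\<^sub>F n :: nat in sequentially. 64 * (h n)\<^sup>2 \<le> real n powr d1 / 4" unfolding h_def using d(1) by real_asymp
    moreover have "\<forall>\<^sub>F n :: nat in sequentially. 4 * (ln (real n) ^ 3 + 3 * h n) * sqrt 2 < real n powr d2 / 4" unfolding h_def using d(2) by real_asymp
    moreover have "\<forall>\<^sub>F n :: nat in sequentially. real n powr (- \<beta>) < 1 / 3" using beta(1) by real_asymp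
    ultimately show ?thesis
    proof eventually_elim
      case (elim n)
      have n: "n \<ge> 2" and n0: "real n > 0" using elim(1) by auto
      have K0: "K n > 0" "(K n)\<^sup>2 = 2 * ln (real n)" using n by (auto simp: K_def)
      have nbhd: "a > 0 \<and> b > 0 \<and> r0 \<le> r_hat n a b" if "\<bar>a / K n - \<alpha>\<bar> \<le> \<rho>" "\<bar>b / K n - \<beta>0\<bar> \<le> \<rho>" for a b
      proof -
        define a' where "a' = a / K n"
        define b' where "b' = b / K n"
        have a': "\<alpha> / 2 \<le> a'" "a' \<le> 2 * \<alpha>" and b': "\<beta>0 / 2 \<le> b'" "b' \<le> 2 * \<beta>0"
          using that \<rho>(3) \<mu> unfolding a'_def b'_def by linarith+
        have pos: "a' > 0" "b' > 0" using a'(1) b'(1) ab by linarith+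
        have "2 * (\<alpha> / 2) * (\<beta>0 / 2) \<le> 2 * a' * b'" using a'(1) b'(1) ab by (intro mult_mono) auto
        then have "(2 * (\<alpha> / 2) * (\<beta>0 / 2))\<^sup>2 \<le> (2 * a' * b')\<^sup>2" using ab by (intro power_mono) auto
        moreover have "a'\<^sup>2 + b'\<^sup>2 \<le> (2 * \<alpha>)\<^sup>2 + (2 * \<beta>0)\<^sup>2" using a' b' pos by (intro add_mono power_mono) auto
        ultimately have "r0 \<le> (2 * a' * b')\<^sup>2 / (a'\<^sup>2 + b'\<^sup>2)"
          unfolding r0_def using pos by (intro frac_le) (auto simp: add_pos_pos)
        then have "r0 \<le> r_hat n a b" unfolding r_hat_s_hat_scale(1)[OF n K_def[THEN fun_cong]] a'_def b'_def .
        moreover have "a > 0" "b > 0" using pos K0 by (auto simp: a'_def b'_def zero_less_divide_iff)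
        ultimately show ?thesis by blast
      qed
      have witness: "S_tail n (r_hat n a b) (s_hat n a b) (\<tau> * K n) \<le> 2 * real n powr (- A0) \<and> real n powr (- E1) \<le> C_tail a1 (- b1) a b (\<tau> * K n * K n)"
        if "\<bar>a / K n - \<alpha>\<bar> \<le> \<rho>" "\<bar>b / K n - \<beta>0\<bar> \<le> \<rho>" "\<bar>a1 / K n - \<alpha>\<bar> \<le> \<rho>" "\<bar>b1 / K n - \<beta>0\<bar> \<le> \<rho>" for a b a1 b1
      proof
        have cl: "\<bar>a / K n - \<alpha>\<bar> \<le> \<rho>'" "\<bar>b / K n - \<beta>0\<bar> \<le> \<rho>'" "\<bar>a1 / K n - \<alpha>\<bar> \<le> \<rho>'" "\<bar>b1 / K n - \<beta>0\<bar> \<le> \<rho>'"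
          using that \<rho>(2) by linarith+
        note w = wit1[OF cl(1,2), folded r_hat_s_hat_scale[OF n K_def[THEN fun_cong]]]
        have r_pos: "r_hat n a b > 0" using nbhd[OF that(1,2)] r0 by linarith
        have s_nn: "s_hat n a b \<ge> 0" using n by (simp add: s_hat_def)
        have "S_tail n (r_hat n a b) (s_hat n a b) (\<tau> * K n) \<le> 2 * real n powr (- ((\<tau> + \<kappa> * sqrt (r_hat n a b + s_hat n a b))\<^sup>2 / (r_hat n a b + \<kappa>\<^sup>2)))"
          unfolding K_def using w wit(1) by (intro S_tail_le r_pos s_nn n) auto
        also have "\<dots> \<le> 2 * real n powr (- A0)"
          using w n by (intro mult_left_mono powr_mono) auto
        finally show "S_tail n (r_hat n a b) (s_hat n a b) (\<tau> * K n) \<le> 2 * real n powr (- A0)" .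
        have "exp (- E1 * ln (real n)) \<le> C_tail a1 (- b1) a b (\<tau> * K n * K n)"
        proof (rule C_tail_box_lower[OF K0 _ \<rho>(1), where x = x and y = y])
          show "sqrt (2 * pi) \<le> 2 * K n * \<rho>" by (rule elim(10))
          show "\<tau> < C_minus x' y' (a / K n) (b / K n)" if "\<bar>x' - x\<bar> \<le> \<rho>" "\<bar>y' - y\<bar> \<le> \<rho>" for x' y'
            using that \<rho>(2) by (intro wit2 cl) auto
          have "(\<bar>x - a1 / K n\<bar> + \<rho>)\<^sup>2 + (\<bar>y + b1 / K n\<bar> + \<rho>)\<^sup>2 \<le> (\<bar>x - a1 / K n\<bar> + \<rho>')\<^sup>2 + (\<bar>y + b1 / K n\<bar> + \<rho>')\<^sup>2"
            using \<rho> by (intro add_mono power_mono) auto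
          also have "\<dots> \<le> E1" using wit1[OF cl(3,4)] by blast
          finally show "(\<bar>x - a1 / K n\<bar> + \<rho>)\<^sup>2 + (\<bar>y + b1 / K n\<bar> + \<rho>)\<^sup>2 \<le> E1" .
          show "0 \<le> ln (real n)" using n by simp
        qed
        then show "real n powr (- E1) \<le> C_tail a1 (- b1) a b (\<tau> * K n * K n)" using n by (simp add: powr_def)
      qed
      have n_d1: "real n * real n powr (- \<beta>) / 4 * real n powr (- E1) = real n powr d1 / 4"
      proof -
        have "real n powr d1 = real n powr 1 * real n powr (- \<beta>) * real n powr (- E1)"
          unfolding powr_add[symmetric] by (simp add: d1_def)
        then show ?thesis using n by simp
      qed
      have num2: "2 * real n powr (- A0) \<le> real n powr (- E1) / 2"
      proof -
        have "real n powr (- E1) = real n powr (A0 - E1) * real n powr (- A0)" unfolding powr_add[symmetric] by simp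
        moreover have "4 * real n powr (- A0) \<le> real n powr (A0 - E1) * real n powr (- A0)" using elim(12) by (intro mult_right_mono) auto
        ultimately show ?thesis by linarith
      qed
      have num4: "4 * (ln (real n) ^ 3 + 3 * h n) * sqrt (real n * (2 * real n powr (- A0))) < real n powr d1 / 4"
      proof -
        have "real n * real n powr (- A0) = (real n powr ((1 - A0) / 2))\<^sup>2"
        proof -
          have "real n * real n powr (- A0) = real n powr (1 - A0)" using n by (simp add: powr_diff powr_minus divide_inverse)
          also have "\<dots> = (real n powr ((1 - A0) / 2))\<^sup>2" unfolding power2_eq_square powr_add[symmetric] by simp
          finally show ?thesis .
        qed
        then have "sqrt (real n * (2 * real n powr (- A0))) = sqrt 2 * real n powr ((1 - A0) / 2)"
          by (simp only: mult.left_commute[of "real n" 2] real_sqrt_mult[of 2] real_sqrt_abs abs_of_nonneg[OF powr_ge_zero])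
        moreover have "real n powr d1 = real n powr d2 * real n powr ((1 - A0) / 2)" unfolding powr_add[symmetric] by (simp add: d2_def)
        moreover have "4 * (ln (real n) ^ 3 + 3 * h n) * sqrt 2 * real n powr ((1 - A0) / 2) < real n powr d2 / 4 * real n powr ((1 - A0) / 2)"
          using elim(14) n by (intro mult_strict_right_mono) auto
        ultimately show ?thesis by (simp add: mult.assoc)
      qed
      show ?case unfolding uniform_risk_bound_def
      proof (intro allI impI)
        fix p q \<theta> \<eta> thalg etalg B and dflt :: "sample \<Rightarrow> real"
        assume alg: "measurable_algorithm n p q p thalg" "measurable_algorithm n p q q etalg"
          and dflt: "\<forall>\<omega>. 0 \<le> dflt \<omega> \<and> dflt \<omega> \<le> (1 :: real)"
          and norms: "vnorm p \<theta> = \<alpha> * sqrt (2 * ln (real n))" "vnorm q \<eta> = \<beta>0 * sqrt (2 * ln (real n))"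
          and B: "\<forall>z\<in>signs n. \<forall>\<sigma>\<in>signs n. measure (law n p q \<theta> \<eta> z \<sigma>) {\<omega> \<in> space (law n p q \<theta> \<eta> z \<sigma>).
             max (loss p (estimate n thalg \<omega>) \<theta>) (loss q (estimate n etalg \<omega>) \<eta>) > real n powr (- \<gamma>)} \<le> B"
        interpret adaptive_setting n p q \<theta> \<eta> thalg etalg dflt \<alpha> \<beta>0 "real n powr (- \<gamma>)" "h n" \<rho> r0 "K n"
        proof unfold_locales
          show "K n = sqrt (2 * ln (real n))" by (simp add: K_def)
          show "vnorm p \<theta> = \<alpha> * K n" "vnorm q \<eta> = \<beta>0 * K n" using norms by (simp_all add: K_def)
          show "2 * real n powr (- \<gamma>) \<le> min \<alpha> \<beta>0 * K n / 2" "h n / sqrt (real n) \<le> min \<alpha> \<beta>0 * K n / 2"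
            using elim(6,7) by (simp_all add: \<mu>_def)
          show "h n / sqrt (real n) + 2 * real n powr (- \<gamma>) \<le> \<rho> * K n" by (rule elim(8))
        qed (use alg dflt n elim ab nbhd r0 in auto)
        have bad: "bad_prob z \<sigma> \<le> B" if "z \<in> signs n" "\<sigma> \<in> signs n" for z \<sigma>
          unfolding bad_prob_def using B that by blast
        have t: "\<bar>\<tau> * K n\<bar> \<le> ln (real n)" using elim(11) K0 by (simp add: abs_mult)
        have num3: "64 * (h n)\<^sup>2 \<le> real n * real n powr (- \<beta>) / 4 * real n powr (- E1)" unfolding n_d1 by (rule elim(13))
        have eps: "0 < real n powr (- \<beta>)" using n by simp
        note bounds = risk_bound[OF eps elim(15) bad witness t num2 num3 num4[folded n_d1]]
        have c: "c1 = c" by (simp add: c1_def c_def \<mu>_def)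
        show "0 \<le> risk n p q (ada_HC_test n p q thalg etalg dflt) \<theta> \<eta> (real n powr (- \<beta>)) \<and>
          risk n p q (ada_HC_test n p q thalg etalg dflt) \<theta> \<eta> (real n powr (- \<beta>)) \<le> 2 * B + \<delta> n"
          using bounds unfolding c \<delta>_def by blast
      qed
    qed
  qed
  ultimately show ?thesis by blast
qed

text \<open>With \<open>c = sqrt (r + s)\<close> and \<open>w = sqrt s\<close>, squaring and adding
  the ratios gives \<open>t\<^sup>2 + e\<^sup>2 = 2 * L * c\<^sup>2\<close>, and the second ratio
  gives the absolute difference \<open>2 * L * (c * w)\<close> of the squares. Both ratios are
  symmetric, so an exchange of the norms remains possible.\<close>

lemma norms_from_ratios:
  fixes t e r s L :: real
  assumes t: "t \<ge> 0" "e \<ge> 0" and r: "r > 0" and s: "s \<ge> 0" and L: "L > 0"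
    and eq1: "2 * t * e / sqrt (t\<^sup>2 + e\<^sup>2) = sqrt (2 * r * L)"
    and eq2: "\<bar>t\<^sup>2 - e\<^sup>2\<bar> / sqrt (t\<^sup>2 + e\<^sup>2) = sqrt (2 * s * L)"
  defines "a1 \<equiv> sqrt (sqrt (r + s) * (sqrt (r + s) + sqrt s) / 2)"
    and "a2 \<equiv> sqrt (sqrt (r + s) * (sqrt (r + s) - sqrt s) / 2)"
  shows "t = a1 * sqrt (2 * L) \<and> e = a2 * sqrt (2 * L) \<or> t = a2 * sqrt (2 * L) \<and> e = a1 * sqrt (2 * L)"
proof -
  define c where "c = sqrt (r + s)"
  define w where "w = sqrt s"
  have c: "c > 0" "c\<^sup>2 = r + s" "w \<ge> 0" "w < c" using r s by (auto simp: c_def w_def)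
  define Q where "Q = t\<^sup>2 + e\<^sup>2"
  have "2 * t * e / sqrt Q > 0" using eq1 r L by (simp add: Q_def)
  then have Q: "Q > 0" by (cases "Q = 0") (auto simp: Q_def less_le)
  have sq1: "4 * t\<^sup>2 * e\<^sup>2 / Q = 2 * r * L"
  proof -
    have "(2 * t * e / sqrt Q)\<^sup>2 = (sqrt (2 * r * L))\<^sup>2" using eq1 by (simp add: Q_def)
    then show ?thesis using Q r L by (simp add: power_divide power_mult_distrib)
  qed
  have sq2: "(t\<^sup>2 - e\<^sup>2)\<^sup>2 / Q = 2 * s * L"
  proof -
    have "(\<bar>t\<^sup>2 - e\<^sup>2\<bar> / sqrt Q)\<^sup>2 = (sqrt (2 * s * L))\<^sup>2" using eq2 by (simp add: Q_def)
    then show ?thesis using Q s L by (simp add: power_divide)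
  qed
  have "4 * t\<^sup>2 * e\<^sup>2 + (t\<^sup>2 - e\<^sup>2)\<^sup>2 = Q * Q" by (simp add: Q_def power2_eq_square algebra_simps)
  then have "Q = 4 * t\<^sup>2 * e\<^sup>2 / Q + (t\<^sup>2 - e\<^sup>2)\<^sup>2 / Q"
    using Q by (simp add: add_divide_distrib[symmetric])
  then have "Q = 2 * L * c\<^sup>2" unfolding sq1 sq2 c(2) by (simp add: algebra_simps)
  then have sum: "t\<^sup>2 + e\<^sup>2 = 2 * L * c\<^sup>2" by (simp only: Q_def)
  have sqrtQ: "sqrt Q = sqrt (2 * L) * c" unfolding Q_def sum using c(1) by (simp add: real_sqrt_mult)
  have "\<bar>t\<^sup>2 - e\<^sup>2\<bar> = sqrt (2 * s * L) * sqrt Q"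
    using eq2[folded Q_def] Q by (subst (asm) nonzero_divide_eq_eq) auto
  also have "sqrt (2 * s * L) = sqrt (2 * L) * w" by (simp add: w_def real_sqrt_mult)
  finally have diff: "\<bar>t\<^sup>2 - e\<^sup>2\<bar> = 2 * L * (c * w)"
    unfolding sqrtQ using L by (simp add: algebra_simps)
  have root: "x = sqrt (y / 2) * sqrt (2 * L)" if "2 * x\<^sup>2 = 2 * L * y" "x \<ge> 0" for x y
  proof -
    have "x\<^sup>2 = y / 2 * (2 * L)" using that by simp
    then show ?thesis using that(2) by (metis real_sqrt_abs real_sqrt_mult abs_of_nonneg)
  qed
  have a: "a1 = sqrt (c * (c + w) / 2)" "a2 = sqrt (c * (c - w) / 2)" by (simp_all add: a1_def a2_def c_def w_def)
  consider "t\<^sup>2 - e\<^sup>2 = 2 * L * (c * w)" | "e\<^sup>2 - t\<^sup>2 = 2 * L * (c * w)" using diff by linarith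
  then show ?thesis
  proof cases
    case 1
    have "2 * t\<^sup>2 = 2 * L * (c * (c + w))" "2 * e\<^sup>2 = 2 * L * (c * (c - w))"
      using 1 sum by (simp_all add: algebra_simps power2_eq_square)
    then show ?thesis using root t unfolding a by blast
  next
    case 2
    have "2 * e\<^sup>2 = 2 * L * (c * (c + w))" "2 * t\<^sup>2 = 2 * L * (c * (c - w))"
      using 2 sum by (simp_all add: algebra_simps power2_eq_square)
    then show ?thesis using root t unfolding a by blast
  qed
qed

theorem theorem5p2:
  fixes \<beta> r s :: real
    and p q :: "nat \<Rightarrow> nat"
    and \<theta> \<eta> :: "nat \<Rightarrow> vec"
    and thalg etalg :: "nat \<Rightarrow> algorithm"
    and dflt :: "nat \<Rightarrow> sample \<Rightarrow> real"
  assumes "\<beta> > 0" and "r > 0" and "s \<ge> 0"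
    and "\<And>n. n \<ge> 2 \<Longrightarrow>
      2 * vnorm (p n) (\<theta> n) * vnorm (q n) (\<eta> n)
        / sqrt ((vnorm (p n) (\<theta> n))\<^sup>2 + (vnorm (q n) (\<eta> n))\<^sup>2) = sqrt (2 * r * ln (real n))"
    and "\<And>n. n \<ge> 2 \<Longrightarrow>
      \<bar>(vnorm (p n) (\<theta> n))\<^sup>2 - (vnorm (q n) (\<eta> n))\<^sup>2\<bar>
        / sqrt ((vnorm (p n) (\<theta> n))\<^sup>2 + (vnorm (q n) (\<eta> n))\<^sup>2) = sqrt (2 * s * ln (real n))"
    and "\<And>n. measurable_algorithm n (p n) (q n) (p n) (thalg n)"
    and "\<And>n. measurable_algorithm n (p n) (q n) (q n) (etalg n)"
    and "\<And>n. dflt n \<in> borel_measurable (sample_space n (p n) (q n))"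
    and "\<And>n \<omega>. 0 \<le> dflt n \<omega> \<and> dflt n \<omega> \<le> 1"
    and "\<exists>\<gamma>>0. (\<lambda>n. SUP (z, \<sigma>)\<in>signs n \<times> signs n.
           measure (law n (p n) (q n) (\<theta> n) (\<eta> n) z \<sigma>)
             {\<omega> \<in> space (law n (p n) (q n) (\<theta> n) (\<eta> n) z \<sigma>).
                max (loss (p n) (estimate n (thalg n) \<omega>) (\<theta> n))
                    (loss (q n) (estimate n (etalg n) \<omega>) (\<eta> n)) > real n powr (- \<gamma>)})
         \<longlonglongrightarrow> 0"
    and "\<beta> < beta_star r s"
  shows "(\<lambda>n. risk n (p n) (q n)
                 (ada_HC_test n (p n) (q n) (thalg n) (etalg n) (dflt n))
                 (\<theta> n) (\<eta> n) (real n powr (- \<beta>)))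
           \<longlonglongrightarrow> 0"
proof -
  note alg = assms(6,7) and dflt = assms(9)
  obtain \<gamma> where gam: "\<gamma> > 0" and est: "(\<lambda>n. SUP (z, \<sigma>)\<in>signs n \<times> signs n.
           measure (law n (p n) (q n) (\<theta> n) (\<eta> n) z \<sigma>)
             {\<omega> \<in> space (law n (p n) (q n) (\<theta> n) (\<eta> n) z \<sigma>).
                max (loss (p n) (estimate n (thalg n) \<omega>) (\<theta> n))
                    (loss (q n) (estimate n (etalg n) \<omega>) (\<eta> n)) > real n powr (- \<gamma>)}) \<longlonglongrightarrow> 0"
    using assms(10) by blast
  define Pr where "Pr = (\<lambda>n z \<sigma>. measure (law n (p n) (q n) (\<theta> n) (\<eta> n) z \<sigma>)
             {\<omega> \<in> space (law n (p n) (q n) (\<theta> n) (\<eta> n) z \<sigma>).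
                max (loss (p n) (estimate n (thalg n) \<omega>) (\<theta> n))
                    (loss (q n) (estimate n (etalg n) \<omega>) (\<eta> n)) > real n powr (- \<gamma>)})"
  define B where "B = (\<lambda>n. SUP (z, \<sigma>)\<in>signs n \<times> signs n. Pr n z \<sigma>)"
  have B0: "B \<longlonglongrightarrow> 0" using est unfolding B_def Pr_def .
  have B: "Pr n z \<sigma> \<le> B n" if "z \<in> signs n" "\<sigma> \<in> signs n" for n z \<sigma>
  proof -
    have "(\<lambda>(z, \<sigma>). Pr n z \<sigma>) (z, \<sigma>) \<le> B n"
      unfolding B_def using that by (intro cSUP_upper bdd_above_finite finite_imageI finite_cartesian_product finite_signs) auto
    then show ?thesis by simp
  qed
  define c where "c = sqrt (r + s)"
  define w where "w = sqrt s"
  define \<alpha>1 where "\<alpha>1 = sqrt (c * (c + w) / 2)"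
  define \<alpha>2 where "\<alpha>2 = sqrt (c * (c - w) / 2)"
  have c: "c > 0" "c\<^sup>2 = r + s" "w \<ge> 0" "w\<^sup>2 = s" "w < c" using assms(2,3) by (auto simp: c_def w_def)
  have pos: "\<alpha>1 > 0" "\<alpha>2 > 0" using c by (auto simp: \<alpha>1_def \<alpha>2_def)
  have sq: "\<alpha>1\<^sup>2 = c * (c + w) / 2" "\<alpha>2\<^sup>2 = c * (c - w) / 2" using c by (auto simp: \<alpha>1_def \<alpha>2_def)
  have prod: "2 * \<alpha>1 * \<alpha>2 = sqrt (r + s) * sqrt r"
  proof -
    have "c * (c + w) / 2 * (c * (c - w) / 2) = (c / 2)\<^sup>2 * (c\<^sup>2 - w\<^sup>2)" by (simp add: power2_eq_square algebra_simps)
    then have "c * (c + w) / 2 * (c * (c - w) / 2) = (c / 2)\<^sup>2 * r" using c by simp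
    then have "\<alpha>1 * \<alpha>2 = sqrt ((c / 2)\<^sup>2 * r)" unfolding \<alpha>1_def \<alpha>2_def real_sqrt_mult[symmetric] by simp
    also have "\<dots> = c / 2 * sqrt r" using c(1) by (simp add: real_sqrt_mult)
    finally show ?thesis unfolding c_def by simp
  qed
  have diff: "\<bar>\<alpha>1\<^sup>2 - \<alpha>2\<^sup>2\<bar> = sqrt (r + s) * sqrt s"
  proof -
    have "\<alpha>1\<^sup>2 - \<alpha>2\<^sup>2 = c * w" unfolding sq by (simp add: field_simps)
    then show ?thesis using c by (simp add: c_def w_def)
  qed
  have swapped: "2 * \<alpha>2 * \<alpha>1 = sqrt (r + s) * sqrt r" "\<bar>\<alpha>2\<^sup>2 - \<alpha>1\<^sup>2\<bar> = sqrt (r + s) * sqrt s"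
    using prod diff by (simp_all add: mult_ac abs_minus_commute)
  obtain \<delta>1 where \<delta>1: "\<delta>1 \<longlonglongrightarrow> 0" and bound1: "\<forall>\<^sub>F n in sequentially. uniform_risk_bound n \<beta> \<gamma> \<alpha>1 \<alpha>2 (\<delta>1 n)"
    using eventually_risk_bound[OF assms(2,3,1,11) gam pos prod diff] by (elim exE conjE)
  obtain \<delta>2 where \<delta>2: "\<delta>2 \<longlonglongrightarrow> 0" and bound2: "\<forall>\<^sub>F n in sequentially. uniform_risk_bound n \<beta> \<gamma> \<alpha>2 \<alpha>1 (\<delta>2 n)"
    using eventually_risk_bound[OF assms(2,3,1,11) gam pos(2,1) swapped] by (elim exE conjE)
  define R where "R = (\<lambda>n. risk n (p n) (q n) (ada_HC_test n (p n) (q n) (thalg n) (etalg n) (dflt n)) (\<theta> n) (\<eta> n) (real n powr (- \<beta>)))"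
  \<comment> \<open>Which norm is the larger one may change with \<open>n\<close>, so both error
    sequences are added to cover either case.\<close>
  have "\<forall>\<^sub>F n in sequentially. 0 \<le> R n \<and> R n \<le> 2 * B n + \<bar>\<delta>1 n\<bar> + \<bar>\<delta>2 n\<bar>"
    using bound1 bound2 eventually_ge_at_top[of 2]
  proof eventually_elim
    case (elim n)
    have "ln (real n) > 0" using elim(3) by simp
    note norms = norms_from_ratios[OF _ _ assms(2,3) this assms(4,5)[OF elim(3)], folded c_def w_def, folded \<alpha>1_def \<alpha>2_def]
    have "vnorm (p n) (\<theta> n) \<ge> 0" "vnorm (q n) (\<eta> n) \<ge> 0" by (simp_all add: vnorm_def)
    note cases = norms[OF this]
    have dflt': "\<forall>\<omega>. 0 \<le> dflt n \<omega> \<and> dflt n \<omega> \<le> 1" using dflt by blast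
    have Pr: "\<forall>z\<in>signs n. \<forall>\<sigma>\<in>signs n. Pr n z \<sigma> \<le> B n" using B by blast
    note b1 = elim(1)[unfolded uniform_risk_bound_def, THEN spec[where x = "p n"], THEN spec[where x = "q n"], THEN spec[where x = "\<theta> n"], THEN spec[where x = "\<eta> n"], THEN spec[where x = "thalg n"], THEN spec[where x = "etalg n"], THEN spec[where x = "dflt n"], THEN spec[where x = "B n"], THEN mp, OF alg(1)[of n], THEN mp, OF alg(2)[of n], THEN mp, OF dflt', THEN mp, THEN mp, THEN mp, OF _ _ Pr[unfolded Pr_def]]
    note b2 = elim(2)[unfolded uniform_risk_bound_def, THEN spec[where x = "p n"], THEN spec[where x = "q n"], THEN spec[where x = "\<theta> n"], THEN spec[where x = "\<eta> n"], THEN spec[where x = "thalg n"], THEN spec[where x = "etalg n"], THEN spec[where x = "dflt n"], THEN spec[where x = "B n"], THEN mp, OF alg(1)[of n], THEN mp, OF alg(2)[of n], THEN mp, OF dflt', THEN mp, THEN mp, THEN mp, OF _ _ Pr[unfolded Pr_def]]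
    show ?case using cases
    proof (elim disjE conjE)
      assume "vnorm (p n) (\<theta> n) = \<alpha>1 * sqrt (2 * ln (real n))" "vnorm (q n) (\<eta> n) = \<alpha>2 * sqrt (2 * ln (real n))"
      from b1[OF this] have "0 \<le> R n \<and> R n \<le> 2 * B n + \<delta>1 n" unfolding R_def by blast
      then show ?thesis by linarith
    next
      assume "vnorm (p n) (\<theta> n) = \<alpha>2 * sqrt (2 * ln (real n))" "vnorm (q n) (\<eta> n) = \<alpha>1 * sqrt (2 * ln (real n))"
      from b2[OF this] have "0 \<le> R n \<and> R n \<le> 2 * B n + \<delta>2 n" unfolding R_def by blast
      then show ?thesis by linarith
    qed
  qed
  then have "\<forall>\<^sub>F n in sequentially. 0 \<le> R n" "\<forall>\<^sub>F n in sequentially. R n \<le> 2 * B n + \<bar>\<delta>1 n\<bar> + \<bar>\<delta>2 n\<bar>"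
    by (auto elim: eventually_mono)
  moreover have "(\<lambda>n. 2 * B n + \<bar>\<delta>1 n\<bar> + \<bar>\<delta>2 n\<bar>) \<longlonglongrightarrow> 0"
    using tendsto_add[OF tendsto_add[OF tendsto_mult_right_zero[OF B0, of 2] tendsto_rabs_zero[OF \<delta>1]] tendsto_rabs_zero[OF \<delta>2]] by simp
  ultimately have "R \<longlonglongrightarrow> 0" by (rule tendsto_sandwich[OF _ _ tendsto_const])
  then show ?thesis unfolding R_def .
qed

end
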